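(* Let $\mathbb{K}$ be a field. For every graph $G$, we have $$\operatorname{ind-match}_{\{K_2,C_5\}}(G)\leq \operatorname{reg}(S/I(G))\leq \operatorname{min-match}_{\{K_2,C_5\}}(G).$$
   Context: All graphs are finite and simple. For a graph $G$ with vertex set $\{v_1,\dots,v_n\}$, $S=\mathbb{K}[x_1,\dots,x_n]$ is the polynomial ring over $\mathbb{K}$ with one variable per vertex, and $I(G)=(x_ix_j : v_iv_j\in E(G))\subseteq S$ is the edge ideal. For a finitely generated graded $S$-module $M$ with graded Betti numbers $\beta_{i,j}(M)$, the Castelnuovo--Mumford regularity is $\operatorname{reg}(M)=\max\{j-i : \beta_{i,j}(M)\neq 0\}$. $K_2$ is the complete graph on two vertices and $C_5$ the cycle on five vertices. A matching of $G$ is a set of pairwise disjoint edges; $\operatorname{match}(G)$ is the largest cardinality of a matching of $G$. For a graph $G$ with at least one edge, a $\{K_2,C_5\}$-subgraph of $G$ is a (nonempty) subgraph of $G$ each of whose connected components is isomorphic to $K_2$ or $C_5$; it is an induced $\{K_2,C_5\}$-subgraph if moreover it is an induced subgraph of $G$. A $\{K_2,C_5\}$-subgraph $H$ of $G$ is maximal if $G\setminus V(H)$ (the graph obtained from $G$ by deleting the vertices of $H$) has no $\{K_2,C_5\}$-subgraph. Define $$\operatorname{ind-match}_{\{K_2,C_5\}}(G)=\max\{\operatorname{match}(H) : H \text{ is an induced } \{K_2,C_5\}\text{-subgraph of } G\},$$ $$\operatorname{min-match}_{\{K_2,C_5\}}(G)=\min\{\operatorname{match}(H) : H \text{ is a maximal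 } \{K_2,C_5\}\text{-subgraph of } G\},$$ and set both equal to $0$ if $G$ has no edge. *)

theory Defs
  imports "HOL-Library.Poly_Mapping" "HOL-Algebra.Module" "HOL-Algebra.QuotRing"
begin

section \<open>Graphs\<close>

type_synonym 'v graph = "'v set \<times> 'v set set"

abbreviation verts :: "'v graph \<Rightarrow> 'v set" where "verts \<equiv> fst"
abbreviation edges :: "'v graph \<Rightarrow> 'v set set" where "edges \<equiv> snd"

definition finite_simple_graph :: "'v graph \<Rightarrow> bool" where
  "finite_simple_graph G \<longleftrightarrow>
     finite (verts G) \<and> edges G \<subseteq> {{u, v} | u v. u \<in> verts G \<and> v \<in> verts G \<and> u \<noteq> v}"

definition subgraph_of :: "'v graph \<Rightarrow> 'v graph \<Rightarrow> bool" where
  "subgraph_of H G \<longleftrightarrow>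
     finite_simple_graph H \<and> verts H \<subseteq> verts G \<and> edges H \<subseteq> edges G"

definition induced_on :: "'v graph \<Rightarrow> 'v set \<Rightarrow> 'v graph" where
  "induced_on G W = (verts G \<inter> W, {e \<in> edges G. e \<subseteq> W})"

definition delete_verts :: "'v graph \<Rightarrow> 'v set \<Rightarrow> 'v graph" where
  "delete_verts G W = induced_on G (verts G - W)"

definition induced_subgraph_of :: "'v graph \<Rightarrow> 'v graph \<Rightarrow> bool" where
  "induced_subgraph_of H G \<longleftrightarrow> subgraph_of H G \<and> H = induced_on G (verts H)"

definition components :: "'v graph \<Rightarrow> 'v graph set" where
  "components G =
     {induced_on G {w. (v, w) \<in> {(a, b). {a, b} \<in> edges G}\<^sup>*} | v. v \<in> verts G}"

definition graph_iso :: "'v graph \<Rightarrow> 'w graph \<Rightarrow> bool" where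
  "graph_iso G H \<longleftrightarrow>
     (\<exists>f. bij_betw f (verts G) (verts H) \<and>
          (\<forall>u\<in>verts G. \<forall>v\<in>verts G. {u, v} \<in> edges G \<longleftrightarrow> {f u, f v} \<in> edges H))"

definition K2 :: "nat graph" where
  "K2 = ({0, 1}, {{0, 1}})"

definition C5 :: "nat graph" where
  "C5 = ({0..<5}, {{i, (i + 1) mod 5} | i. i < 5})"

definition K2_C5_subgraph :: "'v graph \<Rightarrow> 'v graph \<Rightarrow> bool" where
  "K2_C5_subgraph H G \<longleftrightarrow>
     subgraph_of H G \<and> verts H \<noteq> {} \<and> (\<forall>C\<in>components H. graph_iso C K2 \<or> graph_iso C C5)"

definition induced_K2_C5_subgraph :: "'v graph \<Rightarrow> 'v graph \<Rightarrow> bool" where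
  "induced_K2_C5_subgraph H G \<longleftrightarrow> K2_C5_subgraph H G \<and> induced_subgraph_of H G"

definition maximal_K2_C5_subgraph :: "'v graph \<Rightarrow> 'v graph \<Rightarrow> bool" where
  "maximal_K2_C5_subgraph H G \<longleftrightarrow>
     K2_C5_subgraph H G \<and> (\<nexists>H'. K2_C5_subgraph H' (delete_verts G (verts H)))"

definition matching_of :: "'v set set \<Rightarrow> 'v graph \<Rightarrow> bool" where
  "matching_of M G \<longleftrightarrow> M \<subseteq> edges G \<and> pairwise disjnt M"

definition matching_number :: "'v graph \<Rightarrow> nat" where
  "matching_number G = Max {card M | M. matching_of M G}"

definition ind_match_K2_C5 :: "'v graph \<Rightarrow> nat" where
  "ind_match_K2_C5 G =
     (if edges G = {} then 0 else Max {matching_number H | H. induced_K2_C5_subgraph H G})"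

definition min_match_K2_C5 :: "'v graph \<Rightarrow> nat" where
  "min_match_K2_C5 G =
     (if edges G = {} then 0 else Min {matching_number H | H. maximal_K2_C5_subgraph H G})"


section \<open>Polynomial rings and graded modules\<close>

text \<open>A monomial is a finitely supported exponent function, so \<open>('v, 'k) mpoly\<close> contains
  the polynomials in all variables of type \<open>'v\<close>; \<open>poly_ring V\<close> is the subring of
  those that involve only the variables indexed by \<open>V\<close>.\<close>

type_synonym ('v, 'k) mpoly = "('v \<Rightarrow>\<^sub>0 nat) \<Rightarrow>\<^sub>0 'k"

definition var :: "'v \<Rightarrow> ('v, 'k::field) mpoly" where
  "var v = Poly_Mapping.single (Poly_Mapping.single v 1) 1"

definition poly_ring :: "'v set \<Rightarrow> ('v, 'k::field) mpoly ring" where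
  "poly_ring V =
     \<lparr>carrier = {p. \<forall>m\<in>Poly_Mapping.keys p. Poly_Mapping.keys m \<subseteq> V},
      mult = (*), one = 1, zero = 0, add = (+)\<rparr>"

definition monom_degree :: "('v \<Rightarrow>\<^sub>0 nat) \<Rightarrow> nat" where
  "monom_degree m = (\<Sum>v\<in>Poly_Mapping.keys m. Poly_Mapping.lookup m v)"

definition homogeneous_part :: "'v set \<Rightarrow> int \<Rightarrow> ('v, 'k::field) mpoly set" where
  "homogeneous_part V j =
     {p \<in> carrier (poly_ring V). \<forall>m\<in>Poly_Mapping.keys p. int (monom_degree m) = j}"

definition irrelevant_ideal :: "'v set \<Rightarrow> ('v, 'k::field) mpoly set" where
  "irrelevant_ideal V = Idl\<^bsub>poly_ring V\<^esub> (var ` V)"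

text \<open>The record type \<open>module\<close> inherits the fields \<open>mult\<close> and \<open>one\<close> from \<open>ring\<close>;
  they carry no meaning for a module.\<close>

definition free_module :: "('a, 'c) ring_scheme \<Rightarrow> nat \<Rightarrow> ('a, nat \<Rightarrow> 'a) module" where
  "free_module R n =
     \<lparr>carrier = {f. (\<forall>b<n. f b \<in> carrier R) \<and> (\<forall>b\<ge>n. f b = \<zero>\<^bsub>R\<^esub>)},
      mult = undefined, one = undefined,
      zero = (\<lambda>b. \<zero>\<^bsub>R\<^esub>), add = (\<lambda>f g b. f b \<oplus>\<^bsub>R\<^esub> g b),
      smult = (\<lambda>a f b. a \<otimes>\<^bsub>R\<^esub> f b)\<rparr>"

definition quotient_module :: "('a, 'c) ring_scheme \<Rightarrow> 'a set \<Rightarrow> ('a, 'a set) module" where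
  "quotient_module R I =
     \<lparr>carrier = carrier (R Quot I), mult = mult (R Quot I), one = one (R Quot I),
      zero = zero (R Quot I), add = add (R Quot I),
      smult = (\<lambda>a X. (I +>\<^bsub>R\<^esub> a) \<otimes>\<^bsub>R Quot I\<^esub> X)\<rparr>"

definition module_hom ::
    "('a, 'c) ring_scheme \<Rightarrow> ('a, 'b, 'd) module_scheme \<Rightarrow> ('a, 'e, 'f) module_scheme
      \<Rightarrow> ('b \<Rightarrow> 'e) set" where
  "module_hom R M N =
     {h \<in> carrier M \<rightarrow> carrier N.
        (\<forall>x\<in>carrier M. \<forall>y\<in>carrier M. h (x \<oplus>\<^bsub>M\<^esub> y) = h x \<oplus>\<^bsub>N\<^esub> h y) \<and>
        (\<forall>a\<in>carrier R. \<forall>x\<in>carrier M. h (a \<odot>\<^bsub>M\<^esub> x) = a \<odot>\<^bsub>N\<^esub> h x)}"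

text \<open>A grading of a module is given by its family of homogeneous components.
  With \<open>S = poly_ring V\<close>, the component of degree \<open>j\<close> of the graded free module
  \<open>\<Oplus>\<^sub>b S(- d b)\<close>, whose basis element with index \<open>b\<close> has degree \<open>d b\<close>, is:\<close>

definition free_grading ::
    "'v set \<Rightarrow> nat \<Rightarrow> (nat \<Rightarrow> int) \<Rightarrow> int \<Rightarrow> (nat \<Rightarrow> ('v, 'k::field) mpoly) set" where
  "free_grading V n d j =
     {f \<in> carrier (free_module (poly_ring V) n). \<forall>b<n. f b \<in> homogeneous_part V (j - d b)}"

definition quotient_grading ::
    "'v set \<Rightarrow> ('v, 'k::field) mpoly set \<Rightarrow> int \<Rightarrow> ('v, 'k) mpoly set set" where
  "quotient_grading V I j = {I +>\<^bsub>poly_ring V\<^esub> p | p. p \<in> homogeneous_part V j}"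


section \<open>Minimal graded free resolutions, Betti numbers and regularity\<close>

text \<open>The data of a complex \<open>\<dots> \<rightarrow> F\<^sub>2 \<rightarrow> F\<^sub>1 \<rightarrow> F\<^sub>0 \<rightarrow> M\<close> of finitely generated
  graded free modules: \<open>F\<^sub>i\<close> has rank \<open>res_rank i\<close> and basis degrees \<open>res_shift i\<close>,
  the last map is \<open>res_aug\<close>, and \<open>res_diff i\<close> is the map from \<open>F\<^sub>i\<^sub>+\<^sub>1\<close> to \<open>F\<^sub>i\<close>.\<close>

record (overloaded) ('v, 'k, 'm) free_complex =
  res_rank :: "nat \<Rightarrow> nat"
  res_shift :: "nat \<Rightarrow> nat \<Rightarrow> int"
  res_aug :: "(nat \<Rightarrow> ('v, 'k) mpoly) \<Rightarrow> 'm"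
  res_diff :: "nat \<Rightarrow> (nat \<Rightarrow> ('v, 'k) mpoly) \<Rightarrow> nat \<Rightarrow> ('v, 'k) mpoly"

definition res_module ::
    "'v set \<Rightarrow> ('v, 'k::field, 'm) free_complex \<Rightarrow> nat
      \<Rightarrow> (('v, 'k) mpoly, nat \<Rightarrow> ('v, 'k) mpoly) module" where
  "res_module V F i = free_module (poly_ring V) (res_rank F i)"

definition res_grading ::
    "'v set \<Rightarrow> ('v, 'k::field, 'm) free_complex \<Rightarrow> nat \<Rightarrow> int
      \<Rightarrow> (nat \<Rightarrow> ('v, 'k) mpoly) set" where
  "res_grading V F i = free_grading V (res_rank F i) (res_shift F i)"

definition graded_free_resolution ::
    "'v set \<Rightarrow> (('v, 'k::field) mpoly, 'm) module \<Rightarrow> (int \<Rightarrow> 'm set)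
      \<Rightarrow> ('v, 'k, 'm) free_complex \<Rightarrow> bool" where
  "graded_free_resolution V M gr F \<longleftrightarrow>
     res_aug F \<in> module_hom (poly_ring V) (res_module V F 0) M \<and>
     (\<forall>i. res_diff F i \<in> module_hom (poly_ring V) (res_module V F (Suc i)) (res_module V F i)) \<and>
     (\<forall>j. res_aug F ` res_grading V F 0 j \<subseteq> gr j) \<and>
     (\<forall>i j. res_diff F i ` res_grading V F (Suc i) j \<subseteq> res_grading V F i j) \<and>
     res_aug F ` carrier (res_module V F 0) = carrier M \<and>
     {f \<in> carrier (res_module V F 0). res_aug F f = \<zero>\<^bsub>M\<^esub>}
       = res_diff F 0 ` carrier (res_module V F 1) \<and>
     (\<forall>i. {f \<in> carrier (res_module V F (Suc i)). res_diff F i f = \<zero>\<^bsub>res_module V F i\<^esub>}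
       = res_diff F (Suc i) ` carrier (res_module V F (Suc (Suc i))))"

text \<open>Minimality says that \<open>F\<^sub>i\<^sub>+\<^sub>1\<close> is mapped into \<open>\<mm> F\<^sub>i\<close>, that is, all
  coordinates of elements of the image lie in the irrelevant ideal \<open>\<mm>\<close>.\<close>

definition minimal_graded_free_resolution ::
    "'v set \<Rightarrow> (('v, 'k::field) mpoly, 'm) module \<Rightarrow> (int \<Rightarrow> 'm set)
      \<Rightarrow> ('v, 'k, 'm) free_complex \<Rightarrow> bool" where
  "minimal_graded_free_resolution V M gr F \<longleftrightarrow>
     graded_free_resolution V M gr F \<and>
     (\<forall>i. \<forall>f\<in>carrier (res_module V F (Suc i)). \<forall>b<res_rank F i.
        res_diff F i f b \<in> irrelevant_ideal V)"

text \<open>A minimal graded free resolution of a finitely generated graded module exists and is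
  unique up to isomorphism, so the choice made here is immaterial.\<close>

definition graded_betti ::
    "'v set \<Rightarrow> (('v, 'k::field) mpoly, 'm) module \<Rightarrow> (int \<Rightarrow> 'm set) \<Rightarrow> nat \<Rightarrow> int \<Rightarrow> nat" where
  "graded_betti V M gr i j =
     (let F = (SOME F. minimal_graded_free_resolution V M gr F)
      in card {b. b < res_rank F i \<and> res_shift F i b = j})"

definition regularity ::
    "'v set \<Rightarrow> (('v, 'k::field) mpoly, 'm) module \<Rightarrow> (int \<Rightarrow> 'm set) \<Rightarrow> int" where
  "regularity V M gr = Max {j - int i | i j. graded_betti V M gr i j \<noteq> 0}"


section \<open>Edge ideals\<close>

definition edge_ideal :: "'v graph \<Rightarrow> ('v, 'k::field) mpoly set" where
  "edge_ideal G = Idl\<^bsub>poly_ring (verts G)\<^esub> {var u * var v | u v. {u, v} \<in> edges G}"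

definition reg_quotient :: "'v set \<Rightarrow> ('v, 'k::field) mpoly set \<Rightarrow> int" where
  "reg_quotient V I =
     regularity V (quotient_module (poly_ring V) I) (quotient_grading V I)"

end

theory Submission
  imports Defs "HOL-Library.Function_Algebras" "HOL.Vector_Spaces"
begin

text \<open>By shifting along short exact sequences, \<open>\<beta>\<^sub>i\<^sub>+\<^sub>1\<^sub>,\<^sub>j\<close> of \<open>S/I\<close> is nonzero for every minimal graded free
  resolution iff the Koszul homology of \<open>I\<close> in homological degree \<open>i\<close> and degree \<open>j\<close> is nonzero.
  For the edge ideal the latter splits by multidegree (Hochster's formula), and
  only squarefree multidegrees \<open>W\<close> with nonzero reduced cohomology of the independence complex of
  \<open>G[W]\<close> in dimension \<open>j - i - 2\<close> contribute, where \<open>j = |W|\<close>. So the regularity is the largest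
  \<open>k\<close> for which some \<open>G[W]\<close> has nonzero reduced cohomology in dimension \<open>k - 1\<close>.

  Upper bound: the deletion-link sequence of a vertex \<open>x\<close> bounds the regularity of \<open>G\<close> by the
  maximum of that of \<open>G - x\<close> and one plus that of \<open>G - N[x]\<close>. Hence removing both ends of an edge
  lowers it by at most 1 and removing a 5-cycle by at most 2, and the vertices outside a maximal
  subgraph are independent. Lower bound: the independence complex of a disjoint union of
  copies of \<open>K\<^sub>2\<close> and \<open>C\<^sub>5\<close> is a join of spheres \<open>S\<^sup>0\<close> and \<open>S\<^sup>1\<close>, and its fundamental cycle detects
  a top-dimensional class.\<close>

\<comment> \<open>Regularity is a \<open>Max\<close> over the Betti numbers of a resolution picked
  by \<open>SOME\<close>, so either bound presupposes three facts: a minimal resolution exists, the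
  set of values \<open>j - i\<close> is finite and nonempty, and it does not depend on the choice.
  All three come from Koszul homology with explicit chains, which replaces Tor: an arbitrary minimal
  resolution is cut into minimal covers, each shifting the homological index by one. In a squarefree
  multidegree W the Koszul chains of the ideal live on the Alexander dual of the independence
  complex of G[W], since the monomial of W - \<sigma> lies in the ideal iff W - \<sigma> contains an
  edge. This turns homology in index i into cohomology on faces of size |W| - i - 1 and accounts for
  the index shifts. The field is arbitrary and may have characteristic 2; acyclicity is always
  obtained from a cone contraction, which divides by nothing. Matchings enter both bounds because
  the matching number, the independence number and the dimension of the independence sphere plus one
  agree on the components: all are 1 for K_2 and 2 for C_5.\<close>
alias lookup = Poly_Mapping.lookup
alias keys = Poly_Mapping.keys
alias single = Poly_Mapping.single

section \<open>Koszul signs and the deletion-link sequence\<close>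

text \<open>Swapping the two indices only yields s = -s, which says nothing in characteristic 2. The
  induction cancels the terms for (v, w) and (w, v) directly.\<close>

lemma sum_antisymmetric_eq_0:
  fixes f :: "'a \<Rightarrow> 'a \<Rightarrow> 'b::ab_group_add"
  assumes "finite U" and "\<And>v w. v \<in> U \<Longrightarrow> w \<in> U \<Longrightarrow> v \<noteq> w \<Longrightarrow> f v w = - f w v"
  shows "(\<Sum>v\<in>U. \<Sum>w\<in>U - {v}. f v w) = 0"
  using assms
proof (induction U rule: finite_induct)
  case (insert u U)
  have A: "(\<Sum>w\<in>insert u U - {v}. f v w) = f v u + (\<Sum>w\<in>U - {v}. f v w)" if "v \<in> U" for v
  proof -
    have "insert u U - {v} = insert u (U - {v})" using that insert.hyps by auto
    then show ?thesis using insert.hyps by simp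
  qed
  have B: "(\<Sum>w\<in>insert u U - {u}. f u w) = - (\<Sum>v\<in>U. f v u)"
  proof -
    have "insert u U - {u} = U" using insert.hyps by auto
    moreover have "(\<Sum>w\<in>U. f u w) = (\<Sum>w\<in>U. - f w u)"
      by (intro sum.cong refl insert.prems) (use insert.hyps in auto)
    ultimately show ?thesis by (simp add: sum_negf)
  qed
  have "(\<Sum>v\<in>insert u U. \<Sum>w\<in>insert u U - {v}. f v w)
      = (\<Sum>w\<in>insert u U - {u}. f u w) + (\<Sum>v\<in>U. \<Sum>w\<in>insert u U - {v}. f v w)"
    by (rule sum.insert[OF insert.hyps])
  also have "(\<Sum>v\<in>U. \<Sum>w\<in>insert u U - {v}. f v w) = (\<Sum>v\<in>U. f v u + (\<Sum>w\<in>U - {v}. f v w))"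
    by (rule sum.cong[OF refl A])
  also have "(\<Sum>w\<in>insert u U - {u}. f u w) + (\<Sum>v\<in>U. f v u + (\<Sum>w\<in>U - {v}. f v w)) = 0"
  proof -
    have "(\<Sum>v\<in>U. \<Sum>w\<in>U - {v}. f v w) = 0"
      by (rule insert.IH, rule insert.prems) auto
    then show ?thesis unfolding B sum.distrib by simp
  qed
  finally show ?case .
qed simp

text \<open>A chain is the function of its coefficients. With \<open>t\<close> equal to a sign this
  is the simplicial boundary on the full simplex on \<open>V\<close>; with a sign times
  \<open>var v\<close> it is the Koszul differential.\<close>

definition koszul_bd :: "('v \<Rightarrow> 'v set \<Rightarrow> 'a::comm_ring_1) \<Rightarrow> 'v set \<Rightarrow> ('v set \<Rightarrow> 'a) \<Rightarrow> 'v set \<Rightarrow> 'a" where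
  "koszul_bd t V c \<tau> = (\<Sum>v\<in>V - \<tau>. t v \<tau> * c (insert v \<tau>))"

definition koszul_cobd :: "('v \<Rightarrow> 'v set \<Rightarrow> 'a::comm_ring_1) \<Rightarrow> ('v set \<Rightarrow> 'a) \<Rightarrow> 'v set \<Rightarrow> 'a" where
  "koszul_cobd t c \<tau> = (\<Sum>v\<in>\<tau>. t v (\<tau> - {v}) * c (\<tau> - {v}))"

text \<open>Up to sign, exterior multiplication by the basis vector of \<open>p\<close>.\<close>

definition cone :: "('v \<Rightarrow> 'v set \<Rightarrow> 'a::comm_ring_1) \<Rightarrow> 'v \<Rightarrow> ('v set \<Rightarrow> 'a) \<Rightarrow> 'v set \<Rightarrow> 'a" where
  "cone t p c \<sigma> = (if p \<in> \<sigma> then t p (\<sigma> - {p}) * c (\<sigma> - {p}) else 0)"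

text \<open>The identity is exactly what makes the differential square to zero. It is separated from
  \<open>sign_system\<close> because weights of the form sign times variable satisfy it without
  squaring to 1.\<close>

locale anticommuting =
  fixes V :: "'v set" and t :: "'v \<Rightarrow> 'v set \<Rightarrow> 'a::comm_ring_1"
  assumes finite_V: "finite V"
    and anti: "\<lbrakk>x \<in> V; v \<in> V; x \<noteq> v; x \<notin> A; v \<notin> A\<rbrakk>
      \<Longrightarrow> t x A * t v (insert x A) = - (t v A * t x (insert v A))"
begin

lemma bd_bd: "koszul_bd t V (koszul_bd t V c) \<tau> = 0"
proof -
  have "koszul_bd t V (koszul_bd t V c) \<tau> =
    (\<Sum>v\<in>V - \<tau>. \<Sum>w\<in>V - \<tau> - {v}. t v \<tau> * t w (insert v \<tau>) * c (insert w (insert v \<tau>)))"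
    unfolding koszul_bd_def sum_distrib_left
    by (intro sum.cong) (auto simp: mult.assoc)
  also have "\<dots> = 0"
  proof (rule sum_antisymmetric_eq_0)
    fix v w assume *: "v \<in> V - \<tau>" "w \<in> V - \<tau>" "v \<noteq> w"
    have "t v \<tau> * t w (insert v \<tau>) = - (t w \<tau> * t v (insert w \<tau>))"
      using * by (intro anti) auto
    then show "t v \<tau> * t w (insert v \<tau>) * c (insert w (insert v \<tau>)) =
       - (t w \<tau> * t v (insert w \<tau>) * c (insert v (insert w \<tau>)))"
      by (simp add: insert_commute)
  qed (use finite_V in auto)
  finally show ?thesis .
qed

lemma cobd_cobd:
  assumes "\<tau> \<subseteq> V"
  shows "koszul_cobd t (koszul_cobd t c) \<tau> = 0"
proof -
  have "koszul_cobd t (koszul_cobd t c) \<tau> =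
    (\<Sum>v\<in>\<tau>. \<Sum>w\<in>\<tau> - {v}. t v (\<tau> - {v}) * t w (\<tau> - {v} - {w}) * c (\<tau> - {v} - {w}))"
    unfolding koszul_cobd_def sum_distrib_left
    by (intro sum.cong) (auto simp: mult.assoc)
  also have "\<dots> = 0"
  proof (rule sum_antisymmetric_eq_0)
    fix v w assume *: "v \<in> \<tau>" "w \<in> \<tau>" "v \<noteq> w"
    define A where "A = \<tau> - {v} - {w}"
    have A: "\<tau> - {v} = insert w A" "\<tau> - {w} = insert v A" "\<tau> - {w} - {v} = A"
      using * by (auto simp: A_def)
    have "t v A * t w (insert v A) = - (t w A * t v (insert w A))"
      using * assms by (intro anti) (auto simp: A_def)
    then show "t v (\<tau> - {v}) * t w (\<tau> - {v} - {w}) * c (\<tau> - {v} - {w})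
       = - (t w (\<tau> - {w}) * t v (\<tau> - {w} - {v}) * c (\<tau> - {w} - {v}))"
      unfolding A(3) A_def[symmetric] unfolding A(1,2) by (simp add: mult.commute)
  qed (use finite_subset[OF assms finite_V] in auto)
  finally show ?thesis .
qed

end

locale sign_system = anticommuting V t
  for V :: "'v set" and t :: "'v \<Rightarrow> 'v set \<Rightarrow> 'a::comm_ring_1" +
  assumes sq: "t v A * t v A = 1"
begin

lemma sq_left [simp]: "t v A * (t v A * a) = a"
  by (simp add: mult.assoc[symmetric] sq)

lemma anti_swap:
  assumes "x \<in> V" "v \<in> V" "x \<noteq> v" "x \<notin> A" "v \<notin> A"
  shows "t v (insert x A) * t x (insert v A) = - (t x A * t v A)"
proof -
  have "t v (insert x A) * t x (insert v A)
     = t x A * (t x A * t v (insert x A)) * t x (insert v A)"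
    by simp
  also have "\<dots> = - (t x A * t v A * (t x (insert v A) * t x (insert v A)))"
    unfolding anti[OF assms] by (simp add: algebra_simps)
  finally show ?thesis by (simp add: sq)
qed

lemma anti_cancel:
  assumes "x \<in> V" "v \<in> V" "x \<noteq> v" "x \<notin> A" "v \<notin> A"
  shows "t v (insert x A) * t x A = - (t v A * t x (insert v A))"
  using anti[OF assms] by (simp add: mult.commute)

text \<open>The simplex on \<open>V\<close> is contractible, with \<open>cone t p\<close> as
  homotopy. If \<open>p\<close> is in \<open>\<tau>\<close>, the term for \<open>p\<close> in the
  inner boundary gives \<open>c \<tau>\<close> and all other terms cancel by
  \<open>anti_swap\<close>; otherwise only the term for \<open>p\<close> in the outer boundary
  survives.\<close>

lemma bd_cone:
  assumes p: "p \<in> V"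
  shows "koszul_bd t V (cone t p c) \<tau> + cone t p (koszul_bd t V c) \<tau> = c \<tau>"
proof (cases "p \<in> \<tau>")
  case False
  have "koszul_bd t V (cone t p c) \<tau> = (\<Sum>v\<in>V - \<tau>. if v = p then c \<tau> else 0)"
    unfolding koszul_bd_def
    by (intro sum.cong) (use False in \<open>auto simp: cone_def\<close>)
  also have "\<dots> = c \<tau>" using finite_V p False by simp
  finally show ?thesis using False by (simp add: cone_def)
next
  case True
  define A where "A = \<tau> - {p}"
  have \<tau>: "\<tau> = insert p A" "p \<notin> A" using True by (auto simp: A_def)
  have VA: "V - A = insert p (V - \<tau>)" using p \<tau> by auto
  have "cone t p (koszul_bd t V c) \<tau> = t p A * (\<Sum>v\<in>V - A. t v A * c (insert v A))"
    using True by (simp add: cone_def koszul_bd_def A_def)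
  also have "\<dots> = c \<tau> + (\<Sum>v\<in>V - \<tau>. t p A * (t v A * c (insert v A)))"
    unfolding VA using finite_V True \<tau> by (simp add: distrib_left sum_distrib_left)
  finally have 1: "cone t p (koszul_bd t V c) \<tau> = c \<tau> + (\<Sum>v\<in>V - \<tau>. t p A * (t v A * c (insert v A)))" .
  have "koszul_bd t V (cone t p c) \<tau> = (\<Sum>v\<in>V - \<tau>. - (t p A * (t v A * c (insert v A))))"
    unfolding koszul_bd_def
  proof (intro sum.cong refl)
    fix v assume v: "v \<in> V - \<tau>"
    have "insert v \<tau> - {p} = insert v A" using v \<tau> by auto
    then have "t v \<tau> * cone t p c (insert v \<tau>) = (t v (insert p A) * t p (insert v A)) * c (insert v A)"
      using \<tau>(1) by (simp add: cone_def mult.assoc)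
    also have "\<dots> = - (t p A * (t v A * c (insert v A)))"
      by (subst anti_swap) (use v \<tau> p in \<open>auto simp: mult.assoc\<close>)
    finally show "t v \<tau> * cone t p c (insert v \<tau>) = - (t p A * (t v A * c (insert v A)))" .
  qed
  then show ?thesis using 1 by (simp add: sum_negf)
qed

end

definition indep :: "'v set set \<Rightarrow> 'v set \<Rightarrow> bool" where
  "indep E \<tau> \<longleftrightarrow> (\<forall>e\<in>E. \<not> e \<subseteq> \<tau>)"

definition closed_nbhd :: "'v set set \<Rightarrow> 'v \<Rightarrow> 'v set" where
  "closed_nbhd E x = insert x {v. {x, v} \<in> E}"

lemma indep_mono: "indep E \<tau> \<Longrightarrow> \<tau>' \<subseteq> \<tau> \<Longrightarrow> indep E \<tau>'"
  unfolding indep_def by blast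

text \<open>The reduced cohomology of the independence complex of \<open>(W, E)\<close> vanishes in dimension
  \<open>k - 1\<close>.\<close>

definition coh_vanishes ::
    "'v set set \<Rightarrow> ('v \<Rightarrow> 'v set \<Rightarrow> 'a::comm_ring_1) \<Rightarrow> 'v set \<Rightarrow> nat \<Rightarrow> bool" where
  "coh_vanishes E t W k \<longleftrightarrow> (\<forall>\<gamma>.
     (\<forall>\<tau>\<subseteq>W. indep E \<tau> \<and> card \<tau> = Suc k \<longrightarrow> koszul_cobd t \<gamma> \<tau> = 0) \<longrightarrow>
     (\<exists>\<eta>. \<forall>\<tau>\<subseteq>W. indep E \<tau> \<and> card \<tau> = k \<longrightarrow> \<gamma> \<tau> = koszul_cobd t \<eta> \<tau>))"

lemma indep_insert:
  assumes E: "E \<subseteq> {{u, v} | u v. u \<in> V \<and> v \<in> V \<and> u \<noteq> v}"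
    and "indep E \<tau>" "\<tau> \<inter> closed_nbhd E x = {}"
  shows "indep E (insert x \<tau>)"
  unfolding indep_def
proof safe
  fix e assume e: "e \<in> E" "e \<subseteq> insert x \<tau>"
  from e E obtain u v where uv: "e = {u, v}" "u \<noteq> v" by blast
  show False
  proof (cases "x \<in> e")
    case True
    then obtain w where "e = {x, w}" "w \<noteq> x" using uv by auto
    then show False using e assms(3) by (auto simp: closed_nbhd_def)
  next
    case False
    then show False using e assms(2) by (auto simp: indep_def)
  qed
qed

lemma indep_remove:
  assumes "indep E \<tau>" "x \<in> \<tau>"
  shows "(\<tau> - {x}) \<inter> closed_nbhd E x = {}"
  using assms by (auto simp: indep_def closed_nbhd_def)

context sign_system
begin

text \<open>Splits a cochain at \<open>x\<close> into its restriction to faces avoiding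
  \<open>x\<close> and the cochain \<open>t x B * c (insert x B)\<close> on the link. This is the
  algebra behind the deletion-link sequence.\<close>

lemma cobd_insert:
  assumes x: "x \<in> V" "x \<notin> A" and A: "A \<subseteq> V"
  shows "koszul_cobd t c (insert x A)
    = t x A * (c A - koszul_cobd t (\<lambda>B. t x B * c (insert x B)) A)"
proof -
  have fA: "finite A" using A finite_V by (rule finite_subset)
  have "(\<Sum>v\<in>A. t v (insert x A - {v}) * c (insert x A - {v}))
    = (\<Sum>v\<in>A. - (t x A * (t v (A - {v}) * (t x (A - {v}) * c (insert x (A - {v}))))))"
  proof (intro sum.cong refl)
    fix v assume v: "v \<in> A"
    define B where "B = A - {v}"
    have B: "insert x A - {v} = insert x B" "A = insert v B" "v \<notin> B" "x \<notin> B" "x \<noteq> v"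
      using v x by (auto simp: B_def)
    have vV: "v \<in> V" using v A by auto
    have "t v (insert x B) = t v (insert x B) * t x B * t x B" by (simp add: mult.assoc sq)
    also have "\<dots> = - (t v B * t x (insert v B)) * t x B"
      by (subst anti_cancel) (use B x vV in auto)
    finally have "t v (insert x B) = - (t x (insert v B) * (t v B * t x B))"
      by (simp add: mult_ac)
    then show "t v (insert x A - {v}) * c (insert x A - {v})
      = - (t x A * (t v (A - {v}) * (t x (A - {v}) * c (insert x (A - {v})))))"
      unfolding B(1) B_def[symmetric] using B(2) by (simp add: mult_ac)
  qed
  then show ?thesis
    unfolding koszul_cobd_def using x fA
    by (simp add: sum_negf sum_distrib_left right_diff_distrib)
qed

text \<open>The independence complex is a cone with apex \<open>x\<close>, so even the class in
  dimension -1 (\<open>k = 0\<close>) dies; the primitive is contraction with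
  \<open>x\<close>.\<close>

lemma coh_vanishes_isolated:
  assumes E: "E \<subseteq> {{u, v} | u v. u \<in> V \<and> v \<in> V \<and> u \<noteq> v}"
    and x: "x \<in> W" "W \<inter> closed_nbhd E x = {x}" and W: "W \<subseteq> V"
  shows "coh_vanishes E t W k"
  unfolding coh_vanishes_def
proof (intro allI impI)
  fix \<gamma> assume cyc: "\<forall>\<tau>\<subseteq>W. indep E \<tau> \<and> card \<tau> = Suc k \<longrightarrow> koszul_cobd t \<gamma> \<tau> = 0"
  let ?\<eta> = "\<lambda>B. if x \<in> B then 0 else t x B * \<gamma> (insert x B)"
  have "\<gamma> \<tau> = koszul_cobd t ?\<eta> \<tau>" if \<tau>: "\<tau> \<subseteq> W" "indep E \<tau>" "card \<tau> = k" for \<tau>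
  proof (cases "x \<in> \<tau>")
    case True
    have "koszul_cobd t ?\<eta> \<tau> = (\<Sum>v\<in>\<tau>. if v = x then \<gamma> \<tau> else 0)"
      unfolding koszul_cobd_def
      by (intro sum.cong) (use True in \<open>auto simp: insert_absorb\<close>)
    also have "\<dots> = \<gamma> \<tau>" using True finite_subset[OF subset_trans[OF \<tau>(1) W] finite_V] by simp
    finally show ?thesis by simp
  next
    case False
    have fin: "finite \<tau>" using \<tau> W finite_V finite_subset by (meson)
    have "indep E (insert x \<tau>)"
      by (rule indep_insert[OF E]) (use \<tau> False x in auto)
    then have "koszul_cobd t \<gamma> (insert x \<tau>) = 0"
      using cyc \<tau> x False fin by auto
    then have "t x \<tau> * (\<gamma> \<tau> - koszul_cobd t (\<lambda>B. t x B * \<gamma> (insert x B)) \<tau>) = 0"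
      using cobd_insert[of x \<tau> \<gamma>] False x \<tau> W by auto
    then have "\<gamma> \<tau> - koszul_cobd t (\<lambda>B. t x B * \<gamma> (insert x B)) \<tau> = 0"
      by (metis sq_left mult_zero_right)
    moreover have "koszul_cobd t (\<lambda>B. t x B * \<gamma> (insert x B)) \<tau> = koszul_cobd t ?\<eta> \<tau>"
      unfolding koszul_cobd_def by (intro sum.cong) (use False in auto)
    ultimately show ?thesis by simp
  qed
  then show "\<exists>\<eta>. \<forall>\<tau>\<subseteq>W. indep E \<tau> \<and> card \<tau> = k \<longrightarrow> \<gamma> \<tau> = koszul_cobd t \<eta> \<tau>"
    by (intro exI[of _ ?\<eta>]) auto
qed

lemma cobd_add: "koszul_cobd t (\<lambda>\<tau>. f \<tau> + g \<tau>) \<tau> = koszul_cobd t f \<tau> + koszul_cobd t g \<tau>"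
  unfolding koszul_cobd_def by (simp add: distrib_left sum.distrib)

lemma cobd_diff: "koszul_cobd t (\<lambda>\<tau>. f \<tau> - g \<tau>) \<tau> = koszul_cobd t f \<tau> - koszul_cobd t g \<tau>"
  unfolding koszul_cobd_def by (simp add: right_diff_distrib sum_subtractf)

text \<open>The long exact sequence of the deletion \<open>W - {x}\<close> and the link, which is the
  independence complex of \<open>W - N[x]\<close>.\<close>

lemma coh_vanishes_delete_link:
  assumes E: "E \<subseteq> {{u, v} | u v. u \<in> V \<and> v \<in> V \<and> u \<noteq> v}"
    and x: "x \<in> W" and W: "W \<subseteq> V"
    and del: "coh_vanishes E t (W - {x}) (Suc k)"
    and link: "coh_vanishes E t (W - closed_nbhd E x) k"
  shows "coh_vanishes E t W (Suc k)"
  unfolding coh_vanishes_def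
proof (intro allI impI)
  fix \<gamma> assume cyc: "\<forall>\<tau>\<subseteq>W. indep E \<tau> \<and> card \<tau> = Suc (Suc k) \<longrightarrow> koszul_cobd t \<gamma> \<tau> = 0"
  have xV: "x \<in> V" using x W by auto
  have fin: "finite \<tau>" if "\<tau> \<subseteq> W" for \<tau> using that W finite_V finite_subset by (meson)
  from del[unfolded coh_vanishes_def, rule_format, of \<gamma>] cyc
  obtain \<eta>0 where \<eta>0: "\<And>\<tau>. \<tau> \<subseteq> W - {x} \<Longrightarrow> indep E \<tau> \<Longrightarrow> card \<tau> = Suc k \<Longrightarrow> \<gamma> \<tau> = koszul_cobd t \<eta>0 \<tau>"
    by blast
  \<comment> \<open>Extension by zero to faces through \<open>x\<close> leaves the coboundary on the
    deletion unchanged, so \<open>\<gamma>1\<close> below vanishes there and is a relative cocycle,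
    determined by its link part.\<close>
  define \<eta>1 where "\<eta>1 = (\<lambda>\<tau>. if x \<in> \<tau> then 0 else \<eta>0 \<tau>)"
  define \<gamma>1 where "\<gamma>1 = (\<lambda>\<tau>. \<gamma> \<tau> - koszul_cobd t \<eta>1 \<tau>)"
  have \<gamma>1_0: "\<gamma>1 \<tau> = 0" if "\<tau> \<subseteq> W" "x \<notin> \<tau>" "indep E \<tau>" "card \<tau> = Suc k" for \<tau>
  proof -
    have "koszul_cobd t \<eta>1 \<tau> = koszul_cobd t \<eta>0 \<tau>"
      unfolding koszul_cobd_def \<eta>1_def by (intro sum.cong) (use that in auto)
    then show ?thesis using \<eta>0[of \<tau>] that by (auto simp: \<gamma>1_def)
  qed
  have cyc1: "koszul_cobd t \<gamma>1 \<tau> = 0" if "\<tau> \<subseteq> W" "indep E \<tau>" "card \<tau> = Suc (Suc k)" for \<tau>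
    using that cyc cobd_cobd[of \<tau> \<eta>1] W unfolding \<gamma>1_def cobd_diff by auto
  \<comment> \<open>\<open>cobd_insert\<close> turns the cocycle condition for
    \<open>\<gamma>1\<close> at \<open>insert x \<tau>\<close> into the one for this link part at
    \<open>\<tau>\<close>, since \<open>\<gamma>1 \<tau>\<close> is zero.\<close>
  let ?\<zeta> = "\<lambda>B. t x B * \<gamma>1 (insert x B)"
  have "koszul_cobd t ?\<zeta> \<tau> = 0" if \<tau>: "\<tau> \<subseteq> W - closed_nbhd E x" "indep E \<tau>" "card \<tau> = Suc k" for \<tau>
  proof -
    have x\<tau>: "x \<notin> \<tau>" using \<tau> by (auto simp: closed_nbhd_def)
    have "indep E (insert x \<tau>)" by (rule indep_insert[OF E]) (use \<tau> in auto)
    moreover have "card (insert x \<tau>) = Suc (Suc k)" using x\<tau> fin[of \<tau>] \<tau> by (subst card_insert_disjoint) auto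
    ultimately have "koszul_cobd t \<gamma>1 (insert x \<tau>) = 0"
      using cyc1[of "insert x \<tau>"] x \<tau>(1) by blast
    then have "t x \<tau> * (\<gamma>1 \<tau> - koszul_cobd t ?\<zeta> \<tau>) = 0"
      using cobd_insert[of x \<tau> \<gamma>1] xV x\<tau> \<tau> W by auto
    then have "\<gamma>1 \<tau> - koszul_cobd t ?\<zeta> \<tau> = 0" by (metis sq_left mult_zero_right)
    moreover have "\<gamma>1 \<tau> = 0" using \<tau> x\<tau> by (intro \<gamma>1_0) auto
    ultimately show ?thesis by simp
  qed
  with link[unfolded coh_vanishes_def, rule_format, of ?\<zeta>]
  obtain \<theta> where \<theta>: "\<And>\<tau>. \<tau> \<subseteq> W - closed_nbhd E x \<Longrightarrow> indep E \<tau> \<Longrightarrow> card \<tau> = k \<Longrightarrow> ?\<zeta> \<tau> = koszul_cobd t \<theta> \<tau>"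
    by blast
  \<comment> \<open>The minus sign compensates the one in front of the link term in
    \<open>cobd_insert\<close>; off \<open>x\<close> this cochain is zero, so the deletion is not
    disturbed.\<close>
  define \<eta>2 where "\<eta>2 = (\<lambda>\<tau>. if x \<in> \<tau> then - (t x (\<tau> - {x}) * \<theta> (\<tau> - {x})) else 0)"
  have "\<gamma> \<tau> = koszul_cobd t (\<lambda>\<tau>. \<eta>1 \<tau> + \<eta>2 \<tau>) \<tau>" if \<tau>: "\<tau> \<subseteq> W" "indep E \<tau>" "card \<tau> = Suc k" for \<tau>
  proof -
    have "\<gamma>1 \<tau> = koszul_cobd t \<eta>2 \<tau>"
    proof (cases "x \<in> \<tau>")
      case False
      have "koszul_cobd t \<eta>2 \<tau> = 0"
        unfolding koszul_cobd_def by (intro sum.neutral) (use False in \<open>auto simp: \<eta>2_def\<close>)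
      then show ?thesis using \<gamma>1_0[of \<tau>] \<tau> False by simp
    next
      case True
      define A where "A = \<tau> - {x}"
      have A: "\<tau> = insert x A" "x \<notin> A" "A \<subseteq> W - closed_nbhd E x" "A \<subseteq> V" "A \<subseteq> W"
        using True \<tau> indep_remove[of E \<tau> x] W by (auto simp: A_def)
      have "card A = k" using True \<tau> fin[of \<tau>] by (simp add: A_def)
      moreover have "indep E A" using \<tau>(2) indep_mono A_def by blast
      ultimately have Z: "?\<zeta> A = koszul_cobd t \<theta> A" using \<theta> A by blast
      have "koszul_cobd t \<eta>2 \<tau> = t x A * (\<eta>2 A - koszul_cobd t (\<lambda>B. t x B * \<eta>2 (insert x B)) A)"
        unfolding A(1) using cobd_insert[of x A \<eta>2] A xV by auto
      also have "\<eta>2 A = 0" using A by (simp add: \<eta>2_def)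
      also have "koszul_cobd t (\<lambda>B. t x B * \<eta>2 (insert x B)) A = koszul_cobd t (\<lambda>B. - \<theta> B) A"
        unfolding koszul_cobd_def
      proof (intro sum.cong refl)
        fix v assume "v \<in> A"
        have "insert x (A - {v}) - {x} = A - {v}" using A by auto
        then show "t v (A - {v}) * (t x (A - {v}) * \<eta>2 (insert x (A - {v}))) = t v (A - {v}) * - \<theta> (A - {v})"
          by (simp add: \<eta>2_def)
      qed
      also have "\<dots> = - koszul_cobd t \<theta> A" unfolding koszul_cobd_def by (simp add: sum_negf)
      also have "\<dots> = - ?\<zeta> A" using Z by simp
      finally show ?thesis using A(1) by simp
    qed
    then show ?thesis unfolding cobd_add by (simp add: \<gamma>1_def algebra_simps)
  qed
  then show "\<exists>\<eta>. \<forall>\<tau>\<subseteq>W. indep E \<tau> \<and> card \<tau> = Suc k \<longrightarrow> \<gamma> \<tau> = koszul_cobd t \<eta> \<tau>"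
    by blast
qed

end

section \<open>Disjoint unions of edges and 5-cycles\<close>

context sign_system
begin

text \<open>In effect: the induced subgraph on \<open>W\<close> has regularity at most
  \<open>r\<close>. The quantifier over \<open>W'\<close> is the maximum in Hochster's formula and
  makes the bound pass to subsets.\<close>

definition vanishes_above :: "'v set set \<Rightarrow> 'v set \<Rightarrow> nat \<Rightarrow> bool" where
  "vanishes_above E W r \<longleftrightarrow> (\<forall>W'\<subseteq>W. \<forall>k>r. coh_vanishes E t W' k)"

lemma vanishes_above_mono:
  "vanishes_above E W r \<Longrightarrow> W' \<subseteq> W \<Longrightarrow> r \<le> r' \<Longrightarrow> vanishes_above E W' r'"
  unfolding vanishes_above_def by (meson order_trans le_less_trans)

context
  fixes E :: "'v set set"
  assumes E: "E \<subseteq> {{u, v} | u v. u \<in> V \<and> v \<in> V \<and> u \<noteq> v}"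
begin

lemma vanishes_above_delete:
  assumes W: "W \<subseteq> V"
    and del: "vanishes_above E (W - {x}) (Suc r)"
    and link: "vanishes_above E (W - closed_nbhd E x) r"
  shows "vanishes_above E W (Suc r)"
  unfolding vanishes_above_def
proof (intro allI impI)
  fix W' k assume W': "W' \<subseteq> W" and k: "Suc r < k"
  show "coh_vanishes E t W' k"
  proof (cases "x \<in> W'")
    case False
    then have "W' \<subseteq> W - {x}" using W' by auto
    then show ?thesis using del k unfolding vanishes_above_def by blast
  next
    case True
    obtain l where l: "k = Suc l" "r < l" using k by (cases k) auto
    have "W' - {x} \<subseteq> W - {x}" "W' - closed_nbhd E x \<subseteq> W - closed_nbhd E x"
      using W' by auto
    then have "coh_vanishes E t (W' - {x}) (Suc l)" "coh_vanishes E t (W' - closed_nbhd E x) l"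
      using del link k l unfolding vanishes_above_def by blast+
    then show ?thesis
      unfolding l(1) using coh_vanishes_delete_link[OF E True] W W' by auto
  qed
qed

lemma vanishes_above_insert:
  assumes "insert x W \<subseteq> V" "vanishes_above E W r"
  shows "vanishes_above E (insert x W) (Suc r)"
  by (rule vanishes_above_delete[where x = x])
    (use assms in \<open>auto intro: vanishes_above_mono simp: closed_nbhd_def\<close>)

text \<open>Two insertions would cost 2. Here the link of \<open>a\<close> already lacks
  \<open>b\<close>, so it stays at \<open>r\<close>, and the deletion of \<open>a\<close> only has
  \<open>b\<close> to pay for.\<close>

lemma vanishes_above_edge:
  assumes V: "insert a (insert b W) \<subseteq> V" and W: "vanishes_above E W r" and "{a, b} \<in> E"
  shows "vanishes_above E (insert a (insert b W)) (Suc r)"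
proof (rule vanishes_above_delete[where x = a])
  show "vanishes_above E (insert a (insert b W) - {a}) (Suc r)"
    by (rule vanishes_above_mono[OF vanishes_above_insert[of b W]]) (use V W in auto)
  show "vanishes_above E (insert a (insert b W) - closed_nbhd E a) r"
    by (rule vanishes_above_mono[OF W]) (use assms(3) in \<open>auto simp: closed_nbhd_def\<close>)
qed (rule V)

text \<open>Deleting \<open>a\<close> leaves the path b, c, d, e, covered by the two edges bc and
  de; in the link of \<open>a\<close> also b and e are gone and only the edge cd remains. Chords
  merely shrink the link further.\<close>

lemma vanishes_above_pentagon:
  assumes V: "{a, b, c, d, e} \<union> W \<subseteq> V" and W: "vanishes_above E W r"
    and edges: "{a, b} \<in> E" "{b, c} \<in> E" "{c, d} \<in> E" "{d, e} \<in> E" "{e, a} \<in> E"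
  shows "vanishes_above E ({a, b, c, d, e} \<union> W) (Suc (Suc r))"
proof (rule vanishes_above_delete[where x = a])
  have "vanishes_above E (insert b (insert c (insert d (insert e W)))) (Suc (Suc r))"
    by (intro vanishes_above_edge) (use V W edges in auto)
  then show "vanishes_above E ({a, b, c, d, e} \<union> W - {a}) (Suc (Suc r))"
    by (rule vanishes_above_mono) auto
  have "vanishes_above E (insert c (insert d W)) (Suc r)"
    by (intro vanishes_above_edge) (use V W edges in auto)
  then show "vanishes_above E ({a, b, c, d, e} \<union> W - closed_nbhd E a) (Suc r)"
    by (rule vanishes_above_mono) (use edges in \<open>auto simp: closed_nbhd_def insert_commute\<close>)
qed (rule V)

text \<open>Every vertex of a nonempty \<open>W'\<close> is isolated, so its complex is a cone; the
  empty set carries a class at \<open>k = 0\<close> only.\<close>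

lemma vanishes_above_indep:
  assumes "W \<subseteq> V" "indep E W"
  shows "vanishes_above E W 0"
  unfolding vanishes_above_def
proof (intro allI impI)
  fix W' :: "'v set" and k :: nat assume W': "W' \<subseteq> W" "0 < k"
  show "coh_vanishes E t W' k"
  proof (cases "W' = {}")
    case True
    then show ?thesis using W'(2) by (simp add: coh_vanishes_def)
  next
    case False
    then obtain x where x: "x \<in> W'" by auto
    show ?thesis
    proof (rule coh_vanishes_isolated[OF E x])
      show "W' \<inter> closed_nbhd E x = {x}"
        using x W' assms(2) by (auto simp: closed_nbhd_def indep_def)
    qed (use W' assms in auto)
  qed
qed

end

end

text \<open>One component is added at a time, so that claims about the whole graph become
  inductions. The counter is 1 per edge and 2 per pentagon; below it turns out to be both the
  matching number and a bound for independent sets.\<close>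

inductive k2c5 :: "'v set \<Rightarrow> 'v set set \<Rightarrow> nat \<Rightarrow> bool" where
  empty: "k2c5 {} {} 0"
| edge: "k2c5 X E n \<Longrightarrow> a \<noteq> b \<Longrightarrow> {a, b} \<inter> X = {} \<Longrightarrow>
    k2c5 ({a, b} \<union> X) ({{a, b}} \<union> E) (Suc n)"
| pentagon: "k2c5 X E n \<Longrightarrow> distinct [a, b, c, d, e] \<Longrightarrow> {a, b, c, d, e} \<inter> X = {} \<Longrightarrow>
    k2c5 ({a, b, c, d, e} \<union> X) ({{a, b}, {b, c}, {c, d}, {d, e}, {e, a}} \<union> E) (Suc (Suc n))"

lemma k2c5_edges: "k2c5 X E n \<Longrightarrow> e \<in> E \<Longrightarrow> e \<subseteq> X \<and> e \<noteq> {}"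
  by (induction rule: k2c5.induct) auto

lemma k2c5_finite: "k2c5 X E n \<Longrightarrow> finite X \<and> finite E"
  by (induction rule: k2c5.induct) auto

lemma k2c5_nonempty: "k2c5 X E n \<Longrightarrow> X \<noteq> {} \<Longrightarrow> E \<noteq> {}"
  by (induction rule: k2c5.induct) auto

text \<open>This makes \<open>card X - Suc n\<close> a genuine homological index in the lower bound;
  for the empty graph both sides are 0, hence the hypothesis.\<close>

lemma k2c5_less_card: "k2c5 X E n \<Longrightarrow> X \<noteq> {} \<Longrightarrow> n < card X"
proof (induction rule: k2c5.induct)
  case (edge X E n a b)
  have "card ({a, b} \<union> X) = 2 + card X"
    using edge k2c5_finite[OF edge(1)] by (subst card_Un_disjoint) auto
  moreover have "n \<le> card X" using edge by (cases "X = {}") (auto elim: k2c5.cases)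
  ultimately show ?case by simp
next
  case (pentagon X E n a b c d e)
  have "card ({a, b, c, d, e} \<union> X) = 5 + card X"
    using pentagon k2c5_finite[OF pentagon(1)] by (subst card_Un_disjoint) auto
  moreover have "n \<le> card X" using pentagon by (cases "X = {}") (auto elim: k2c5.cases)
  ultimately show ?case by simp
qed simp

text \<open>The five names stand for any cyclic arrangement: they are the vertices of the pentagon
  for independent sets, and its edges for matchings.\<close>

lemma card_pentagon_le_2:
  assumes "S \<subseteq> {a, b, c, d, e}"
    and "\<not> (a \<in> S \<and> b \<in> S)" "\<not> (b \<in> S \<and> c \<in> S)" "\<not> (c \<in> S \<and> d \<in> S)" "\<not> (d \<in> S \<and> e \<in> S)"
      "\<not> (e \<in> S \<and> a \<in> S)"
  shows "card S \<le> 2"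
proof -
  have "S \<subseteq> {a, c} \<or> S \<subseteq> {a, d} \<or> S \<subseteq> {b, d} \<or> S \<subseteq> {b, e} \<or> S \<subseteq> {c, e}"
    using assms by blast
  then obtain x y where "S \<subseteq> {x, y}" by blast
  then have "card S \<le> card {x, y}" by (intro card_mono) auto
  also have "\<dots> \<le> 2" by (simp add: card_insert_if)
  finally show ?thesis .
qed

text \<open>Bounds the dimension of the independence complex, so that every cochain on faces of size
  \<open>n\<close> is a cocycle.\<close>

lemma k2c5_indep_card: "k2c5 X E n \<Longrightarrow> indep E \<tau> \<Longrightarrow> \<tau> \<subseteq> X \<Longrightarrow> card \<tau> \<le> n"
proof (induction arbitrary: \<tau> rule: k2c5.induct)
  case (edge X E n a b)
  have "indep E (\<tau> - {a, b})" using edge.prems by (auto simp: indep_def)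
  then have 1: "card (\<tau> - {a, b}) \<le> n" using edge by (intro edge.IH) auto
  have "\<tau> \<inter> {a, b} \<subseteq> {a} \<or> \<tau> \<inter> {a, b} \<subseteq> {b}" using edge.prems by (auto simp: indep_def)
  then have "card (\<tau> \<inter> {a, b}) \<le> 1" by (auto dest: card_mono[rotated])
  moreover have "card \<tau> \<le> card (\<tau> - {a, b}) + card (\<tau> \<inter> {a, b})"
    by (metis Un_Diff_Int card_Un_le)
  ultimately show ?case using 1 by simp
next
  case (pentagon X E n a b c d e)
  let ?P = "{a, b, c, d, e}"
  have "indep E (\<tau> - ?P)" using pentagon.prems by (auto simp: indep_def)
  then have 1: "card (\<tau> - ?P) \<le> n" using pentagon by (intro pentagon.IH) auto
  have "\<not> {a, b} \<subseteq> \<tau>" "\<not> {b, c} \<subseteq> \<tau>" "\<not> {c, d} \<subseteq> \<tau>" "\<not> {d, e} \<subseteq> \<tau>" "\<not> {e, a} \<subseteq> \<tau>"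
    using pentagon.prems(1) unfolding indep_def by blast+
  then have "card (\<tau> \<inter> ?P) \<le> 2"
    by (intro card_pentagon_le_2[of _ a b c d e]) auto
  moreover have "card \<tau> \<le> card (\<tau> - ?P) + card (\<tau> \<inter> ?P)"
    by (metis Un_Diff_Int card_Un_le)
  ultimately show ?case using 1 by simp
qed simp

lemma k2c5_matching_card: "k2c5 X E n \<Longrightarrow> M \<subseteq> E \<Longrightarrow> pairwise disjnt M \<Longrightarrow> card M \<le> n"
proof (induction arbitrary: M rule: k2c5.induct)
  case (edge X E n a b)
  have 1: "card (M - {{a, b}}) \<le> n"
    by (rule edge.IH) (use edge.prems in \<open>auto simp: pairwise_def\<close>)
  have "card M \<le> card (M - {{a, b}}) + card (M \<inter> {{a, b}})"
    by (metis Un_Diff_Int card_Un_le)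
  moreover have "card (M \<inter> {{a, b}}) \<le> 1" using card_mono[of "{{a, b}}" "M \<inter> {{a, b}}"] by simp
  ultimately show ?case using 1 by simp
next
  case (pentagon X E n a b c d e)
  let ?P = "{{a, b}, {b, c}, {c, d}, {d, e}, {e, a}}"
  have 1: "card (M - ?P) \<le> n"
  proof (rule pentagon.IH)
    show "M - ?P \<subseteq> E" using pentagon.prems(1) by blast
    show "pairwise disjnt (M - ?P)" by (rule pairwise_subset[OF pentagon.prems(2)]) blast
  qed
  have disj: "x = y" if "x \<in> M" "y \<in> M" "v \<in> x" "v \<in> y" for x y v
    using pentagon.prems(2) that by (auto simp: pairwise_def disjnt_iff)
  have "card (M \<inter> ?P) \<le> 2"
  proof (rule card_pentagon_le_2)
    have ne: "{a, b} \<noteq> {b, c}" "{b, c} \<noteq> {c, d}" "{c, d} \<noteq> {d, e}" "{d, e} \<noteq> {e, a}" "{e, a} \<noteq> {a, b}"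
      using pentagon.hyps(2) by (auto simp: doubleton_eq_iff)
    show "\<not> ({a, b} \<in> M \<inter> ?P \<and> {b, c} \<in> M \<inter> ?P)" using disj[of "{a, b}" "{b, c}" b] ne by auto
    show "\<not> ({b, c} \<in> M \<inter> ?P \<and> {c, d} \<in> M \<inter> ?P)" using disj[of "{b, c}" "{c, d}" c] ne by auto
    show "\<not> ({c, d} \<in> M \<inter> ?P \<and> {d, e} \<in> M \<inter> ?P)" using disj[of "{c, d}" "{d, e}" d] ne by auto
    show "\<not> ({d, e} \<in> M \<inter> ?P \<and> {e, a} \<in> M \<inter> ?P)" using disj[of "{d, e}" "{e, a}" e] ne by auto
    show "\<not> ({e, a} \<in> M \<inter> ?P \<and> {a, b} \<in> M \<inter> ?P)" using disj[of "{e, a}" "{a, b}" a] ne by auto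
  qed auto
  moreover have "card M \<le> card (M - ?P) + card (M \<inter> ?P)"
    by (metis Un_Diff_Int card_Un_le)
  ultimately show ?case using 1 by simp
qed simp

lemma k2c5_matching_exists: "k2c5 X E n \<Longrightarrow> \<exists>M\<subseteq>E. pairwise disjnt M \<and> card M = n"
proof (induction rule: k2c5.induct)
  case empty
  then show ?case by (intro exI[of _ "{}"]) auto
next
  case (edge X E n a b)
  then obtain M where M: "M \<subseteq> E" "pairwise disjnt M" "card M = n" by blast
  have sub: "m \<subseteq> X" if "m \<in> M" for m using k2c5_edges[OF edge(1)] M that by auto
  have "finite M" using k2c5_finite[OF edge(1)] M finite_subset by auto
  moreover have "{a, b} \<notin> M" using sub edge by auto
  ultimately have "card (insert {a, b} M) = Suc n" using M by simp
  moreover have "pairwise disjnt (insert {a, b} M)"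
    using M sub edge(3) by (fastforce simp: pairwise_insert disjnt_iff)
  ultimately show ?case using M by (intro exI[of _ "insert {a, b} M"]) auto
next
  case (pentagon X E n a b c d e)
  then obtain M where M: "M \<subseteq> E" "pairwise disjnt M" "card M = n" by blast
  have sub: "m \<subseteq> X" if "m \<in> M" for m using k2c5_edges[OF pentagon(1)] M that by auto
  have "finite M" using k2c5_finite[OF pentagon(1)] M finite_subset by auto
  moreover have "{a, b} \<notin> M" "{c, d} \<notin> M" using sub pentagon by auto
  moreover have "{a, b} \<noteq> {c, d}" using pentagon by (auto simp: doubleton_eq_iff)
  ultimately have "card (insert {a, b} (insert {c, d} M)) = Suc (Suc n)" using M by simp
  moreover have "disjnt {a, b} m" "disjnt {c, d} m" "disjnt m {a, b}" "disjnt m {c, d}"  if "m \<in> M" for m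
    using sub[OF that] pentagon(3) by (auto simp: disjnt_iff)
  then have "pairwise disjnt (insert {a, b} (insert {c, d} M))"
    using M pentagon(2) by (auto simp: pairwise_insert)
  ultimately show ?case using M by (intro exI[of _ "insert {a, b} (insert {c, d} M)"]) auto
qed

lemma k2c5_matching_number:
  assumes "k2c5 (verts H) (edges H) n"
  shows "matching_number H = n"
  unfolding matching_number_def
proof (rule Max_eqI)
  show "finite {card M |M. matching_of M H}"
    by (rule finite_subset[of _ "{..n}"])
      (use k2c5_matching_card[OF assms] in \<open>auto simp: matching_of_def\<close>)
  show "y \<le> n" if "y \<in> {card M |M. matching_of M H}" for y
    using that k2c5_matching_card[OF assms] by (auto simp: matching_of_def)
  show "n \<in> {card M |M. matching_of M H}"
    using k2c5_matching_exists[OF assms] by (auto simp: matching_of_def)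
qed

section \<open>Fundamental cycles and nonvanishing cohomology\<close>

lemma koszul_bd_add: "koszul_bd t V (\<lambda>\<tau>. f \<tau> + g \<tau>) \<tau> = koszul_bd t V f \<tau> + koszul_bd t V g \<tau>"
  unfolding koszul_bd_def by (simp add: distrib_left sum.distrib)

lemma koszul_bd_diff: "koszul_bd t V (\<lambda>\<tau>. f \<tau> - g \<tau>) \<tau> = koszul_bd t V f \<tau> - koszul_bd t V g \<tau>"
  unfolding koszul_bd_def by (simp add: right_diff_distrib sum_subtractf)

text \<open>Boundary and coboundary are adjoint: both sides run over pairs of a face and an element
  removed from or added to it. Consequently a cycle pairs to zero with every coboundary.\<close>

lemma koszul_cobd_pairing:
  assumes "finite V"
  shows "(\<Sum>\<tau>\<in>Pow V. z \<tau> * koszul_cobd t \<eta> \<tau>) = (\<Sum>A\<in>Pow V. koszul_bd t V z A * \<eta> A)"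
proof -
  have fin: "finite \<tau>" if "\<tau> \<in> Pow V" for \<tau> using that assms finite_subset by blast
  have "(\<Sum>\<tau>\<in>Pow V. z \<tau> * koszul_cobd t \<eta> \<tau>)
     = (\<Sum>\<tau>\<in>Pow V. \<Sum>v\<in>\<tau>. t v (\<tau> - {v}) * z \<tau> * \<eta> (\<tau> - {v}))"
    unfolding koszul_cobd_def sum_distrib_left by (simp add: mult_ac)
  also have "\<dots> = (\<Sum>(\<tau>, v)\<in>Sigma (Pow V) (\<lambda>\<tau>. \<tau>). t v (\<tau> - {v}) * z \<tau> * \<eta> (\<tau> - {v}))"
    by (rule sum.Sigma) (use assms fin in auto)
  also have "\<dots> = (\<Sum>(A, v)\<in>Sigma (Pow V) (\<lambda>A. V - A). t v A * z (insert v A) * \<eta> A)"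
    by (rule sum.reindex_bij_witness[where i = "\<lambda>(A, v). (insert v A, v)" and j = "\<lambda>(\<tau>, v). (\<tau> - {v}, v)"])
      (auto simp: insert_absorb)
  also have "\<dots> = (\<Sum>A\<in>Pow V. \<Sum>v\<in>V - A. t v A * z (insert v A) * \<eta> A)"
    by (rule sum.Sigma[symmetric]) (use assms in auto)
  also have "\<dots> = (\<Sum>A\<in>Pow V. koszul_bd t V z A * \<eta> A)"
    unfolding koszul_bd_def sum_distrib_right ..
  finally show ?thesis .
qed

locale field_sign_system = sign_system V t
  for V :: "'v set" and t :: "'v \<Rightarrow> 'v set \<Rightarrow> 'a::field"
begin

lemma t_nonzero [simp]: "t v A \<noteq> 0"
  using sq[of v A] by auto

lemma bd_cone_cycle:
  assumes "p \<in> V" "\<And>\<tau>. koszul_bd t V z \<tau> = 0"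
  shows "koszul_bd t V (cone t p z) \<tau> = z \<tau>"
proof -
  have "cone t p (koszul_bd t V z) \<tau> = 0" by (simp add: cone_def assms(2))
  then show ?thesis using bd_cone[OF assms(1), of z \<tau>] by simp
qed

text \<open>The independence complexes of \<open>K\<^sub>2\<close> and \<open>C\<^sub>5\<close> are a 0-sphere and a 1-sphere, and \<open>z\<close> is
  the fundamental cycle of their join.\<close>

lemma k2c5_cycle:
  "k2c5 X E n \<Longrightarrow> X \<subseteq> V \<Longrightarrow> \<exists>z \<tau>0. z \<tau>0 \<noteq> 0 \<and> (\<forall>\<tau>. koszul_bd t V z \<tau> = 0) \<and>
    (\<forall>\<tau>. z \<tau> \<noteq> 0 \<longrightarrow> \<tau> \<subseteq> X \<and> indep E \<tau> \<and> card \<tau> = n)"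
proof (induction rule: k2c5.induct)
  case empty
  show ?case
    by (intro exI[of _ "\<lambda>\<tau>. if \<tau> = {} then 1 else 0"] exI[of _ "{}"])
      (auto simp: koszul_bd_def indep_def)
next
  case (edge X E n a b)
  then obtain z \<tau>0 where z: "z \<tau>0 \<noteq> 0" "\<And>\<tau>. koszul_bd t V z \<tau> = 0"
    "\<And>\<tau>. z \<tau> \<noteq> 0 \<Longrightarrow> \<tau> \<subseteq> X \<and> indep E \<tau> \<and> card \<tau> = n" by auto
  have fin: "finite X" using k2c5_finite[OF edge(1)] by simp
  have EX: "e \<subseteq> X" if "e \<in> E" for e using k2c5_edges[OF edge(1) that] by simp
  \<comment> \<open>The join with the 0-sphere of the two points; each cone has boundary
    \<open>z\<close>, so these cancel.\<close>
  let ?z = "\<lambda>\<tau>. cone t a z \<tau> - cone t b z \<tau>"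
  have supp: "\<tau> \<subseteq> {a, b} \<union> X \<and> indep ({{a, b}} \<union> E) \<tau> \<and> card \<tau> = Suc n"
    if p: "p \<in> \<tau>" "p \<in> {a, b}" "z (\<tau> - {p}) \<noteq> 0" for p \<tau>
  proof -
    define A where "A = \<tau> - {p}"
    have A: "A \<subseteq> X" "indep E A" "card A = n" using z(3)[of A] p by (auto simp: A_def)
    have \<tau>: "\<tau> = insert p A" "p \<notin> A" using p by (auto simp: A_def)
    have "card \<tau> = Suc n" using \<tau> A fin finite_subset by (metis card_insert_disjoint)
    moreover have "\<not> {a, b} \<subseteq> \<tau>" using \<tau> A(1) edge.hyps p(2) by auto
    moreover have "\<not> e \<subseteq> \<tau>" if "e \<in> E" for e
    proof -
      have "p \<notin> e" using EX[OF that] p(2) edge.hyps by auto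
      then show ?thesis using A(2) that \<tau> by (auto simp: indep_def)
    qed
    ultimately have "card \<tau> = Suc n" "indep ({{a, b}} \<union> E) \<tau>" by (auto simp: indep_def)
    then show ?thesis using A \<tau> p by auto
  qed
  have \<tau>0: "\<tau>0 \<subseteq> X" using z by auto
  show ?case
  proof (intro exI[of _ ?z] exI[of _ "insert a \<tau>0"] conjI allI impI)
    have "insert a \<tau>0 - {a} = \<tau>0" using \<tau>0 edge by auto
    then show "?z (insert a \<tau>0) \<noteq> 0" using \<tau>0 edge z(1) by (auto simp: cone_def)
    show "koszul_bd t V ?z \<tau> = 0" for \<tau>
      unfolding koszul_bd_diff using edge z(2) by (simp add: bd_cone_cycle)
  next
    fix \<tau> assume "?z \<tau> \<noteq> 0"
    then have "cone t a z \<tau> \<noteq> 0 \<or> cone t b z \<tau> \<noteq> 0" by auto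
    then obtain p where "p \<in> {a, b}" "p \<in> \<tau>" "z (\<tau> - {p}) \<noteq> 0"
      by (auto simp: cone_def split: if_splits)
    from supp[OF this(2,1,3)] show "\<tau> \<subseteq> {a, b} \<union> X" "indep ({{a, b}} \<union> E) \<tau>" "card \<tau> = Suc n"
      by auto
  qed
next
  case (pentagon X E n a b c d e)
  then obtain z \<tau>0 where z: "z \<tau>0 \<noteq> 0" "\<And>\<tau>. koszul_bd t V z \<tau> = 0"
    "\<And>\<tau>. z \<tau> \<noteq> 0 \<Longrightarrow> \<tau> \<subseteq> X \<and> indep E \<tau> \<and> card \<tau> = n" by auto
  have fin: "finite X" using k2c5_finite[OF pentagon(1)] by simp
  have EX: "e \<subseteq> X" if "e \<in> E" for e using k2c5_edges[OF pentagon(1) that] by simp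
  let ?P = "{a, b, c, d, e}" and ?F = "{{a, b}, {b, c}, {c, d}, {d, e}, {e, a}}"
  define cc where "cc p q = cone t p (cone t q z)" for p q
  \<comment> \<open>The non-edges ac, ce, eb, bd, da of the pentagon again form a 5-cycle, so the
    boundaries \<open>cone t q z - cone t p z\<close> telescope to zero around it.\<close>
  let ?z = "\<lambda>\<tau>. cc a c \<tau> + (cc c e \<tau> + (cc e b \<tau> + (cc b d \<tau> + cc d a \<tau>)))"
  have bd_cc: "koszul_bd t V (cc p q) \<tau> = cone t q z \<tau> - cone t p z \<tau>" if "p \<in> V" "q \<in> V" for p q \<tau>
  proof -
    have "koszul_bd t V (cone t q z) = z" using bd_cone_cycle[OF that(2) z(2)] by blast
    then show ?thesis using bd_cone[OF that(1), of "cone t q z" \<tau>]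
      by (simp add: cc_def algebra_simps)
  qed
  have cc_supp: "\<tau> \<subseteq> ?P \<union> X \<and> indep (?F \<union> E) \<tau> \<and> card \<tau> = Suc (Suc n)"
    if pq: "(p, q) \<in> {(a, c), (c, e), (e, b), (b, d), (d, a)}" and "cc p q \<tau> \<noteq> 0" for p q \<tau>
  proof -
    define A where "A = \<tau> - {p} - {q}"
    have *: "p \<in> \<tau>" "q \<in> \<tau>" "p \<noteq> q" "z A \<noteq> 0"
      using that(2) by (auto simp: cc_def cone_def A_def split: if_splits)
    have A: "A \<subseteq> X" "indep E A" "card A = n" using z(3)[OF *(4)] by (auto)
    have \<tau>: "\<tau> = insert p (insert q A)" using * by (auto simp: A_def)
    have "q \<notin> A" "p \<notin> insert q A" using * by (auto simp: A_def)
    then have "card \<tau> = Suc (Suc n)" using \<tau> A fin finite_subset by (metis card_insert_disjoint finite_insert)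
    moreover have "?P \<inter> A = {}" using A(1) pentagon.hyps(3) by blast
    then have "\<not> {a, b} \<subseteq> \<tau>" "\<not> {b, c} \<subseteq> \<tau>" "\<not> {c, d} \<subseteq> \<tau>" "\<not> {d, e} \<subseteq> \<tau>" "\<not> {e, a} \<subseteq> \<tau>"
      using pq pentagon.hyps(2) unfolding \<tau> by auto
    moreover have "\<not> f \<subseteq> \<tau>" if "f \<in> E" for f
    proof -
      have "f \<inter> ?P = {}" using EX[OF that] pentagon.hyps(3) by blast
      then have "p \<notin> f" "q \<notin> f" using pq by auto
      then show ?thesis using A(2) that \<tau> by (auto simp: indep_def)
    qed
    moreover have "\<tau> \<subseteq> ?P \<union> X" using A \<tau> pq by auto
    ultimately show ?thesis by (auto simp: indep_def)
  qed
  have \<tau>0: "\<tau>0 \<subseteq> X" using z by auto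
  show ?case
  proof (intro exI[of _ ?z] exI[of _ "insert a (insert c \<tau>0)"] conjI allI impI)
    \<comment> \<open>Every other summand requires b, d or e in the face, so nothing can cancel the
      first one here.\<close>
    let ?\<tau> = "insert a (insert c \<tau>0)"
    have "?\<tau> - {a} = insert c \<tau>0" "insert c \<tau>0 - {c} = \<tau>0" using \<tau>0 pentagon.hyps by auto
    then have "cc a c ?\<tau> \<noteq> 0" using z(1) by (simp add: cc_def cone_def)
    moreover have "b \<notin> ?\<tau>" "d \<notin> ?\<tau>" "e \<notin> ?\<tau>" using \<tau>0 pentagon.hyps by auto
    then have "cc c e ?\<tau> = 0" "cc e b ?\<tau> = 0" "cc b d ?\<tau> = 0" "cc d a ?\<tau> = 0"
      by (auto simp: cc_def cone_def)
    ultimately show "?z ?\<tau> \<noteq> 0" by simp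
    show "koszul_bd t V ?z \<tau> = 0" for \<tau>
      unfolding koszul_bd_add using pentagon.prems by (simp add: bd_cc)
  next
    fix \<tau> assume "?z \<tau> \<noteq> 0"
    then have "cc a c \<tau> \<noteq> 0 \<or> cc c e \<tau> \<noteq> 0 \<or> cc e b \<tau> \<noteq> 0 \<or> cc b d \<tau> \<noteq> 0 \<or> cc d a \<tau> \<noteq> 0"
      by auto
    then have "\<tau> \<subseteq> ?P \<union> X \<and> indep (?F \<union> E) \<tau> \<and> card \<tau> = Suc (Suc n)"
      using cc_supp[of a c \<tau>] cc_supp[of c e \<tau>] cc_supp[of e b \<tau>] cc_supp[of b d \<tau>] cc_supp[of d a \<tau>]
      by blast
    then show "\<tau> \<subseteq> ?P \<union> X" "indep (?F \<union> E) \<tau>" "card \<tau> = Suc (Suc n)"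
      by auto
  qed
qed

text \<open>As there are no faces of size \<open>n + 1\<close>, the indicator of a face
  \<open>\<tau>0\<close> in the support of the fundamental cycle is a cocycle. It pairs with that
  cycle to \<open>z \<tau>0\<close>, which is nonzero, so it is no coboundary. Only independence
  inside \<open>X\<close> enters, which lets \<open>E'\<close> be the edge set of the ambient
  graph.\<close>

lemma k2c5_not_coh_vanishes:
  assumes X: "k2c5 X E n" "X \<subseteq> V" and E': "\<And>\<tau>. \<tau> \<subseteq> X \<Longrightarrow> indep E' \<tau> \<longleftrightarrow> indep E \<tau>"
  shows "\<not> coh_vanishes E' t X n"
proof
  assume "coh_vanishes E' t X n"
  from k2c5_cycle[OF X] obtain z \<tau>0 where z: "z \<tau>0 \<noteq> 0" "\<And>\<tau>. koszul_bd t V z \<tau> = 0"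
    "\<And>\<tau>. z \<tau> \<noteq> 0 \<Longrightarrow> \<tau> \<subseteq> X \<and> indep E \<tau> \<and> card \<tau> = n" by auto
  let ?\<gamma> = "\<lambda>\<tau>. if \<tau> = \<tau>0 then 1 else (0 :: 'a)"
  have "\<not> (indep E' \<tau> \<and> card \<tau> = Suc n)" if "\<tau> \<subseteq> X" for \<tau>
    using k2c5_indep_card[OF X(1), of \<tau>] E' that by auto
  with \<open>coh_vanishes E' t X n\<close>[unfolded coh_vanishes_def, rule_format, of ?\<gamma>]
  obtain \<eta> where \<eta>: "\<And>\<tau>. \<tau> \<subseteq> X \<Longrightarrow> indep E' \<tau> \<Longrightarrow> card \<tau> = n \<Longrightarrow> ?\<gamma> \<tau> = koszul_cobd t \<eta> \<tau>"
    by blast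
  have "z \<tau>0 = (\<Sum>\<tau>\<in>Pow V. if \<tau> = \<tau>0 then z \<tau> else 0)"
    using z(3)[OF z(1)] X finite_V by (subst sum.delta) auto
  also have "\<dots> = (\<Sum>\<tau>\<in>Pow V. z \<tau> * koszul_cobd t \<eta> \<tau>)"
  proof (intro sum.cong refl)
    fix \<tau>
    show "(if \<tau> = \<tau>0 then z \<tau> else 0) = z \<tau> * koszul_cobd t \<eta> \<tau>"
    proof (cases "z \<tau> = 0")
      case False
      then have "?\<gamma> \<tau> = koszul_cobd t \<eta> \<tau>" using \<eta>[of \<tau>] z(3)[of \<tau>] E'[of \<tau>] by blast
      then show ?thesis by (metis mult.right_neutral mult_zero_right)
    qed auto
  qed
  also have "\<dots> = (\<Sum>A\<in>Pow V. koszul_bd t V z A * \<eta> A)"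
    by (rule koszul_cobd_pairing[OF finite_V])
  also have "\<dots> = 0" using z(2) by simp
  finally show False using z(1) by simp
qed

end

section \<open>From connected components to \<open>k2c5\<close>, and extremal subgraphs\<close>

definition reachable :: "'v graph \<Rightarrow> 'v \<Rightarrow> 'v set" where
  "reachable G v = {w. (v, w) \<in> {(a, b). {a, b} \<in> edges G}\<^sup>*}"

lemma components_reachable: "components G = {induced_on G (reachable G v) | v. v \<in> verts G}"
  unfolding components_def reachable_def ..

lemma reachable_refl [simp]: "v \<in> reachable G v"
  by (simp add: reachable_def)

lemma reachable_edge: "{u, w} \<in> edges G \<Longrightarrow> w \<in> reachable G u"
  by (auto simp: reachable_def)

lemma reachable_eq:
  assumes "w \<in> reachable G u"
  shows "reachable G w = reachable G u"
proof -
  let ?r = "{(a, b). {a, b} \<in> edges G}"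
  have "sym (?r\<^sup>*)" by (rule sym_rtrancl) (auto simp: sym_def insert_commute)
  then have "(w, u) \<in> ?r\<^sup>*" "(u, w) \<in> ?r\<^sup>*" using assms by (auto simp: reachable_def sym_def)
  then show ?thesis by (auto simp: reachable_def)
qed

lemma finite_simple_graph_edgeE:
  assumes "finite_simple_graph G" "e \<in> edges G"
  obtains u v where "e = {u, v}" "u \<in> verts G" "v \<in> verts G" "u \<noteq> v"
  using assms unfolding finite_simple_graph_def by blast

lemma finite_simple_graph_induced_on:
  assumes "finite_simple_graph G"
  shows "finite_simple_graph (induced_on G W)"
  unfolding finite_simple_graph_def
proof
  show "finite (verts (induced_on G W))"
    using assms by (simp add: finite_simple_graph_def induced_on_def)
  show "edges (induced_on G W) \<subseteq>
    {{u, v} |u v. u \<in> verts (induced_on G W) \<and> v \<in> verts (induced_on G W) \<and> u \<noteq> v}"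
  proof
    fix e assume "e \<in> edges (induced_on G W)"
    then have e: "e \<in> edges G" "e \<subseteq> W" by (auto simp: induced_on_def)
    from finite_simple_graph_edgeE[OF assms e(1)]
    obtain u v where "e = {u, v}" "u \<in> verts G" "v \<in> verts G" "u \<noteq> v" .
    then show "e \<in> {{u, v} |u v. u \<in> verts (induced_on G W) \<and> v \<in> verts (induced_on G W) \<and> u \<noteq> v}"
      using e(2) by (auto simp: induced_on_def)
  qed
qed

lemma graph_iso_K2E:
  assumes "finite_simple_graph C" "graph_iso C K2"
  obtains a b where "a \<noteq> b" "C = ({a, b}, {{a, b}})"
proof -
  obtain f where f: "bij_betw f (verts C) {0, 1::nat}"
    and fe: "\<And>u v. u \<in> verts C \<Longrightarrow> v \<in> verts C \<Longrightarrow> {u, v} \<in> edges C \<longleftrightarrow> {f u, f v} \<in> {{0, 1}}"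
    using assms(2) unfolding graph_iso_def K2_def by auto
  define a b where "a = the_inv_into (verts C) f 0" and "b = the_inv_into (verts C) f 1"
  have inj: "inj_on f (verts C)" and img: "f ` verts C = {0, 1}" using f by (auto simp: bij_betw_def)
  have ab: "f a = 0" "f b = 1" "a \<in> verts C" "b \<in> verts C"
    unfolding a_def b_def
    by (rule f_the_inv_into_f[OF inj] the_inv_into_into[OF inj _ order_refl], simp add: img)+
  then have ne: "a \<noteq> b" by auto
  have "x = a \<or> x = b" if "x \<in> verts C" for x
  proof -
    have "f x = f a \<or> f x = f b" using that f ab by (auto simp: bij_betw_def)
    then show ?thesis using f ab that unfolding bij_betw_def inj_on_def by blast
  qed
  then have vs: "verts C = {a, b}" using ab by auto
  have "{a, b} \<in> edges C" using fe[OF ab(3,4)] ab by simp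
  moreover have "e = {a, b}" if "e \<in> edges C" for e
    using finite_simple_graph_edgeE[OF assms(1) that] vs by (metis insert_commute insertE singletonD)
  ultimately have "edges C = {{a, b}}" by blast
  then show ?thesis using that[of a b] ne vs by (cases C) auto
qed

lemma C5_alt: "C5 = ({0, 1, 2, 3, 4}, {{0, 1}, {1, 2}, {2, 3}, {3, 4}, {4, 0}})"
proof -
  have *: "{0..<5} = {0, 1, 2, 3, 4::nat}" by auto
  have "{{i, (i + 1) mod 5} | i. i < (5::nat)} = (\<lambda>i. {i, (i + 1) mod 5}) ` {0..<5}" by auto
  also have "\<dots> = {{0, 1}, {1, 2}, {2, 3}, {3, 4}, {4, 0}}"
    unfolding * by (simp add: insert_commute numeral_2_eq_2)
  finally show ?thesis unfolding C5_def * by simp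
qed

lemma graph_iso_C5E:
  assumes "finite_simple_graph C" "graph_iso C C5"
  obtains a b c d e where "distinct [a, b, c, d, e]"
    "C = ({a, b, c, d, e}, {{a, b}, {b, c}, {c, d}, {d, e}, {e, a}})"
proof -
  let ?F = "{{0, 1}, {1, 2}, {2, 3}, {3, 4}, {4, 0::nat}}"
  obtain f where f: "bij_betw f (verts C) {0, 1, 2, 3, 4::nat}"
    and fe: "\<And>u v. u \<in> verts C \<Longrightarrow> v \<in> verts C \<Longrightarrow> {u, v} \<in> edges C \<longleftrightarrow> {f u, f v} \<in> ?F"
    using assms(2) unfolding graph_iso_def C5_alt by auto
  define g where "g = the_inv_into (verts C) f"
  have fg: "f (g i) = i" "g i \<in> verts C" if "i \<in> {0, 1, 2, 3, 4}" for i
    using that f_the_inv_into_f[of f "verts C" i] the_inv_into_into[of f "verts C" i, OF _ _ order_refl] f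
    unfolding g_def bij_betw_def by metis+
  have vs: "verts C = g ` {0, 1, 2, 3, 4}"
    using bij_betw_the_inv_into[OF f] unfolding g_def bij_betw_def by simp
  have g_edge: "{g i, g j} \<in> edges C \<longleftrightarrow> {i, j} \<in> ?F"
    if "i \<in> {0, 1, 2, 3, 4}" "j \<in> {0, 1, 2, 3, 4}" for i j
    using fe[OF fg(2)[OF that(1)] fg(2)[OF that(2)]] unfolding fg(1)[OF that(1)] fg(1)[OF that(2)] .
  have "inj_on g {0, 1, 2, 3, 4}"
    using bij_betw_the_inv_into[OF f] unfolding g_def bij_betw_def by simp
  then have dist: "distinct [g 0, g 1, g 2, g 3, g 4]"
    by (auto simp: inj_on_def)
  have "edges C = (\<lambda>e. g ` e) ` ?F"
  proof (intro equalityI subsetI)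
    fix e assume e: "e \<in> edges C"
    then obtain u v where uv: "e = {u, v}" "u \<in> verts C" "v \<in> verts C"
      using assms(1) unfolding finite_simple_graph_def by blast
    then obtain i j where ij: "u = g i" "v = g j" "i \<in> {0, 1, 2, 3, 4}" "j \<in> {0, 1, 2, 3, 4}"
      unfolding vs by blast
    then have "{i, j} \<in> ?F" using g_edge[OF ij(3,4)] e uv by simp
    moreover have "e = g ` {i, j}" using ij uv by simp
    ultimately show "e \<in> (\<lambda>e. g ` e) ` ?F" by blast
  next
    fix e assume "e \<in> (\<lambda>e. g ` e) ` ?F"
    then obtain i j where ij: "e = {g i, g j}" "{i, j} \<in> ?F" "i \<in> {0, 1, 2, 3, 4}" "j \<in> {0, 1, 2, 3, 4}"
      by auto
    show "e \<in> edges C" unfolding ij(1) using g_edge[OF ij(3,4)] ij(2) by simp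
  qed
  then show ?thesis using that[OF dist] vs by (cases C) simp
qed

lemma K2_C5_subgraph_k2c5:
  assumes "K2_C5_subgraph H G"
  shows "\<exists>n. k2c5 (verts H) (edges H) n"
proof -
  have H: "finite_simple_graph H"
    and comp: "\<And>C. C \<in> components H \<Longrightarrow> graph_iso C K2 \<or> graph_iso C C5"
    using assms by (auto simp: K2_C5_subgraph_def subgraph_of_def)
  have edgeE: "\<exists>u v. e = {u, v} \<and> u \<in> verts H \<and> v \<in> verts H \<and> u \<noteq> v" if "e \<in> edges H" for e
    using H that unfolding finite_simple_graph_def by blast
  have fin: "finite (components H)"
    using H unfolding components_reachable finite_simple_graph_def by simp
  \<comment> \<open>Stated for every set of components, so that finite induction can add one at a
    time; a new one is disjoint from the earlier ones because reachability is an equivalence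
    relation.\<close>
  have "\<exists>n. k2c5 (\<Union>(verts ` \<C>)) (\<Union>(edges ` \<C>)) n" if "finite \<C>" "\<C> \<subseteq> components H" for \<C>
    using that
  proof (induction rule: finite_induct)
    case empty
    then show ?case using k2c5.empty by auto
  next
    case (insert C \<C>)
    then obtain n where n: "k2c5 (\<Union>(verts ` \<C>)) (\<Union>(edges ` \<C>)) n" by auto
    have C: "C \<in> components H" using insert.prems by simp
    then obtain v where v: "v \<in> verts H" "C = induced_on H (reachable H v)"
      unfolding components_reachable by blast
    have disj: "verts C \<inter> \<Union>(verts ` \<C>) = {}"
    proof (rule ccontr)
      assume "verts C \<inter> \<Union>(verts ` \<C>) \<noteq> {}"
      then obtain w D where w: "w \<in> verts C" "D \<in> \<C>" "w \<in> verts D" by blast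
      then obtain u where u: "D = induced_on H (reachable H u)"
        using insert.prems unfolding components_reachable by blast
      have "w \<in> reachable H v" "w \<in> reachable H u" using w v u by (auto simp: induced_on_def)
      then have "reachable H v = reachable H u" using reachable_eq by metis
      then show False using u v w insert.hyps by simp
    qed
    have simpleC: "finite_simple_graph C"
      unfolding v(2) by (rule finite_simple_graph_induced_on[OF H])
    from comp[OF C] show ?case
    proof
      assume "graph_iso C K2"
      from graph_iso_K2E[OF simpleC this] obtain a b where ab: "a \<noteq> b" "C = ({a, b}, {{a, b}})" .
      then show ?thesis using k2c5.edge[OF n, of a b] disj by auto
    next
      assume "graph_iso C C5"
      from graph_iso_C5E[OF simpleC this] obtain a b c d e where P: "distinct [a, b, c, d, e]"
        "C = ({a, b, c, d, e}, {{a, b}, {b, c}, {c, d}, {d, e}, {e, a}})" .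
      have "k2c5 ({a, b, c, d, e} \<union> \<Union>(verts ` \<C>))
          ({{a, b}, {b, c}, {c, d}, {d, e}, {e, a}} \<union> \<Union>(edges ` \<C>)) (Suc (Suc n))"
        by (rule k2c5.pentagon[OF n P(1)]) (use disj P(2) in simp)
      moreover have "\<Union>(verts ` insert C \<C>) = {a, b, c, d, e} \<union> \<Union>(verts ` \<C>)"
        "\<Union>(edges ` insert C \<C>) = {{a, b}, {b, c}, {c, d}, {d, e}, {e, a}} \<union> \<Union>(edges ` \<C>)"
        using P(2) by auto
      ultimately show ?thesis by metis
    qed
  qed
  from this[OF fin order_refl]
  obtain n where n: "k2c5 (\<Union>(verts ` components H)) (\<Union>(edges ` components H)) n" by blast
  have "\<Union>(verts ` components H) = verts H"
  proof (intro equalityI subsetI)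
    fix v assume "v \<in> verts H"
    then have "v \<in> verts (induced_on H (reachable H v))" by (simp add: induced_on_def)
    then show "v \<in> \<Union>(verts ` components H)"
      unfolding components_reachable using \<open>v \<in> verts H\<close> by blast
  qed (auto simp: components_reachable induced_on_def)
  moreover have "\<Union>(edges ` components H) = edges H"
  proof (intro equalityI subsetI)
    fix e assume e: "e \<in> edges H"
    then obtain u v where uv: "e = {u, v}" "u \<in> verts H" using edgeE by blast
    then have "e \<subseteq> reachable H u" using e reachable_edge[of u v H] by auto
    then have "e \<in> edges (induced_on H (reachable H u))" using e by (simp add: induced_on_def)
    then show "e \<in> \<Union>(edges ` components H)" unfolding components_reachable using uv(2) by blast
  qed (auto simp: components_reachable induced_on_def)
  ultimately show ?thesis using n by auto
qed

text \<open>On the vertices it covers, a matching has its edges as components. This supplies the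
  later witnesses: a single edge for the induced case and for contradicting maximality, a maximum
  matching for the existence of a maximal subgraph.\<close>

lemma matching_K2_C5_subgraph:
  assumes G: "finite_simple_graph G" and M: "M \<subseteq> edges G" "pairwise disjnt M" "M \<noteq> {}"
  shows "K2_C5_subgraph (\<Union>M, M) G"
proof -
  let ?H = "(\<Union>M, M)"
  have edgeE: "\<exists>u v. e = {u, v} \<and> u \<in> verts G \<and> v \<in> verts G \<and> u \<noteq> v" if "e \<in> M" for e
    using G M that unfolding finite_simple_graph_def by blast
  have UM: "\<Union>M \<subseteq> verts G" using edgeE by fastforce
  have disj: "e = f" if "e \<in> M" "f \<in> M" "v \<in> e" "v \<in> f" for e f v
    using M(2) that by (auto simp: pairwise_def disjnt_iff)
  have "finite_simple_graph ?H"
    unfolding finite_simple_graph_def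
  proof
    show "finite (verts ?H)" using UM G finite_subset by (auto simp: finite_simple_graph_def)
    show "edges ?H \<subseteq> {{u, v} |u v. u \<in> verts ?H \<and> v \<in> verts ?H \<and> u \<noteq> v}"
    proof
      fix e assume e: "e \<in> edges ?H"
      then obtain u v where "e = {u, v}" "u \<noteq> v" using edgeE[of e] by auto
      moreover have "u \<in> \<Union>M" "v \<in> \<Union>M" using e calculation by auto
      ultimately show "e \<in> {{u, v} |u v. u \<in> verts ?H \<and> v \<in> verts ?H \<and> u \<noteq> v}" by auto
    qed
  qed
  moreover have "graph_iso C K2" if C: "C \<in> components ?H" for C
  proof -
    obtain v where v: "v \<in> \<Union>M" "C = induced_on ?H (reachable ?H v)"
      using C unfolding components_reachable by auto
    then obtain e where e: "e \<in> M" "v \<in> e" by auto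
    then obtain w where w: "e = {v, w}" "v \<noteq> w" using edgeE[of e] by auto
    have "reachable ?H v = e"
    proof
      show "e \<subseteq> reachable ?H v" using w e reachable_edge[of v w ?H] by auto
      have "y \<in> e" if "(v, y) \<in> {(a, b). {a, b} \<in> M}\<^sup>*" for y
        using that
      proof (induction rule: rtrancl_induct)
        case (step y z)
        then show ?case using disj[of e "{y, z}" y] e by auto
      qed (use e in simp)
      then show "reachable ?H v \<subseteq> e" by (auto simp: reachable_def)
    qed
    moreover have "f = e" if f: "f \<in> M" "f \<subseteq> e" for f
    proof -
      obtain u where "u \<in> f" using edgeE[OF f(1)] by auto
      then show ?thesis using disj[of f e u] f e by auto
    qed
    ultimately have C_eq: "C = ({v, w}, {{v, w}})"
      using v e w by (auto simp: induced_on_def)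
    show ?thesis
      unfolding graph_iso_def C_eq K2_def
    proof (intro exI[of _ "\<lambda>x. if x = v then 0 else 1"] conjI)
      show "bij_betw (\<lambda>x. if x = v then 0 else 1) (verts ({v, w}, {{v, w}})) (verts ({0, 1}, {{0, 1::nat}}))"
        using w by (auto simp: bij_betw_def)
    qed (use w in \<open>auto simp: doubleton_eq_iff\<close>)
  qed
  moreover have "\<Union>M \<noteq> {}" using M(3) edgeE by fastforce
  ultimately show ?thesis
    unfolding K2_C5_subgraph_def subgraph_of_def using UM M(1) by auto
qed

lemma finite_subgraphs:
  assumes "finite_simple_graph G"
  shows "finite {H. subgraph_of H G}"
proof -
  have "edges G \<subseteq> Pow (verts G)" using assms unfolding finite_simple_graph_def by blast
  then have "finite (edges G)" using assms finite_subset unfolding finite_simple_graph_def by blast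
  then have "finite (Pow (verts G) \<times> Pow (edges G))" using assms by (simp add: finite_simple_graph_def)
  then show ?thesis by (rule finite_subset[rotated]) (auto simp: subgraph_of_def)
qed

text \<open>Guarantees that the \<open>Min\<close> is taken over a nonempty set. A maximum matching
  works: any subgraph of the given kind avoiding it contains an edge by which the matching could
  grow.\<close>

lemma maximal_K2_C5_subgraph_exists:
  assumes G: "finite_simple_graph G" and "edges G \<noteq> {}"
  shows "\<exists>H. maximal_K2_C5_subgraph H G"
proof -
  have edgeE: "\<exists>u v. e = {u, v} \<and> u \<in> verts G \<and> v \<in> verts G \<and> u \<noteq> v" if "e \<in> edges G" for e
    using G that unfolding finite_simple_graph_def by blast
  then have "edges G \<subseteq> Pow (verts G)" by fast
  then have fE: "finite (edges G)" using G finite_subset unfolding finite_simple_graph_def by blast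
  let ?P = "\<lambda>M. M \<subseteq> edges G \<and> pairwise disjnt M"
  have "\<exists>M. ?P M \<and> (\<forall>M'. ?P M' \<longrightarrow> card M' \<le> card M)"
    by (rule ex_has_greatest_nat[of ?P "{}" card "Suc (card (edges G))"])
      (use card_mono[OF fE] in \<open>auto simp: le_imp_less_Suc\<close>)
  then obtain M where M: "M \<subseteq> edges G" "pairwise disjnt M"
    and max: "\<And>M'. M' \<subseteq> edges G \<Longrightarrow> pairwise disjnt M' \<Longrightarrow> card M' \<le> card M" by blast
  have fM: "finite M" using M fE finite_subset by blast
  have "M \<noteq> {}"
  proof
    assume "M = {}"
    moreover obtain e where "e \<in> edges G" using assms(2) by auto
    ultimately show False using max[of "{e}"] by auto
  qed
  moreover have False if H': "K2_C5_subgraph H' (delete_verts G (\<Union>M))" for H'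
  proof -
    obtain n where n: "k2c5 (verts H') (edges H') n" using K2_C5_subgraph_k2c5[OF H'] by blast
    have "verts H' \<noteq> {}" using H' by (simp add: K2_C5_subgraph_def)
    then obtain e where "e \<in> edges H'" using k2c5_nonempty[OF n] by auto
    then have "e \<in> edges (delete_verts G (\<Union>M))"
      using H' by (auto simp: K2_C5_subgraph_def subgraph_of_def)
    then have e: "e \<in> edges G" "e \<inter> \<Union>M = {}"
      unfolding delete_verts_def induced_on_def by auto
    obtain u where u: "u \<in> e" using edgeE[OF e(1)] by blast
    then have "e \<notin> M" using e by auto
    moreover have "pairwise disjnt (insert e M)"
      using M(2) e(2) by (auto simp: pairwise_insert disjnt_def)
    ultimately show False using max[of "insert e M"] e M fM by auto
  qed
  ultimately show ?thesis
    unfolding maximal_K2_C5_subgraph_def using matching_K2_C5_subgraph[OF G M]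
    by (intro exI[of _ "(\<Union>M, M)"]) auto
qed

text \<open>\<open>W\<close> collects the vertices outside the subgraph, and each component raises
  the bound by its own matching number. \<open>E'\<close> may contain further edges among the
  vertices of \<open>X\<close>, as chords do no harm to the upper bound.\<close>

lemma (in sign_system) k2c5_vanishes_above:
  assumes E': "E' \<subseteq> {{u, v} | u v. u \<in> V \<and> v \<in> V \<and> u \<noteq> v}"
  shows "k2c5 X E n \<Longrightarrow> E \<subseteq> E' \<Longrightarrow> X \<union> W \<subseteq> V \<Longrightarrow> vanishes_above E' W 0
    \<Longrightarrow> vanishes_above E' (X \<union> W) n"
proof (induction rule: k2c5.induct)
  case (edge X E n a b)
  then show ?case using vanishes_above_edge[OF E', of a b "X \<union> W" n] by simp
next
  case (pentagon X E n a b c d e)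
  then show ?case using vanishes_above_pentagon[OF E', of a b c d e "X \<union> W" n] by (simp add: Un_assoc)
qed simp

lemma (in sign_system) coh_vanishes_min_match:
  assumes G: "finite_simple_graph G" and V: "V = verts G"
  shows "vanishes_above (edges G) V (min_match_K2_C5 G)"
proof (cases "edges G = {}")
  case True
  have "vanishes_above (edges G) V 0"
    by (rule vanishes_above_indep) (use True in \<open>auto simp: indep_def\<close>)
  then show ?thesis using True by (simp add: min_match_K2_C5_def)
next
  case False
  have E: "edges G \<subseteq> {{u, v} | u v. u \<in> V \<and> v \<in> V \<and> u \<noteq> v}"
    using G V by (simp add: finite_simple_graph_def)
  let ?S = "{matching_number H | H. maximal_K2_C5_subgraph H G}"
  have "finite ?S"
    by (rule finite_subset[of _ "matching_number ` {H. subgraph_of H G}"])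
      (use finite_subgraphs[OF G] in \<open>auto simp: maximal_K2_C5_subgraph_def K2_C5_subgraph_def\<close>)
  moreover have "?S \<noteq> {}" using maximal_K2_C5_subgraph_exists[OF G False] by auto
  ultimately have "min_match_K2_C5 G \<in> ?S"
    using False Min_in[of ?S] by (simp add: min_match_K2_C5_def)
  then obtain H where H: "min_match_K2_C5 G = matching_number H" "maximal_K2_C5_subgraph H G" by auto
  then have HG: "K2_C5_subgraph H G" by (simp add: maximal_K2_C5_subgraph_def)
  then obtain n where n: "k2c5 (verts H) (edges H) n" using K2_C5_subgraph_k2c5 by blast
  let ?W = "V - verts H"
  \<comment> \<open>An edge avoiding \<open>H\<close> would be a copy of K_2 in the rest, against
    maximality.\<close>
  have "indep (edges G) ?W"
    unfolding indep_def
  proof (intro ballI notI)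
    fix e assume e: "e \<in> edges G" "e \<subseteq> ?W"
    have "finite_simple_graph (delete_verts G (verts H))"
      unfolding delete_verts_def by (rule finite_simple_graph_induced_on[OF G])
    moreover have "e \<in> edges (delete_verts G (verts H))"
      using e V by (auto simp: delete_verts_def induced_on_def)
    ultimately have "K2_C5_subgraph (\<Union>{e}, {e}) (delete_verts G (verts H))"
      by (intro matching_K2_C5_subgraph) auto
    then show False using H(2) unfolding maximal_K2_C5_subgraph_def by blast
  qed
  then have "vanishes_above (edges G) ?W 0" by (intro vanishes_above_indep[OF E]) auto
  moreover have "verts H \<union> ?W = V" "edges H \<subseteq> edges G"
    using HG V by (auto simp: K2_C5_subgraph_def subgraph_of_def)
  ultimately have "vanishes_above (edges G) V n"
    using k2c5_vanishes_above[OF E n, of ?W] by simp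
  then show ?thesis using H(1) k2c5_matching_number[OF n] by simp
qed

text \<open>Being induced enters through the last clause: inside \<open>X\<close>, the ambient graph
  and the subgraph have the same independent sets.\<close>

lemma ind_match_attained:
  assumes G: "finite_simple_graph G" and "edges G \<noteq> {}"
  obtains X E where "k2c5 X E (ind_match_K2_C5 G)" "X \<subseteq> verts G" "X \<noteq> {}"
    "\<And>\<tau>. \<tau> \<subseteq> X \<Longrightarrow> indep (edges G) \<tau> \<longleftrightarrow> indep E \<tau>"
proof -
  let ?S = "{matching_number H | H. induced_K2_C5_subgraph H G}"
  have "finite ?S"
    by (rule finite_subset[of _ "matching_number ` {H. subgraph_of H G}"])
      (use finite_subgraphs[OF G] in \<open>auto simp: induced_K2_C5_subgraph_def K2_C5_subgraph_def\<close>)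
  moreover have "?S \<noteq> {}"
  proof -
    obtain e where e: "e \<in> edges G" using assms(2) by auto
    then obtain u v where uv: "e = {u, v}" "u \<in> verts G" "v \<in> verts G" "u \<noteq> v"
      using G unfolding finite_simple_graph_def by blast
    have K: "K2_C5_subgraph (\<Union>{e}, {e}) G" by (rule matching_K2_C5_subgraph[OF G]) (use e in auto)
    have "f = e" if f: "f \<in> edges G" "f \<subseteq> e" for f
    proof -
      obtain x y where "f = {x, y}" "x \<noteq> y" using f(1) G unfolding finite_simple_graph_def by blast
      then show ?thesis using f(2) uv by auto
    qed
    then have "(\<Union>{e}, {e}) = induced_on G (verts (\<Union>{e}, {e}))"
      using e uv by (auto simp: induced_on_def)
    then have "induced_K2_C5_subgraph (\<Union>{e}, {e}) G"
      using K unfolding induced_K2_C5_subgraph_def induced_subgraph_of_def K2_C5_subgraph_def by blast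
    then show ?thesis by blast
  qed
  ultimately have "ind_match_K2_C5 G \<in> ?S"
    using assms(2) Max_in[of ?S] by (simp add: ind_match_K2_C5_def)
  then obtain H where H: "ind_match_K2_C5 G = matching_number H" "induced_K2_C5_subgraph H G" by auto
  then have HG: "K2_C5_subgraph H G" and ind: "H = induced_on G (verts H)"
    unfolding induced_K2_C5_subgraph_def induced_subgraph_of_def by blast+
  have EH: "edges H = {e \<in> edges G. e \<subseteq> verts H}"
    using arg_cong[OF ind, of edges] unfolding induced_on_def snd_conv .
  from K2_C5_subgraph_k2c5[OF HG] obtain n where n: "k2c5 (verts H) (edges H) n" by blast
  then have "ind_match_K2_C5 G = n" using H k2c5_matching_number by simp
  moreover have "indep (edges G) \<tau> \<longleftrightarrow> indep (edges H) \<tau>" if "\<tau> \<subseteq> verts H" for \<tau>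
    unfolding EH indep_def using that by auto
  moreover have "verts H \<subseteq> verts G" "verts H \<noteq> {}"
    using HG(1) by (auto simp: K2_C5_subgraph_def subgraph_of_def)
  ultimately show ?thesis using that n by blast
qed

section \<open>Polynomial rings and monomial ideals\<close>

lemma keys_add_nat: "keys (m + n) = keys m \<union> keys (n :: 'v \<Rightarrow>\<^sub>0 nat)"
  by (auto simp: in_keys_iff lookup_add)

lemma monom_degree_superset:
  assumes "finite A" "keys m \<subseteq> A"
  shows "monom_degree m = (\<Sum>v\<in>A. lookup m v)"
  unfolding monom_degree_def
  by (rule sum.mono_neutral_left) (use assms in \<open>auto simp: in_keys_iff\<close>)

lemma monom_degree_add: "monom_degree (m + n) = monom_degree m + monom_degree n"
proof -
  let ?A = "keys m \<union> keys n"
  have "monom_degree (m + n) = (\<Sum>v\<in>?A. lookup m v + lookup n v)"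
    by (subst monom_degree_superset[of ?A]) (auto simp: keys_add_nat lookup_add)
  also have "\<dots> = monom_degree m + monom_degree n"
    unfolding sum.distrib by (subst (1 2) monom_degree_superset[of ?A]) auto
  finally show ?thesis .
qed

lemma monom_degree_0 [simp]: "monom_degree 0 = 0"
  by (simp add: monom_degree_def)

lemma monom_degree_eq_0_iff: "monom_degree m = 0 \<longleftrightarrow> m = 0"
proof
  assume "monom_degree m = 0"
  then have "\<forall>v\<in>keys m. lookup m v = 0"
    by (simp add: monom_degree_def)
  then show "m = 0" by (intro poly_mapping_eqI) (auto simp: in_keys_iff)
qed simp

lemma monom_degree_single [simp]: "monom_degree (single v n) = n"
  by (simp add: monom_degree_def)

lemma poly_mapping_sum_single:
  "p = (\<Sum>m\<in>keys p. single m (lookup p m))"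
  by (rule poly_mapping_eqI) (auto simp: lookup_sum lookup_single when_def in_keys_iff)

lemma lookup_single_mult_add:
  fixes p :: "('v, 'k::field) mpoly"
  shows "lookup (single s c * p) (s + m) = c * lookup p m"
  by (simp add: lookup_mult lookup_single when_mult)

lemma lookup_single_mult_0:
  fixes p :: "('v, 'k::field) mpoly"
  assumes "\<And>n. m \<noteq> s + n"
  shows "lookup (single s c * p) m = 0"
  by (simp add: lookup_mult lookup_single when_mult assms)

lemma add_single_diff: "v \<in> keys m \<Longrightarrow> single v 1 + (m - single v 1) = (m :: 'v \<Rightarrow>\<^sub>0 nat)"
  by (rule poly_mapping_eqI) (auto simp: lookup_add lookup_minus lookup_single when_def in_keys_iff)

lemma lookup_var_mult:
  fixes p :: "('v, 'k::field) mpoly"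
  shows "lookup (var v * p) m =
    (if v \<in> keys m then lookup p (m - single v 1) else 0)"
proof (cases "v \<in> keys m")
  case True
  then show ?thesis
    using lookup_single_mult_add[of "single v 1" 1 p "m - single v 1"]
    by (simp add: add_single_diff var_def del: One_nat_def)
next
  case False
  have "m \<noteq> single v 1 + n" for n
    using False by (auto simp: keys_add_nat)
  then show ?thesis using False by (simp add: var_def lookup_single_mult_0)
qed

lemma lookup_sign_mult:
  fixes p :: "('v, 'k::field) mpoly"
  shows "lookup ((-1) ^ n * p) m = (-1) ^ n * lookup p m"
  by (cases "even n") auto

lemma add_eq_0_nat_mapping: "m + n = 0 \<longleftrightarrow> m = 0 \<and> n = (0 :: 'v \<Rightarrow>\<^sub>0 nat)"
  by (auto simp: poly_mapping_eq_iff lookup_add fun_eq_iff)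

text \<open>Exponents are natural numbers, so only constant terms multiply to a constant
  term.\<close>

lemma lookup_mult_0:
  fixes p q :: "('v, 'k::field) mpoly"
  shows "lookup (p * q) 0 = lookup p 0 * lookup q 0"
proof -
  have "(\<Sum>n. lookup q n when 0 = m + n) = (lookup q 0 when m = 0)" for m
  proof (cases "m = 0")
    case False
    then have "0 \<noteq> m + n" for n using add_eq_0_nat_mapping[of m n] by auto
    then show ?thesis using False by simp
  qed simp
  then show ?thesis by (simp add: lookup_mult mult_when)
qed

lemma carrier_poly_ring_iff:
  "p \<in> carrier (poly_ring V) \<longleftrightarrow> (\<forall>m. lookup p m \<noteq> 0 \<longrightarrow> keys m \<subseteq> V)"
  by (auto simp: poly_ring_def in_keys_iff)

lemma poly_ring_simps [simp]:
  "mult (poly_ring V) = (*)" "one (poly_ring V) = 1" "zero (poly_ring V) = 0" "add (poly_ring V) = (+)"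
  by (simp_all add: poly_ring_def)

lemma homogeneous_part_iff:
  "p \<in> homogeneous_part V j \<longleftrightarrow>
    (\<forall>m. lookup p m \<noteq> 0 \<longrightarrow> keys m \<subseteq> V \<and> int (monom_degree m) = j)"
  by (auto simp: homogeneous_part_def carrier_poly_ring_iff in_keys_iff)

lemma homogeneous_part_carrier: "p \<in> homogeneous_part V j \<Longrightarrow> p \<in> carrier (poly_ring V)"
  by (simp add: homogeneous_part_def)

lemma poly_ring_closed:
  fixes p q :: "('v, 'k::field) mpoly"
  shows "0 \<in> carrier (poly_ring V :: ('v, 'k) mpoly ring)" "1 \<in> carrier (poly_ring V :: ('v, 'k) mpoly ring)"
    "p \<in> carrier (poly_ring V) \<Longrightarrow> q \<in> carrier (poly_ring V) \<Longrightarrow> p + q \<in> carrier (poly_ring V)"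
    "p \<in> carrier (poly_ring V) \<Longrightarrow> - p \<in> carrier (poly_ring V)"
    "p \<in> carrier (poly_ring V) \<Longrightarrow> q \<in> carrier (poly_ring V) \<Longrightarrow> p - q \<in> carrier (poly_ring V)"
    "p \<in> carrier (poly_ring V) \<Longrightarrow> q \<in> carrier (poly_ring V) \<Longrightarrow> p * q \<in> carrier (poly_ring V)"
    "v \<in> V \<Longrightarrow> var v \<in> carrier (poly_ring V :: ('v, 'k) mpoly ring)"
proof -
  show "p \<in> carrier (poly_ring V) \<Longrightarrow> q \<in> carrier (poly_ring V) \<Longrightarrow> p + q \<in> carrier (poly_ring V)"
    unfolding carrier_poly_ring_iff lookup_add by (metis add.right_neutral)
  show "p \<in> carrier (poly_ring V) \<Longrightarrow> q \<in> carrier (poly_ring V) \<Longrightarrow> p - q \<in> carrier (poly_ring V)"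
    unfolding carrier_poly_ring_iff lookup_minus by (metis diff_0_right)
  show "p * q \<in> carrier (poly_ring V)" if pq: "p \<in> carrier (poly_ring V)" "q \<in> carrier (poly_ring V)"
  proof -
    have "keys m \<subseteq> V" if "m \<in> keys (p * q)" for m
    proof -
      obtain a b where "m = a + b" "a \<in> keys p" "b \<in> keys q"
        using keys_mult[of p q] \<open>m \<in> _\<close> by auto
      then show ?thesis using pq by (auto simp: keys_add_nat carrier_poly_ring_iff in_keys_iff)
    qed
    then show ?thesis by (simp add: carrier_poly_ring_iff in_keys_iff)
  qed
qed (auto simp: carrier_poly_ring_iff lookup_one when_def var_def lookup_single)

lemma cring_poly_ring: "cring (poly_ring V :: ('v, 'k::field) mpoly ring)"
proof (rule cringI)
  show "abelian_group (poly_ring V :: ('v, 'k) mpoly ring)"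
  proof (rule abelian_groupI)
    fix p :: "('v, 'k) mpoly" assume "p \<in> carrier (poly_ring V)"
    then show "\<exists>y\<in>carrier (poly_ring V). y \<oplus>\<^bsub>poly_ring V\<^esub> p = \<zero>\<^bsub>poly_ring V\<^esub>"
      by (intro bexI[of _ "- p"]) (auto intro: poly_ring_closed)
  qed (auto intro: poly_ring_closed simp: ac_simps)
  show "comm_monoid (poly_ring V :: ('v, 'k) mpoly ring)"
    by (rule comm_monoidI) (auto intro: poly_ring_closed simp: ac_simps)
qed (auto simp: distrib_right)

lemma homogeneous_part_closed:
  fixes p q :: "('v, 'k::field) mpoly"
  shows "0 \<in> homogeneous_part V j"
    "p \<in> homogeneous_part V j \<Longrightarrow> q \<in> homogeneous_part V j \<Longrightarrow> p + q \<in> homogeneous_part V j"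
    "p \<in> homogeneous_part V j \<Longrightarrow> - p \<in> homogeneous_part V j"
    "p \<in> homogeneous_part V j \<Longrightarrow> q \<in> homogeneous_part V j \<Longrightarrow> p - q \<in> homogeneous_part V j"
    "v \<in> V \<Longrightarrow> (var v :: ('v, 'k) mpoly) \<in> homogeneous_part V 1"
    "(single 0 c :: ('v, 'k) mpoly) \<in> homogeneous_part V 0"
    "(1 :: ('v, 'k) mpoly) \<in> homogeneous_part V 0"
proof -
  show "p \<in> homogeneous_part V j \<Longrightarrow> q \<in> homogeneous_part V j \<Longrightarrow> p + q \<in> homogeneous_part V j"
    unfolding homogeneous_part_iff lookup_add by (metis add.right_neutral)
  show "p \<in> homogeneous_part V j \<Longrightarrow> q \<in> homogeneous_part V j \<Longrightarrow> p - q \<in> homogeneous_part V j"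
    unfolding homogeneous_part_iff lookup_minus by (metis diff_0_right)
qed (auto simp: homogeneous_part_iff lookup_one when_def var_def lookup_single)

lemma homogeneous_part_mult:
  fixes p q :: "('v, 'k::field) mpoly"
  assumes "p \<in> homogeneous_part V i" "q \<in> homogeneous_part V j" "l = i + j"
  shows "p * q \<in> homogeneous_part V l"
proof -
  have "keys m \<subseteq> V \<and> int (monom_degree m) = l" if "m \<in> keys (p * q)" for m
  proof -
    obtain a b where "m = a + b" "a \<in> keys p" "b \<in> keys q"
      using keys_mult[of p q] \<open>m \<in> _\<close> by auto
    then show ?thesis using assms
      by (auto simp: keys_add_nat monom_degree_add homogeneous_part_iff in_keys_iff)
  qed
  then show ?thesis by (simp add: homogeneous_part_iff in_keys_iff)
qed

lemma homogeneous_part_sum: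
  fixes f :: "'a \<Rightarrow> ('v, 'k::field) mpoly"
  shows "(\<And>x. x \<in> A \<Longrightarrow> f x \<in> homogeneous_part V j) \<Longrightarrow> sum f A \<in> homogeneous_part V j"
  by (induction A rule: infinite_finite_induct) (auto intro: homogeneous_part_closed)

lemma poly_ring_sum:
  fixes f :: "'a \<Rightarrow> ('v, 'k::field) mpoly"
  shows "(\<And>x. x \<in> A \<Longrightarrow> f x \<in> carrier (poly_ring V)) \<Longrightarrow> sum f A \<in> carrier (poly_ring V)"
  by (induction A rule: infinite_finite_induct) (auto intro: poly_ring_closed)

lemma homogeneous_part_sign:
  fixes p :: "('v, 'k::field) mpoly"
  shows "p \<in> homogeneous_part V j \<Longrightarrow> (-1) ^ n * p \<in> homogeneous_part V j"
  by (cases "even n") (auto intro: homogeneous_part_closed)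

lemma homogeneous_part_neg: "p \<in> homogeneous_part V j \<Longrightarrow> j < 0 \<Longrightarrow> p = 0"
  by (rule poly_mapping_eqI) (auto simp: homogeneous_part_iff)

lemma homogeneous_part_0: "p \<in> homogeneous_part V 0 \<Longrightarrow> p = single 0 (lookup p 0)"
  by (rule poly_mapping_eqI)
    (auto simp: homogeneous_part_iff lookup_single when_def monom_degree_eq_0_iff)

lemma homogeneous_part_const: "p \<in> homogeneous_part V j \<Longrightarrow> j \<noteq> 0 \<Longrightarrow> lookup p 0 = 0"
  by (auto simp: homogeneous_part_iff)

definition hcomp :: "int \<Rightarrow> ('v, 'k::field) mpoly \<Rightarrow> ('v, 'k) mpoly" where
  "hcomp j p = (\<Sum>m | m \<in> keys p \<and> int (monom_degree m) = j.
     single m (lookup p m))"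

lemma lookup_hcomp:
  "lookup (hcomp j p) m = (if int (monom_degree m) = j then lookup p m else 0)"
  by (auto simp: hcomp_def lookup_sum lookup_single when_def in_keys_iff)

lemma hcomp_add: "hcomp j (p + q) = hcomp j p + hcomp j q"
  by (rule poly_mapping_eqI) (simp add: lookup_hcomp lookup_add)

lemma hcomp_0 [simp]: "hcomp j 0 = 0"
  by (simp add: hcomp_def)

lemma hcomp_sum: "hcomp j (sum f A) = (\<Sum>x\<in>A. hcomp j (f x))"
  by (induction A rule: infinite_finite_induct) (auto simp: hcomp_add)

lemma hcomp_in: "p \<in> carrier (poly_ring V) \<Longrightarrow> hcomp j p \<in> homogeneous_part V j"
  by (auto simp: homogeneous_part_iff lookup_hcomp carrier_poly_ring_iff)

lemma hcomp_homogeneous: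
  "p \<in> homogeneous_part V i \<Longrightarrow> hcomp j p = (if i = j then p else 0)"
  by (rule poly_mapping_eqI) (auto simp: lookup_hcomp homogeneous_part_iff)

definition hdegs :: "('v, 'k::field) mpoly \<Rightarrow> int set" where
  "hdegs p = (\<lambda>m. int (monom_degree m)) ` keys p"

lemma finite_hdegs: "finite (hdegs p)"
  by (simp add: hdegs_def)

lemma sum_hcomp:
  assumes "finite J" "hdegs p \<subseteq> J"
  shows "(\<Sum>j\<in>J. hcomp j p) = p"
proof (rule poly_mapping_eqI)
  fix m
  have "lookup p m = 0" if "int (monom_degree m) \<notin> J"
    using that assms(2) by (auto simp: hdegs_def in_keys_iff image_subset_iff)
  then show "lookup (\<Sum>j\<in>J. hcomp j p) m = lookup p m"
    using assms(1) by (auto simp: lookup_sum lookup_hcomp)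
qed

text \<open>The right-hand side is an ideal containing the generators, and conversely each term of
  one of its elements is a multiple of a generator. Specialised below to the irrelevant ideal and to
  the edge ideal.\<close>

lemma genideal_monomials:
  fixes V :: "'v set"
  assumes T: "\<And>s. s \<in> T \<Longrightarrow> keys s \<subseteq> V"
  shows "Idl\<^bsub>poly_ring V\<^esub> ((\<lambda>s. single s (1::'k::field)) ` T)
    = {p \<in> carrier (poly_ring V). \<forall>m\<in>keys p. \<exists>s\<in>T. \<exists>n. m = s + n}"
    (is "?I = ?J")
proof
  interpret R: cring "poly_ring V :: ('v, 'k) mpoly ring" by (rule cring_poly_ring)
  have S: "(\<lambda>s. single s (1::'k)) ` T \<subseteq> carrier (poly_ring V)"
    using T by (auto simp: carrier_poly_ring_iff lookup_single when_def)
  have J_add: "p + q \<in> ?J" if "p \<in> ?J" "q \<in> ?J" for p q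
  proof -
    have "keys (p + q) \<subseteq> keys p \<union> keys q" by (rule keys_add)
    then show ?thesis using that by (blast intro: poly_ring_closed)
  qed
  have J_mult: "p * q \<in> ?J" if "p \<in> ?J" "q \<in> carrier (poly_ring V)" for p q
  proof -
    have "\<exists>s\<in>T. \<exists>n. m = s + n" if "m \<in> keys (p * q)" for m
    proof -
      obtain a b where "m = a + b" "a \<in> keys p"
        using keys_mult[of p q] \<open>m \<in> _\<close> by auto
      then obtain s n where "s \<in> T" "a = s + n" using \<open>p \<in> ?J\<close> by blast
      then have "m = s + (n + b)" using \<open>m = a + b\<close> by (simp add: add.assoc)
      then show ?thesis using \<open>s \<in> T\<close> by blast
    qed
    then show ?thesis using that by (blast intro: poly_ring_closed)
  qed
  have "ideal ?J (poly_ring V)"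
  proof (rule idealI)
    show "ring (poly_ring V :: ('v, 'k) mpoly ring)" by (rule R.ring_axioms)
    show "subgroup ?J (add_monoid (poly_ring V))"
    proof (rule R.add.subgroupI)
      show "?J \<noteq> {}" using poly_ring_closed(1) by force
      show "\<ominus>\<^bsub>poly_ring V\<^esub> p \<in> ?J" if "p \<in> ?J" for p
      proof -
        have "\<ominus>\<^bsub>poly_ring V\<^esub> p = - p"
          using that by (intro R.minus_equality) (auto intro: poly_ring_closed)
        then show ?thesis using that by (auto intro: poly_ring_closed simp: in_keys_iff)
      qed
      show "p \<oplus>\<^bsub>poly_ring V\<^esub> q \<in> ?J" if "p \<in> ?J" "q \<in> ?J" for p q
        unfolding poly_ring_simps by (rule J_add[OF that])
    qed auto
  next
    fix p q :: "('v, 'k) mpoly" assume pq: "p \<in> ?J" "q \<in> carrier (poly_ring V)"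
    show "p \<otimes>\<^bsub>poly_ring V\<^esub> q \<in> ?J" unfolding poly_ring_simps by (rule J_mult[OF pq])
    show "q \<otimes>\<^bsub>poly_ring V\<^esub> p \<in> ?J"
      unfolding poly_ring_simps by (subst mult.commute) (rule J_mult[OF pq])
  qed
  moreover have "(\<lambda>s. single s (1::'k)) ` T \<subseteq> ?J"
  proof (intro image_subsetI)
    fix s assume s: "s \<in> T"
    have "\<exists>s'\<in>T. \<exists>n. s = s' + n" by (rule bexI[of _ s], rule exI[of _ 0]) (use s in auto)
    then show "single s (1::'k) \<in> ?J" using S s by auto
  qed
  ultimately show "?I \<subseteq> ?J" by (rule R.genideal_minimal)
  have I: "ideal ?I (poly_ring V)" by (rule R.genideal_ideal[OF S])
  show "?J \<subseteq> ?I"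
  proof
    fix p assume p: "p \<in> ?J"
    have terms: "single m (lookup p m) \<in> ?I" if m: "m \<in> keys p" for m
    proof -
      obtain s n where s: "s \<in> T" "m = s + n" using p m by blast
      have "keys m \<subseteq> V" using p m by (auto simp: carrier_poly_ring_iff in_keys_iff)
      then have "single n (lookup p m) \<in> carrier (poly_ring V)"
        using s by (auto simp: carrier_poly_ring_iff lookup_single when_def keys_add_nat)
      moreover have "single s 1 \<in> ?I" using R.genideal_self[OF S] s by auto
      ultimately have "single s 1 \<otimes>\<^bsub>poly_ring V\<^esub> single n (lookup p m) \<in> ?I"
        using ideal.I_r_closed[OF I] by blast
      then show ?thesis using s by (simp add: mult_single)
    qed
    have sums: "sum f A \<in> ?I" if "\<And>m. m \<in> A \<Longrightarrow> f m \<in> ?I" for f and A :: "('v \<Rightarrow>\<^sub>0 nat) set"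
      using that
    proof (induction A rule: infinite_finite_induct)
      case (insert x F)
      then have "f x \<oplus>\<^bsub>poly_ring V\<^esub> sum f F \<in> ?I"
        by (intro additive_subgroup.a_closed[OF ideal.axioms(1)[OF I]]) auto
      then show ?case using insert.hyps by simp
    qed (use additive_subgroup.zero_closed[OF ideal.axioms(1)[OF I]] in auto)
    have "(\<Sum>m\<in>keys p. single m (lookup p m)) \<in> ?I"
      by (rule sums, rule terms)
    then show "p \<in> ?I" unfolding poly_mapping_sum_single[symmetric] .
  qed
qed

text \<open>Turns minimality of a resolution into the vanishing of constant terms.\<close>

lemma irrelevant_ideal_eq:
  "(irrelevant_ideal V :: ('v, 'k::field) mpoly set) = {p \<in> carrier (poly_ring V). lookup p 0 = 0}"
proof -
  have *: "(\<exists>s\<in>(\<lambda>v. single v 1) ` V. \<exists>n. m = s + n) \<longleftrightarrow> m \<noteq> 0"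
    if "keys m \<subseteq> V" for m :: "'v \<Rightarrow>\<^sub>0 nat"
  proof
    assume "m \<noteq> 0"
    then obtain v where v: "v \<in> keys m" by (metis equals0I keys_eq_empty)
    show "\<exists>s\<in>(\<lambda>v. single v 1) ` V. \<exists>n. m = s + n"
      using v that add_single_diff[OF v, symmetric] by blast
  qed (auto simp: add_eq_0_nat_mapping poly_mapping_eq_iff fun_eq_iff lookup_add lookup_single when_def)
  have "irrelevant_ideal V = Idl\<^bsub>poly_ring V\<^esub> ((\<lambda>s. single s (1::'k)) ` ((\<lambda>v. single v 1) ` V))"
    unfolding irrelevant_ideal_def image_image var_def ..
  also have "\<dots> = {p \<in> carrier (poly_ring V). \<forall>m\<in>keys p.
      \<exists>s\<in>(\<lambda>v. single v 1) ` V. \<exists>n. m = s + n}"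
    by (rule genideal_monomials) auto
  also have "\<dots> = {p \<in> carrier (poly_ring V). \<forall>m\<in>keys p. m \<noteq> 0}"
    by (intro Collect_cong conj_cong refl ball_cong *) (auto simp: carrier_poly_ring_iff in_keys_iff)
  also have "\<dots> = {p \<in> carrier (poly_ring V). lookup p 0 = 0}"
    by (auto simp: in_keys_iff)
  finally show ?thesis .
qed

text \<open>The generators are squarefree, so divisibility by one of them depends only on the
  support of a monomial; this is how independent sets enter.\<close>

lemma edge_ideal_eq:
  assumes G: "finite_simple_graph G"
  shows "(edge_ideal G :: ('v, 'k::field) mpoly set) =
    {p \<in> carrier (poly_ring (verts G)). \<forall>m. lookup p m \<noteq> 0 \<longrightarrow> \<not> indep (edges G) (keys m)}"
proof -
  define T where "T = {single u 1 + single v (1::nat) | u v. {u, v} \<in> edges G}"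
  have uv: "u \<in> verts G" "v \<in> verts G" "u \<noteq> v" if "{u, v} \<in> edges G" for u v
    using finite_simple_graph_edgeE[OF G that] by (auto simp: doubleton_eq_iff)
  have *: "var u * var v = (\<lambda>s. single s (1::'k)) (single u 1 + single v 1)" for u v :: 'v
    by (simp add: var_def mult_single)
  then have "{var u * var v | u v. {u, v} \<in> edges G} = (\<lambda>s. single s (1::'k)) ` T"
    unfolding T_def * by blast
  then have "(edge_ideal G :: ('v, 'k) mpoly set) = Idl\<^bsub>poly_ring (verts G)\<^esub> ((\<lambda>s. single s (1::'k)) ` T)"
    unfolding edge_ideal_def by simp
  also have "\<dots> = {p \<in> carrier (poly_ring (verts G)). \<forall>m\<in>keys p. \<exists>s\<in>T. \<exists>n. m = s + n}"
    by (rule genideal_monomials) (use uv in \<open>auto simp: T_def keys_add_nat\<close>)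
  also have "\<dots> = {p \<in> carrier (poly_ring (verts G)). \<forall>m\<in>keys p. \<not> indep (edges G) (keys m)}"
  proof -
    have "(\<exists>s\<in>T. \<exists>n. m = s + n) \<longleftrightarrow> \<not> indep (edges G) (keys m)" for m
    proof
      assume "\<exists>s\<in>T. \<exists>n. m = s + n"
      then show "\<not> indep (edges G) (keys m)"
        unfolding T_def indep_def by (force simp: keys_add_nat)
    next
      assume "\<not> indep (edges G) (keys m)"
      then obtain e where e: "e \<in> edges G" "e \<subseteq> keys m" by (auto simp: indep_def)
      from finite_simple_graph_edgeE[OF G e(1)] obtain u v where e': "e = {u, v}" "u \<noteq> v" by metis
      have "m = (single u 1 + single v 1)
          + (m - (single u 1 + single v 1))"
        by (rule poly_mapping_eqI)
          (use e e' in \<open>auto simp: lookup_add lookup_minus lookup_single when_def in_keys_iff\<close>)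
      then show "\<exists>s\<in>T. \<exists>n. m = s + n" using e e' unfolding T_def by blast
    qed
    then show ?thesis by simp
  qed
  finally show ?thesis by (simp add: in_keys_iff Ball_def)
qed

section \<open>Multigraded Koszul homology\<close>

text \<open>The vertex type carries no order, so an arbitrary injection into the naturals provides
  the one on which the signs are based.\<close>

definition vrank :: "'v set \<Rightarrow> 'v \<Rightarrow> nat" where
  "vrank V = (SOME f. inj_on f V)"

lemma inj_on_vrank: "finite V \<Longrightarrow> inj_on (vrank V) V"
  unfolding vrank_def
  using finite_imp_inj_to_nat_seg[of V] by (metis (mono_tags, lifting) someI_ex)

definition ksign :: "'v set \<Rightarrow> 'v \<Rightarrow> 'v set \<Rightarrow> 'a::comm_ring_1" where
  "ksign V v A = (-1) ^ card {u \<in> A \<inter> V. vrank V u < vrank V v}"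

lemma ksign_insert:
  assumes "finite V" "x \<in> V" "x \<notin> A"
  shows "ksign V v (insert x A) = (if vrank V x < vrank V v then - ksign V v A else (ksign V v A :: 'a::comm_ring_1))"
proof -
  have "{u \<in> insert x A \<inter> V. vrank V u < vrank V v} =
    (if vrank V x < vrank V v then insert x {u \<in> A \<inter> V. vrank V u < vrank V v}
     else {u \<in> A \<inter> V. vrank V u < vrank V v})"
    using assms(2) by auto
  then show ?thesis using assms by (simp add: ksign_def)
qed

lemma ksign_anti:
  assumes V: "finite V" "x \<in> V" "v \<in> V" "x \<noteq> v" "x \<notin> A" "v \<notin> A"
  shows "ksign V x A * ksign V v (insert x A) = - (ksign V v A * (ksign V x (insert v A) :: 'a::comm_ring_1))"
proof -
  have "vrank V x \<noteq> vrank V v" using inj_on_vrank[OF V(1)] V by (auto dest: inj_onD)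
  then show ?thesis using V by (simp add: ksign_insert mult.commute)
qed

lemma ksign_sq: "ksign V v A * ksign V v A = 1"
  by (simp add: ksign_def)

lemma sign_system_ksign: "finite V \<Longrightarrow> sign_system V (ksign V)"
  by unfold_locales (rule ksign_anti ksign_sq | assumption)+

text \<open>The sign that the Koszul differential induces on the coboundary of the independence complex
  when a face is replaced by its complement in \<open>W\<close> (see \<open>cobd_complement\<close>).\<close>

definition csign :: "'v set \<Rightarrow> 'v set \<Rightarrow> 'v \<Rightarrow> 'v set \<Rightarrow> 'a::comm_ring_1" where
  "csign V W v A = (-1) ^ card {u \<in> W. vrank V u < vrank V v} * ksign V v A"

lemma sign_system_csign:
  assumes "finite V"
  shows "field_sign_system V (csign V W :: _ \<Rightarrow> _ \<Rightarrow> 'a::field)"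
proof -
  interpret sign_system V "ksign V" by (rule sign_system_ksign[OF assms])
  show ?thesis
  proof
    fix x v :: 'b and A assume *: "x \<in> V" "v \<in> V" "x \<noteq> v" "x \<notin> A" "v \<notin> A"
    let ?e = "\<lambda>v. (-1) ^ card {u \<in> W. vrank V u < vrank V v} :: 'a"
    have "csign V W x A * csign V W v (insert x A) = ?e x * ?e v * (ksign V x A * ksign V v (insert x A))"
      by (simp only: csign_def mult_ac)
    also have "\<dots> = - (csign V W v A * csign V W x (insert v A))"
      unfolding ksign_anti[OF assms *] by (simp only: csign_def mult_ac mult_minus_right mult_minus_left)
    finally show "csign V W x A * csign V W v (insert x A) = - (csign V W v A * csign V W x (insert v A) :: 'a)" .
  next
    fix v :: 'b and A
    have "csign V W v A * csign V W v A = ((-1) ^ card {u \<in> W. vrank V u < vrank V v} * (-1) ^ card {u \<in> W. vrank V u < vrank V v})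
       * (ksign V v A * ksign V v A :: 'a)"
      by (simp only: csign_def mult_ac)
    also have "\<dots> = 1" unfolding ksign_sq by simp
    finally show "csign V W v A * csign V W v A = (1 :: 'a)" .
  qed (rule assms)
qed

text \<open>The elements of \<open>W\<close> before \<open>v\<close> split into those of
  \<open>A\<close> and those of \<open>W - insert v A\<close>, so the signs of the two parts
  multiply to one that depends on \<open>v\<close> and \<open>W\<close> alone.\<close>

lemma ksign_complement:
  assumes "finite V" "W \<subseteq> V" "A \<subseteq> W" "v \<in> W" "v \<notin> A"
  shows "ksign V v (W - insert v A) = (csign V W v A :: 'a::comm_ring_1)"
proof -
  let ?lt = "\<lambda>B. {u \<in> B. vrank V u < vrank V v}"
  have fin: "finite W" using assms finite_subset by auto
  have "?lt W = ?lt ((W - insert v A) \<inter> V) \<union> ?lt (A \<inter> V)" using assms by auto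
  then have "card (?lt W) = card (?lt ((W - insert v A) \<inter> V)) + card (?lt (A \<inter> V))"
    using fin assms(3) by (simp only:) (subst card_Un_disjoint, auto intro: finite_subset)
  then have "csign V W v A = ksign V v (W - insert v A) * (ksign V v A * ksign V v A :: 'a)"
    by (simp add: csign_def ksign_def power_add mult.assoc)
  then show ?thesis by (simp add: ksign_sq)
qed

text \<open>Adding \<open>v\<close> to \<open>W - \<tau>\<close> amounts to removing
  \<open>v\<close> from \<open>\<tau>\<close>, so complements exchange boundary and coboundary; the
  support condition discards the elements of \<open>V\<close> outside \<open>W\<close>.\<close>

lemma cobd_complement:
  fixes f :: "'v set \<Rightarrow> 'a::comm_ring_1"
  assumes "finite V" "W \<subseteq> V" "\<tau> \<subseteq> W" and supp: "\<And>\<sigma>. f \<sigma> \<noteq> 0 \<Longrightarrow> \<sigma> \<subseteq> W"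
  shows "koszul_cobd (csign V W) (\<lambda>\<tau>. f (W - \<tau>)) \<tau> = koszul_bd (ksign V) V f (W - \<tau>)"
proof -
  have "koszul_bd (ksign V) V f (W - \<tau>) = (\<Sum>v\<in>\<tau>. ksign V v (W - \<tau>) * f (insert v (W - \<tau>)))"
    unfolding koszul_bd_def
  proof (rule sum.mono_neutral_right)
    show "\<forall>v\<in>V - (W - \<tau>) - \<tau>. ksign V v (W - \<tau>) * f (insert v (W - \<tau>)) = 0"
    proof
      fix v assume "v \<in> V - (W - \<tau>) - \<tau>"
      then have "\<not> insert v (W - \<tau>) \<subseteq> W" by auto
      then show "ksign V v (W - \<tau>) * f (insert v (W - \<tau>)) = 0" using supp by (metis mult_zero_right)
    qed
  qed (use assms in auto)
  also have "\<dots> = koszul_cobd (csign V W) (\<lambda>\<tau>. f (W - \<tau>)) \<tau>"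
    unfolding koszul_cobd_def
  proof (intro sum.cong refl)
    fix v assume v: "v \<in> \<tau>"
    have "W - (\<tau> - {v}) = insert v (W - \<tau>)" "W - insert v (\<tau> - {v}) = W - \<tau>" using v assms by auto
    moreover have "ksign V v (W - insert v (\<tau> - {v})) = (csign V W v (\<tau> - {v}) :: 'a)"
      by (rule ksign_complement) (use v assms in auto)
    ultimately show "ksign V v (W - \<tau>) * f (insert v (W - \<tau>)) = csign V W v (\<tau> - {v}) * f (W - (\<tau> - {v}))"
      by (simp only:)
  qed
  finally show ?thesis by simp
qed

section \<open>The Koszul complex, one multidegree at a time\<close>

definition sqfree :: "'v set \<Rightarrow> 'v \<Rightarrow>\<^sub>0 nat" where
  "sqfree \<sigma> = (\<Sum>v\<in>\<sigma>. single v 1)"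

lemma lookup_sqfree: "finite \<sigma> \<Longrightarrow> lookup (sqfree \<sigma>) v = (if v \<in> \<sigma> then 1 else 0)"
  by (simp add: sqfree_def lookup_sum lookup_single when_def)

lemma keys_sqfree: "finite \<sigma> \<Longrightarrow> keys (sqfree \<sigma>) = \<sigma>"
  by (auto simp: in_keys_iff lookup_sqfree split: if_splits)

lemma monom_degree_sqfree: "finite \<sigma> \<Longrightarrow> monom_degree (sqfree \<sigma>) = card \<sigma>"
  by (simp add: monom_degree_def keys_sqfree lookup_sqfree)

lemma finite_subset_keys: "\<sigma> \<subseteq> keys m \<Longrightarrow> finite \<sigma>"
  by (erule finite_subset) simp

lemma sqfree_diff_add: "\<sigma> \<subseteq> keys m \<Longrightarrow> m - sqfree \<sigma> + sqfree \<sigma> = m"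
proof (rule poly_mapping_eqI)
  fix v assume *: "\<sigma> \<subseteq> keys m"
  then have "finite \<sigma>" by (rule finite_subset_keys)
  then show "lookup (m - sqfree \<sigma> + sqfree \<sigma>) v = lookup m v"
    using * by (auto simp: lookup_add lookup_minus lookup_sqfree in_keys_iff)
qed

lemma monom_degree_diff_sqfree:
  assumes "\<sigma> \<subseteq> keys m"
  shows "int (monom_degree (m - sqfree \<sigma>)) = int (monom_degree m) - int (card \<sigma>)"
proof -
  have "finite \<sigma>" using assms by (rule finite_subset_keys)
  then have "monom_degree m = monom_degree (m - sqfree \<sigma>) + card \<sigma>"
    by (subst sqfree_diff_add[OF assms, symmetric]) (simp only: monom_degree_add monom_degree_sqfree)
  then show ?thesis by simp
qed

lemma keys_diff_sqfree:
  "finite \<sigma> \<Longrightarrow> keys (m - sqfree \<sigma>) = {v. (if v \<in> \<sigma> then 1 else 0) < lookup m v}"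
  by (auto simp: in_keys_iff lookup_minus lookup_sqfree)

text \<open>The Koszul differential of the polynomial ring for the variables in \<open>V\<close>;
  the value of a chain at \<open>\<sigma>\<close> is its coefficient at the basis vector of
  \<open>\<sigma>\<close>.\<close>

definition kz :: "'v set \<Rightarrow> ('v set \<Rightarrow> ('v, 'k::field) mpoly) \<Rightarrow> 'v set \<Rightarrow> ('v, 'k) mpoly" where
  "kz V = koszul_bd (\<lambda>v A. ksign V v A * var v) V"

lemma anticommuting_kz: "finite V \<Longrightarrow> anticommuting V (\<lambda>v A. ksign V v A * var v :: ('v, 'k::field) mpoly)"
proof
  fix x v :: 'v and A assume *: "finite V" "x \<in> V" "v \<in> V" "x \<noteq> v" "x \<notin> A" "v \<notin> A"
  have "ksign V x A * var x * (ksign V v (insert x A) * var v) =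
    ksign V x A * ksign V v (insert x A) * (var x * (var v :: ('v, 'k) mpoly))"
    by (simp only: mult_ac)
  also have "\<dots> = - (ksign V v A * var v * (ksign V x (insert v A) * var x))"
    unfolding ksign_anti[OF *] by (simp add: mult_ac)
  finally show "ksign V x A * var x * (ksign V v (insert x A) * var v) =
    - (ksign V v A * var v * (ksign V x (insert v A) * var x) :: ('v, 'k) mpoly)" .
qed

lemma kz_kz: "finite V \<Longrightarrow> kz V (kz V c) \<tau> = 0"
  unfolding kz_def by (rule anticommuting.bd_bd[OF anticommuting_kz])

text \<open>The part of multidegree \<open>m\<close> of a Koszul chain, where \<open>x\<^sup>a e\<^sub>\<sigma>\<close> has multidegree
  \<open>a + sqfree \<sigma>\<close>.\<close>

definition mcoef :: "('v \<Rightarrow>\<^sub>0 nat) \<Rightarrow> ('v set \<Rightarrow> ('v, 'k::field) mpoly) \<Rightarrow> 'v set \<Rightarrow> 'k" where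
  "mcoef m c \<sigma> = (if \<sigma> \<subseteq> keys m then lookup (c \<sigma>) (m - sqfree \<sigma>) else 0)"

lemma lookup_ksign_var_mult:
  fixes p :: "('v, 'k::field) mpoly"
  shows "lookup (ksign V v A * var v * p) a =
    ksign V v A * (if v \<in> keys a then lookup p (a - single v 1) else 0)"
  unfolding ksign_def mult.assoc lookup_sign_mult lookup_var_mult ..

text \<open>Passing from \<open>insert v \<tau>\<close> to \<open>\<tau>\<close> moves x_v from the
  index into the coefficient, which keeps the multidegree. In each multidegree the differential is
  therefore a scalar boundary with signs.\<close>

lemma mcoef_kz:
  fixes c :: "'v set \<Rightarrow> ('v, 'k::field) mpoly"
  shows "mcoef m (kz V c) \<tau> = koszul_bd (ksign V) V (mcoef m c) \<tau>"
proof (cases "\<tau> \<subseteq> keys m")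
  case False
  then show ?thesis by (auto simp: mcoef_def koszul_bd_def intro!: sum.neutral[symmetric])
next
  case True
  then have fin: "finite \<tau>" by (rule finite_subset_keys)
  have "mcoef m (kz V c) \<tau> = (\<Sum>v\<in>V - \<tau>. lookup (ksign V v \<tau> * var v * c (insert v \<tau>)) (m - sqfree \<tau>))"
    using True by (simp add: mcoef_def kz_def koszul_bd_def lookup_sum)
  also have "\<dots> = (\<Sum>v\<in>V - \<tau>. ksign V v \<tau> * mcoef m c (insert v \<tau>))"
  proof (intro sum.cong refl)
    fix v assume v: "v \<in> V - \<tau>"
    have "v \<in> keys (m - sqfree \<tau>) \<longleftrightarrow> insert v \<tau> \<subseteq> keys m"
      using v True fin by (simp add: keys_diff_sqfree in_keys_iff)
    moreover have "m - sqfree \<tau> - single v 1 = m - sqfree (insert v \<tau>)"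
      by (rule poly_mapping_eqI)
        (use v fin in \<open>auto simp: lookup_minus lookup_sqfree lookup_single when_def\<close>)
    ultimately show "lookup (ksign V v \<tau> * var v * c (insert v \<tau>)) (m - sqfree \<tau>)
      = ksign V v \<tau> * mcoef m c (insert v \<tau>)"
      unfolding lookup_ksign_var_mult mcoef_def by simp
  qed
  finally show ?thesis unfolding koszul_bd_def .
qed

lemma lookup_eq_mcoef:
  assumes "finite \<tau>"
  shows "lookup (c \<tau>) a = mcoef (a + sqfree \<tau>) c \<tau>"
proof -
  have "\<tau> \<subseteq> keys (a + sqfree \<tau>)" using assms by (simp add: keys_add_nat keys_sqfree)
  moreover have "a + sqfree \<tau> - sqfree \<tau> = a" by simp
  ultimately show ?thesis by (simp add: mcoef_def)
qed

definition chains :: "'v set \<Rightarrow> 'm::zero set \<Rightarrow> nat \<Rightarrow> ('v set \<Rightarrow> 'm) set" where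
  "chains V A i = {c. \<forall>\<sigma>. if \<sigma> \<subseteq> V \<and> card \<sigma> = i then c \<sigma> \<in> A else c \<sigma> = 0}"

lemma chainsD: "c \<in> chains V A i \<Longrightarrow> \<sigma> \<subseteq> V \<Longrightarrow> card \<sigma> = i \<Longrightarrow> c \<sigma> \<in> A"
  and chains_0: "c \<in> chains V A i \<Longrightarrow> \<not> (\<sigma> \<subseteq> V \<and> card \<sigma> = i) \<Longrightarrow> c \<sigma> = 0"
  by (auto simp: chains_def split: if_splits)

text \<open>A monomial ideal given by its membership predicate: \<open>dep_monomial\<close> yields
  the edge ideal, the constant predicate the whole ring.\<close>

definition monomial_pieces :: "'v set \<Rightarrow> (('v \<Rightarrow>\<^sub>0 nat) \<Rightarrow> bool) \<Rightarrow> int \<Rightarrow> ('v, 'k::field) mpoly set" where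
  "monomial_pieces V P k = {p \<in> homogeneous_part V k. \<forall>m. lookup p m \<noteq> 0 \<longrightarrow> P m}"

text \<open>Chains on the upper Koszul simplicial complex of a monomial ideal in multidegree \<open>m\<close>.\<close>

definition mchain :: "(('v \<Rightarrow>\<^sub>0 nat) \<Rightarrow> bool) \<Rightarrow> ('v \<Rightarrow>\<^sub>0 nat) \<Rightarrow> nat \<Rightarrow> ('v set \<Rightarrow> 'k::field) \<Rightarrow> bool" where
  "mchain P m i \<gamma> \<longleftrightarrow> (\<forall>\<sigma>. \<gamma> \<sigma> \<noteq> 0 \<longrightarrow> \<sigma> \<subseteq> keys m \<and> card \<sigma> = i \<and> P (m - sqfree \<sigma>))"

lemma mcoef_mchain:
  fixes c :: "'v set \<Rightarrow> ('v, 'k::field) mpoly"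
  assumes "c \<in> chains V (monomial_pieces V P k) i"
  shows "mchain P m i (mcoef m c)"
  unfolding mchain_def
proof (intro allI impI)
  fix \<sigma> assume nz: "mcoef m c \<sigma> \<noteq> 0"
  then have *: "\<sigma> \<subseteq> keys m" "lookup (c \<sigma>) (m - sqfree \<sigma>) \<noteq> 0"
    by (auto simp: mcoef_def split: if_splits)
  then have "c \<sigma> \<noteq> 0" by auto
  then have "\<sigma> \<subseteq> V \<and> card \<sigma> = i" using chains_0[OF assms] by blast
  moreover from this have "c \<sigma> \<in> monomial_pieces V P k" using chainsD[OF assms] by blast
  ultimately show "\<sigma> \<subseteq> keys m \<and> card \<sigma> = i \<and> P (m - sqfree \<sigma>)"
    using * by (auto simp: monomial_pieces_def)
qed

lemma mcoef_degree:
  fixes c :: "'v set \<Rightarrow> ('v, 'k::field) mpoly"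
  assumes "c \<in> chains V (homogeneous_part V k) i" "mcoef m c \<sigma> \<noteq> 0"
  shows "keys m \<subseteq> V \<and> int (monom_degree m) = k + int i"
proof -
  have *: "\<sigma> \<subseteq> keys m" "lookup (c \<sigma>) (m - sqfree \<sigma>) \<noteq> 0"
    using assms(2) by (auto simp: mcoef_def split: if_splits)
  then have "c \<sigma> \<noteq> 0" by auto
  then have \<sigma>: "\<sigma> \<subseteq> V" "card \<sigma> = i" using chains_0[OF assms(1)] by blast+
  then have "c \<sigma> \<in> homogeneous_part V k" using chainsD[OF assms(1)] by blast
  then have "keys (m - sqfree \<sigma>) \<subseteq> V" "int (monom_degree (m - sqfree \<sigma>)) = k"
    using *(2) by (auto simp: homogeneous_part_iff)
  moreover have "finite \<sigma>" using *(1) by (rule finite_subset_keys)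
  ultimately show ?thesis
    using monom_degree_diff_sqfree[OF *(1)] \<sigma> sqfree_diff_add[OF *(1)]
    by (metis diff_add_cancel keys_add_nat keys_sqfree le_sup_iff)
qed

lemma chains_mono: "A \<subseteq> B \<Longrightarrow> chains V A i \<subseteq> chains V B i"
  by (auto simp: chains_def split: if_splits)

lemma finite_monomials:
  assumes "finite V"
  shows "finite {m. keys m \<subseteq> V \<and> int (monom_degree m) = k}"
proof (rule finite_imageD)
  show "inj_on lookup {m. keys m \<subseteq> V \<and> int (monom_degree m) = k}"
    by (rule inj_onI, rule poly_mapping_eqI) simp
  have "lookup m v \<le> nat k" if "keys m \<subseteq> V" "int (monom_degree m) = k" for m v
  proof -
    have "lookup m v \<le> monom_degree m"
    proof (cases "v \<in> keys m")
      case True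
      then show ?thesis unfolding monom_degree_def by (intro member_le_sum) auto
    qed (simp add: in_keys_iff)
    then show ?thesis using that by simp
  qed
  then have "lookup ` {m. keys m \<subseteq> V \<and> int (monom_degree m) = k}
    \<subseteq> {f. \<forall>v. (v \<in> V \<longrightarrow> f v \<in> {..nat k}) \<and> (v \<notin> V \<longrightarrow> f v = 0)}"
    by (auto simp: in_keys_iff)
  then show "finite (lookup ` {m. keys m \<subseteq> V \<and> int (monom_degree m) = k})"
    by (rule finite_subset) (use assms in \<open>intro finite_set_of_finite_funs; simp\<close>)
qed

text \<open>Fillings can be found one multidegree at a time: only the finitely many multidegrees of
  total degree \<open>k + i\<close> occur (\<open>i\<close> is contributed by the basis vectors),
  and their fillings add up to a chain of polynomials.\<close>

lemma kz_lift:
  fixes c :: "'v set \<Rightarrow> ('v, 'k::field) mpoly"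
  assumes V: "finite V" and c: "c \<in> chains V (monomial_pieces V P k) i"
    and bd: "\<And>m. keys m \<subseteq> V \<Longrightarrow> int (monom_degree m) = k + int i \<Longrightarrow>
      \<exists>\<eta>. mchain P m (Suc i) \<eta> \<and> (\<forall>\<tau>. koszul_bd (ksign V) V \<eta> \<tau> = mcoef m c \<tau>)"
  shows "\<exists>g\<in>chains V (monomial_pieces V P (k - 1)) (Suc i). \<forall>\<tau>. kz V g \<tau> = c \<tau>"
proof -
  define M where "M = {m. keys m \<subseteq> V \<and> int (monom_degree m) = k + int i}"
  have finM: "finite M" unfolding M_def by (rule finite_monomials[OF V])
  have "\<forall>m\<in>M. \<exists>\<eta>. mchain P m (Suc i) \<eta> \<and> (\<forall>\<tau>. koszul_bd (ksign V) V \<eta> \<tau> = mcoef m c \<tau>)"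
    using bd by (auto simp: M_def)
  then obtain \<eta> where \<eta>: "\<And>m. m \<in> M \<Longrightarrow> mchain P m (Suc i) (\<eta> m)"
    "\<And>m \<tau>. m \<in> M \<Longrightarrow> koszul_bd (ksign V) V (\<eta> m) \<tau> = mcoef m c \<tau>"
    by metis
  \<comment> \<open>Inverse of \<open>mcoef\<close>: the scalar \<open>\<eta> m \<sigma>\<close>
    goes to the monomial with exponent \<open>m - sqfree \<sigma>\<close>, and for fixed
    \<open>\<sigma>\<close> distinct multidegrees give distinct monomials.\<close>
  define g where "g \<sigma> = (\<Sum>m | m \<in> M \<and> \<sigma> \<subseteq> keys m. single (m - sqfree \<sigma>) (\<eta> m \<sigma>))" for \<sigma>
  have g_lookup: "\<exists>m\<in>M. \<sigma> \<subseteq> keys m \<and> a = m - sqfree \<sigma> \<and> \<eta> m \<sigma> \<noteq> 0"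
    if "lookup (g \<sigma>) a \<noteq> 0" for \<sigma> a
  proof -
    have "(\<Sum>m | m \<in> M \<and> \<sigma> \<subseteq> keys m. lookup (single (m - sqfree \<sigma>) (\<eta> m \<sigma>)) a) \<noteq> 0"
      using that by (simp add: g_def lookup_sum)
    then obtain m where "m \<in> M" "\<sigma> \<subseteq> keys m"
      "lookup (single (m - sqfree \<sigma>) (\<eta> m \<sigma>)) a \<noteq> 0"
      by (auto elim: sum.not_neutral_contains_not_neutral)
    then show ?thesis by (auto simp: lookup_single when_def split: if_splits)
  qed
  have gch: "g \<in> chains V (monomial_pieces V P (k - 1)) (Suc i)"
  proof -
    have "g \<sigma> \<in> monomial_pieces V P (k - 1)" if "\<sigma> \<subseteq> V" "card \<sigma> = Suc i" for \<sigma>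
    proof -
      have "keys a \<subseteq> V \<and> int (monom_degree a) = k - 1 \<and> P a"
        if a: "lookup (g \<sigma>) a \<noteq> 0" for a
      proof -
        obtain m where m: "m \<in> M" "\<sigma> \<subseteq> keys m" "a = m - sqfree \<sigma>" "\<eta> m \<sigma> \<noteq> 0"
          using g_lookup[OF a] by blast
        have "finite \<sigma>" using m(2) by (rule finite_subset_keys)
        then have "keys a \<subseteq> keys m"
          unfolding m(3) by (auto simp: keys_diff_sqfree in_keys_iff)
        moreover have "P a" using \<eta>(1)[OF m(1)] m by (auto simp: mchain_def)
        ultimately show ?thesis
          using monom_degree_diff_sqfree[OF m(2)] m \<open>card \<sigma> = Suc i\<close> by (auto simp: M_def)
      qed
      then show ?thesis unfolding monomial_pieces_def homogeneous_part_iff by blast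
    qed
    moreover have "g \<sigma> = 0" if "\<not> (\<sigma> \<subseteq> V \<and> card \<sigma> = Suc i)" for \<sigma>
    proof (rule poly_mapping_eqI, rule ccontr)
      fix a assume "lookup (g \<sigma>) a \<noteq> lookup 0 a"
      then have "lookup (g \<sigma>) a \<noteq> 0" by simp
      from g_lookup[OF this] obtain m where m: "m \<in> M" "\<sigma> \<subseteq> keys m" "\<eta> m \<sigma> \<noteq> 0" by blast
      then have "card \<sigma> = Suc i" using \<eta>(1)[OF m(1)] by (auto simp: mchain_def)
      then show False using m that by (auto simp: M_def)
    qed
    ultimately show ?thesis by (auto simp: chains_def)
  qed
  have mg: "mcoef m g = \<eta> m" if m: "m \<in> M" for m
  proof
    fix \<sigma>
    show "mcoef m g \<sigma> = \<eta> m \<sigma>"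
    proof (cases "\<sigma> \<subseteq> keys m")
      case False
      then show ?thesis using \<eta>(1)[OF m] by (auto simp: mcoef_def mchain_def)
    next
      case True
      have "mcoef m g \<sigma> = (\<Sum>m' | m' \<in> M \<and> \<sigma> \<subseteq> keys m'.
          lookup (single (m' - sqfree \<sigma>) (\<eta> m' \<sigma>)) (m - sqfree \<sigma>))"
        using True by (simp add: mcoef_def g_def lookup_sum)
      also have "\<dots> = (\<Sum>m' | m' \<in> M \<and> \<sigma> \<subseteq> keys m'. if m' = m then \<eta> m \<sigma> else 0)"
      proof (intro sum.cong refl)
        fix m' assume m': "m' \<in> {m' \<in> M. \<sigma> \<subseteq> keys m'}"
        have "m' - sqfree \<sigma> = m - sqfree \<sigma> \<longleftrightarrow> m' = m"
          using sqfree_diff_add[OF True] sqfree_diff_add[of \<sigma> m'] m' by auto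
        then show "lookup (single (m' - sqfree \<sigma>) (\<eta> m' \<sigma>)) (m - sqfree \<sigma>)
          = (if m' = m then \<eta> m \<sigma> else 0)"
          by (auto simp: lookup_single when_def)
      qed
      also have "\<dots> = \<eta> m \<sigma>" using finM m True by simp
      finally show ?thesis .
    qed
  qed
  have sub: "monomial_pieces V P j \<subseteq> homogeneous_part V j" for j
    by (auto simp: monomial_pieces_def)
  have "kz V g \<tau> = c \<tau>" for \<tau>
  proof (cases "\<tau> \<subseteq> V")
    case False
    then have "kz V g \<tau> = 0" using chains_0[OF gch] by (auto simp: kz_def koszul_bd_def)
    then show ?thesis using chains_0[OF c] False by simp
  next
    case True
    then have fin: "finite \<tau>" using V finite_subset by auto
    show ?thesis
    proof (rule poly_mapping_eqI)
      fix a
      let ?m = "a + sqfree \<tau>"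
      have "koszul_bd (ksign V) V (mcoef ?m g) \<tau> = mcoef ?m c \<tau>"
      proof (cases "?m \<in> M")
        case True
        then show ?thesis using mg \<eta>(2) by simp
      next
        case False
        have "mcoef ?m c \<tau> = 0"
          using False mcoef_degree[OF subsetD[OF chains_mono[OF sub] c]] by (auto simp: M_def)
        moreover have "mcoef ?m g \<sigma> = 0" for \<sigma>
          using False mcoef_degree[OF subsetD[OF chains_mono[OF sub] gch]] by (auto simp: M_def)
        ultimately show ?thesis by (simp add: koszul_bd_def)
      qed
      then show "lookup (kz V g \<tau>) a = lookup (c \<tau>) a"
        unfolding lookup_eq_mcoef[OF fin] mcoef_kz .
    qed
  qed
  then show ?thesis using gch by blast
qed

text \<open>The Koszul cycle is concentrated in the single multidegree \<open>m\<close>. This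
  carries nonvanishing from the simplicial to the Koszul side.\<close>

lemma mchain_lift:
  fixes \<gamma> :: "'v set \<Rightarrow> 'k::field"
  assumes V: "finite V" and m: "keys m \<subseteq> V" "int (monom_degree m) = k + int i"
    and \<gamma>: "mchain P m i \<gamma>" "\<And>\<tau>. koszul_bd (ksign V) V \<gamma> \<tau> = 0"
  obtains c :: "'v set \<Rightarrow> ('v, 'k) mpoly" where
    "c \<in> chains V (monomial_pieces V P k) i" "\<And>\<tau>. kz V c \<tau> = 0" "mcoef m c = \<gamma>"
proof -
  define c where "c \<sigma> = single (m - sqfree \<sigma>) (\<gamma> \<sigma>)" for \<sigma>
  have ch: "c \<in> chains V (monomial_pieces V P k) i"
  proof -
    have "c \<sigma> \<in> monomial_pieces V P k" if "\<sigma> \<subseteq> V" "card \<sigma> = i" for \<sigma>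
    proof (cases "\<gamma> \<sigma> = 0")
      case True
      then show ?thesis by (simp add: c_def monomial_pieces_def homogeneous_part_iff)
    next
      case False
      then have *: "\<sigma> \<subseteq> keys m" "P (m - sqfree \<sigma>)" using \<gamma>(1) by (auto simp: mchain_def)
      then have "finite \<sigma>" using finite_subset_keys by blast
      then have "keys (m - sqfree \<sigma>) \<subseteq> keys m"
        by (auto simp: keys_diff_sqfree in_keys_iff)
      then show ?thesis using monom_degree_diff_sqfree[OF *(1)] * m that
        by (auto simp: c_def monomial_pieces_def homogeneous_part_iff lookup_single when_def)
    qed
    moreover have "c \<sigma> = 0" if "\<not> (\<sigma> \<subseteq> V \<and> card \<sigma> = i)" for \<sigma>
      using \<gamma>(1) m that unfolding c_def mchain_def by (metis order_trans single_zero)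
    ultimately show ?thesis by (auto simp: chains_def)
  qed
  have mc: "mcoef m' c \<sigma> = (if m' = m then \<gamma> \<sigma> else 0)" for m' \<sigma>
  proof (cases "\<gamma> \<sigma> = 0")
    case True
    then show ?thesis by (simp add: mcoef_def c_def)
  next
    case False
    then have *: "\<sigma> \<subseteq> keys m" using \<gamma>(1) by (auto simp: mchain_def)
    show ?thesis
    proof (cases "\<sigma> \<subseteq> keys m'")
      case True
      have "m - sqfree \<sigma> = m' - sqfree \<sigma> \<longleftrightarrow> m' = m"
        using sqfree_diff_add[OF *] sqfree_diff_add[OF True] by metis
      then show ?thesis using True by (simp add: mcoef_def c_def lookup_single when_def)
    qed (use * in \<open>auto simp: mcoef_def\<close>)
  qed
  have "kz V c \<tau> = 0" for \<tau>
  proof (cases "\<tau> \<subseteq> V")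
    case False
    then show ?thesis using chains_0[OF ch] by (auto simp: kz_def koszul_bd_def)
  next
    case True
    then have fin: "finite \<tau>" using V finite_subset by auto
    show ?thesis
    proof (rule poly_mapping_eqI)
      fix a
      have "koszul_bd (ksign V) V (mcoef m' c) \<tau> = 0" for m'
      proof (cases "m' = m")
        case True
        have "mcoef m c = \<gamma>" using mc by auto
        then show ?thesis using True \<gamma>(2) by simp
      qed (simp add: koszul_bd_def mc)
      then show "lookup (kz V c \<tau>) a = lookup 0 a"
        unfolding lookup_eq_mcoef[OF fin, of "kz V c"] mcoef_kz by simp
    qed
  qed
  moreover have "mcoef m c = \<gamma>" using mc by auto
  ultimately show ?thesis using that ch by blast
qed

text \<open>Homology of the upper Koszul complex in multidegree \<open>m\<close>. The argument
  \<open>K\<close> fixes the coefficient field, which the types of the other arguments do not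
  mention.\<close>

definition mvanishes :: "'k::field itself \<Rightarrow> 'v set \<Rightarrow> (('v \<Rightarrow>\<^sub>0 nat) \<Rightarrow> bool) \<Rightarrow> ('v \<Rightarrow>\<^sub>0 nat) \<Rightarrow> nat \<Rightarrow> bool" where
  "mvanishes K V P m i \<longleftrightarrow> (\<forall>\<gamma> :: 'v set \<Rightarrow> 'k. mchain P m i \<gamma> \<and> (\<forall>\<tau>. koszul_bd (ksign V) V \<gamma> \<tau> = 0) \<longrightarrow>
    (\<exists>\<eta>. mchain P m (Suc i) \<eta> \<and> (\<forall>\<tau>. koszul_bd (ksign V) V \<eta> \<tau> = \<gamma> \<tau>)))"

text \<open>The last assumption makes the upper Koszul complex a cone with apex
  \<open>p\<close>.\<close>

lemma mvanishes_cone: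
  fixes V :: "'v set"
  assumes V: "finite V" and p: "p \<in> V" "p \<in> keys m"
    and cone: "\<And>\<sigma>. \<sigma> \<subseteq> keys m \<Longrightarrow> p \<notin> \<sigma> \<Longrightarrow> P (m - sqfree \<sigma>) \<Longrightarrow> P (m - sqfree (insert p \<sigma>))"
  shows "mvanishes TYPE('k::field) V P m i"
  unfolding mvanishes_def
proof (intro allI impI, elim conjE)
  fix \<gamma> :: "'v set \<Rightarrow> 'k" assume \<gamma>: "mchain P m i \<gamma>" "\<forall>\<tau>. koszul_bd (ksign V) V \<gamma> \<tau> = 0"
  interpret field_sign_system V "ksign V :: _ \<Rightarrow> _ \<Rightarrow> 'k"
    using sign_system_ksign[OF V] by (simp add: field_sign_system_def)
  have "mchain P m (Suc i) (cone (ksign V) p \<gamma>)"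
    unfolding mchain_def
  proof (intro allI impI)
    fix \<sigma> assume "cone (ksign V) p \<gamma> \<sigma> \<noteq> 0"
    then have \<sigma>: "p \<in> \<sigma>" "\<gamma> (\<sigma> - {p}) \<noteq> 0" by (auto simp: cone_def split: if_splits)
    then have *: "\<sigma> - {p} \<subseteq> keys m" "card (\<sigma> - {p}) = i" "P (m - sqfree (\<sigma> - {p}))"
      using \<gamma>(1) by (auto simp: mchain_def)
    have "finite \<sigma>" using finite_subset[OF *(1)] by simp
    moreover have "P (m - sqfree (insert p (\<sigma> - {p})))" by (rule cone) (use * in auto)
    moreover have "insert p (\<sigma> - {p}) = \<sigma>" using \<sigma> by auto
    moreover have "card \<sigma> = Suc i"
      using card.remove[OF \<open>finite \<sigma>\<close> \<sigma>(1)] *(2) by simp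
    ultimately show "\<sigma> \<subseteq> keys m \<and> card \<sigma> = Suc i \<and> P (m - sqfree \<sigma>)"
      using *(1) p by auto
  qed
  moreover have "koszul_bd (ksign V) V (cone (ksign V) p \<gamma>) \<tau> = \<gamma> \<tau>" for \<tau>
    by (rule bd_cone_cycle) (use \<gamma> p in auto)
  ultimately show "\<exists>\<eta>. mchain P m (Suc i) \<eta> \<and> (\<forall>\<tau>. koszul_bd (ksign V) V \<eta> \<tau> = \<gamma> \<tau>)" by blast
qed

section \<open>Alexander duality and Hochster's formula\<close>

definition dep_monomial :: "'v set set \<Rightarrow> ('v \<Rightarrow>\<^sub>0 nat) \<Rightarrow> bool" where
  "dep_monomial E a \<longleftrightarrow> \<not> indep E (keys a)"

lemma keys_sqfree_diff:
  assumes "finite W" "\<sigma> \<subseteq> W"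
  shows "keys (sqfree W - sqfree \<sigma>) = W - \<sigma>"
  using assms finite_subset[OF assms(2,1)] by (auto simp: keys_diff_sqfree lookup_sqfree split: if_splits)

lemma mchain_sqfree:
  assumes "finite W"
  shows "mchain (dep_monomial E) (sqfree W) i \<gamma> \<longleftrightarrow>
    (\<forall>\<sigma>. \<gamma> \<sigma> \<noteq> 0 \<longrightarrow> \<sigma> \<subseteq> W \<and> card \<sigma> = i \<and> \<not> indep E (W - \<sigma>))"
  using assms keys_sqfree_diff[OF assms] unfolding mchain_def dep_monomial_def keys_sqfree[OF assms]
  by metis

lemma bd_support:
  assumes "\<And>\<sigma>. f \<sigma> \<noteq> 0 \<Longrightarrow> \<sigma> \<subseteq> W \<and> card \<sigma> = Suc n" "koszul_bd t V f \<sigma> \<noteq> 0" "finite W"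
  shows "\<sigma> \<subseteq> W \<and> card \<sigma> = n"
proof -
  obtain v where v: "v \<in> V - \<sigma>" "t v \<sigma> * f (insert v \<sigma>) \<noteq> 0"
    using assms(2) unfolding koszul_bd_def by (rule sum.not_neutral_contains_not_neutral)
  then have "f (insert v \<sigma>) \<noteq> 0" by auto
  then have *: "insert v \<sigma> \<subseteq> W" "card (insert v \<sigma>) = Suc n" using assms(1)[of "insert v \<sigma>"] by auto
  then have "finite \<sigma>" using assms(3) finite_subset by auto
  then show ?thesis using * v by auto
qed

text \<open>The upper Koszul complex in multidegree \<open>W\<close> consists of the sets with
  dependent complement, the Alexander dual of the independence complex. A cycle is filled in the
  full simplex on \<open>W\<close>; the values of the filling on complements of independent sets
  form a cocycle on faces of size \<open>card W - Suc i\<close>, and a primitive of it corrects the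
  filling to lie in the complex.\<close>

lemma coh_vanishes_imp_mvanishes:
  fixes W :: "'v set"
  assumes V: "finite V" "W \<subseteq> V" and i: "i < card W"
    and coh: "coh_vanishes E (csign V W :: _ \<Rightarrow> _ \<Rightarrow> 'k::field) W (card W - Suc i)"
  shows "mvanishes TYPE('k) V (dep_monomial E) (sqfree W) i"
  unfolding mvanishes_def
proof (intro allI impI, elim conjE)
  have fW: "finite W" using V finite_subset by auto
  fix \<gamma> :: "'v set \<Rightarrow> 'k"
  assume ch: "mchain (dep_monomial E) (sqfree W) i \<gamma>" and cyc: "\<forall>\<tau>. koszul_bd (ksign V) V \<gamma> \<tau> = 0"
  note \<gamma> = ch[unfolded mchain_sqfree[OF fW], rule_format]
  interpret field_sign_system V "ksign V :: _ \<Rightarrow> _ \<Rightarrow> 'k"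
    using sign_system_ksign[OF V(1)] by (simp add: field_sign_system_def)
  define k where "k = card W - Suc i"
  have kW: "card W = k + Suc i" using i by (simp add: k_def)
  obtain p where p: "p \<in> W" using i by fastforce
  define f where "f = cone (ksign V) p \<gamma>"
  have bd_f: "koszul_bd (ksign V) V f \<tau> = \<gamma> \<tau>" for \<tau>
    unfolding f_def by (rule bd_cone_cycle) (use cyc p V in auto)
  have f: "\<sigma> \<subseteq> W \<and> card \<sigma> = Suc i" if "f \<sigma> \<noteq> 0" for \<sigma>
  proof -
    have \<sigma>: "p \<in> \<sigma>" "\<gamma> (\<sigma> - {p}) \<noteq> 0" using that by (auto simp: f_def cone_def split: if_splits)
    have *: "\<sigma> - {p} \<subseteq> W" "card (\<sigma> - {p}) = i" using \<gamma>[OF \<sigma>(2)] by auto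
    then have "finite \<sigma>" using fW finite_subset by (metis finite_Diff_insert finite.emptyI finite_Diff2)
    then show ?thesis using card.remove[OF _ \<sigma>(1)] * p by auto
  qed
  have compl: "koszul_cobd (csign V W) (\<lambda>\<tau>. g (W - \<tau>)) \<tau> = koszul_bd (ksign V) V g (W - \<tau>)"
    if "\<tau> \<subseteq> W" "\<And>\<sigma>. g \<sigma> \<noteq> 0 \<Longrightarrow> \<sigma> \<subseteq> W" for g :: "'v set \<Rightarrow> 'k" and \<tau>
    using cobd_complement[OF V that] .
  have "\<exists>\<eta>. \<forall>\<tau>\<subseteq>W. indep E \<tau> \<and> card \<tau> = k \<longrightarrow> f (W - \<tau>) = koszul_cobd (csign V W) \<eta> \<tau>"
  proof (rule coh[folded k_def, unfolded coh_vanishes_def, rule_format])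
    fix \<tau> assume \<tau>: "\<tau> \<subseteq> W" "indep E \<tau> \<and> card \<tau> = Suc k"
    have "W - (W - \<tau>) = \<tau>" using \<tau> by auto
    then have "\<gamma> (W - \<tau>) = 0" using \<gamma>[of "W - \<tau>"] \<tau> by auto
    then show "koszul_cobd (csign V W) (\<lambda>\<tau>. f (W - \<tau>)) \<tau> = 0"
      using compl[OF \<tau>(1), of f] f bd_f by auto
  qed
  then obtain \<eta> where \<eta>: "\<And>\<tau>. \<tau> \<subseteq> W \<Longrightarrow> indep E \<tau> \<Longrightarrow> card \<tau> = k \<Longrightarrow>
    f (W - \<tau>) = koszul_cobd (csign V W) \<eta> \<tau>" by blast
  \<comment> \<open>The primitive, transported to complements and cut off outside size
    \<open>i + 2\<close> so that the support of its boundary is under control.\<close>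
  define h where "h \<sigma> = (if \<sigma> \<subseteq> W \<and> card \<sigma> = Suc (Suc i) then \<eta> (W - \<sigma>) else 0)" for \<sigma>
  have h: "\<sigma> \<subseteq> W \<and> card \<sigma> = Suc (Suc i)" if "h \<sigma> \<noteq> 0" for \<sigma>
    using that by (auto simp: h_def split: if_splits)
  have bd_h: "koszul_bd (ksign V) V h (W - \<tau>) = f (W - \<tau>)" if \<tau>: "\<tau> \<subseteq> W" "indep E \<tau>" "card \<tau> = k" for \<tau>
  proof -
    have fin: "finite \<tau>" using \<tau> fW finite_subset by auto
    have "koszul_cobd (csign V W) (\<lambda>\<tau>. h (W - \<tau>)) \<tau> = koszul_cobd (csign V W) \<eta> \<tau>"
      unfolding koszul_cobd_def
    proof (intro sum.cong refl)
      fix v assume v: "v \<in> \<tau>"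
      then have "k > 0" using \<tau> fin by (auto simp: card_gt_0_iff)
      have *: "W - (W - (\<tau> - {v})) = \<tau> - {v}" using \<tau> by auto
      have "card (W - (\<tau> - {v})) = card W - card (\<tau> - {v})"
        by (rule card_Diff_subset) (use \<tau> fin in auto)
      also have "card (\<tau> - {v}) = k - 1" using v \<tau> fin by simp
      finally have "card (W - (\<tau> - {v})) = Suc (Suc i)" using kW \<open>k > 0\<close> by simp
      then have "h (W - (\<tau> - {v})) = \<eta> (\<tau> - {v})" unfolding h_def * by auto
      then show "csign V W v (\<tau> - {v}) * h (W - (\<tau> - {v})) = csign V W v (\<tau> - {v}) * \<eta> (\<tau> - {v})" by simp
    qed
    then show ?thesis using compl[OF \<tau>(1), of h] h \<eta>[OF \<tau>] by auto
  qed
  \<comment> \<open>Same boundary as \<open>f\<close>, but zero wherever the complement is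
    independent.\<close>
  let ?r = "\<lambda>\<sigma>. f \<sigma> - koszul_bd (ksign V) V h \<sigma>"
  have "mchain (dep_monomial E) (sqfree W) (Suc i) ?r"
    unfolding mchain_sqfree[OF fW]
  proof (intro allI impI)
    fix \<sigma> assume nz: "?r \<sigma> \<noteq> 0"
    then have "f \<sigma> \<noteq> 0 \<or> koszul_bd (ksign V) V h \<sigma> \<noteq> 0" by auto
    then have \<sigma>: "\<sigma> \<subseteq> W \<and> card \<sigma> = Suc i" using f bd_support[OF h _ fW] by blast
    then have "card (W - \<sigma>) = k" using kW fW finite_subset by (subst card_Diff_subset) auto
    moreover have "W - (W - \<sigma>) = \<sigma>" using \<sigma> by auto
    ultimately have "\<not> indep E (W - \<sigma>)" using bd_h[of "W - \<sigma>"] nz by auto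
    then show "\<sigma> \<subseteq> W \<and> card \<sigma> = Suc i \<and> \<not> indep E (W - \<sigma>)" using \<sigma> by auto
  qed
  moreover have "koszul_bd (ksign V) V ?r \<tau> = \<gamma> \<tau>" for \<tau>
    unfolding koszul_bd_diff by (simp add: bd_f bd_bd)
  ultimately show "\<exists>\<eta>. mchain (dep_monomial E) (sqfree W) (Suc i) \<eta> \<and> (\<forall>\<tau>. koszul_bd (ksign V) V \<eta> \<tau> = \<gamma> \<tau>)"
    by blast
qed

text \<open>The duality backwards: a cocycle read on complements is a chain of the full simplex
  whose boundary lies in the upper Koszul complex. Filling that boundary inside the complex leaves a
  cycle of the simplex, which a cone bounds; this cone, read on complements, is the
  primitive.\<close>

lemma mvanishes_imp_coh_vanishes:
  fixes W :: "'v set"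
  assumes V: "finite V" "W \<subseteq> V" and i: "i < card W"
    and van: "mvanishes TYPE('k::field) V (dep_monomial E) (sqfree W) i"
  shows "coh_vanishes E (csign V W :: _ \<Rightarrow> _ \<Rightarrow> 'k) W (card W - Suc i)"
proof -
  have fW: "finite W" using V finite_subset by auto
  interpret field_sign_system V "ksign V :: _ \<Rightarrow> _ \<Rightarrow> 'k"
    using sign_system_ksign[OF V(1)] by (simp add: field_sign_system_def)
  define k where "k = card W - Suc i"
  have kW: "card W = k + Suc i" using i by (simp add: k_def)
  obtain p where p: "p \<in> W" using i by fastforce
  have compl: "koszul_cobd (csign V W) (\<lambda>\<tau>. g (W - \<tau>)) \<tau> = koszul_bd (ksign V) V g (W - \<tau>)"
    if "\<tau> \<subseteq> W" "\<And>\<sigma>. g \<sigma> \<noteq> 0 \<Longrightarrow> \<sigma> \<subseteq> W" for g :: "'v set \<Rightarrow> 'k" and \<tau>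
    using cobd_complement[OF V that] .
  have "coh_vanishes E (csign V W :: _ \<Rightarrow> _ \<Rightarrow> 'k) W k"
    unfolding coh_vanishes_def
  proof (intro allI impI)
    fix \<gamma> :: "'v set \<Rightarrow> 'k"
    assume cyc: "\<forall>\<tau>\<subseteq>W. indep E \<tau> \<and> card \<tau> = Suc k \<longrightarrow> koszul_cobd (csign V W) \<gamma> \<tau> = 0"
    define f where "f \<sigma> = (if \<sigma> \<subseteq> W \<and> card \<sigma> = Suc i then \<gamma> (W - \<sigma>) else 0)" for \<sigma>
    have f: "\<sigma> \<subseteq> W \<and> card \<sigma> = Suc i" if "f \<sigma> \<noteq> 0" for \<sigma>
      using that by (auto simp: f_def split: if_splits)
    have f_compl: "f (W - \<tau>) = \<gamma> \<tau>" if "\<tau> \<subseteq> W" "card \<tau> = k" for \<tau>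
    proof -
      have "card (W - \<tau>) = Suc i" using kW that fW finite_subset by (subst card_Diff_subset) auto
      moreover have "W - (W - \<tau>) = \<tau>" using that by auto
      ultimately show ?thesis unfolding f_def by auto
    qed
    have "mchain (dep_monomial E) (sqfree W) i (koszul_bd (ksign V) V f)"
      unfolding mchain_sqfree[OF fW]
    proof (intro allI impI)
      fix \<sigma> assume nz: "koszul_bd (ksign V) V f \<sigma> \<noteq> 0"
      then have \<sigma>: "\<sigma> \<subseteq> W" "card \<sigma> = i" using bd_support[OF f _ fW] by blast+
      define \<tau> where "\<tau> = W - \<sigma>"
      have fin\<sigma>: "finite \<sigma>" using \<sigma>(1) fW finite_subset by auto
      have \<tau>: "\<tau> \<subseteq> W" "card \<tau> = Suc k" "W - \<tau> = \<sigma>"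
        using kW \<sigma> fin\<sigma> by (auto simp: \<tau>_def card_Diff_subset)
      have fin: "finite \<tau>" using \<tau>(1) fW finite_subset by auto
      have "\<not> indep E \<tau>"
      proof
        assume "indep E \<tau>"
        then have "koszul_cobd (csign V W) \<gamma> \<tau> = 0" using cyc \<tau> by blast
        moreover have "koszul_cobd (csign V W) (\<lambda>\<tau>. f (W - \<tau>)) \<tau> = koszul_cobd (csign V W) \<gamma> \<tau>"
          unfolding koszul_cobd_def
        proof (intro sum.cong refl)
          fix v assume "v \<in> \<tau>"
          then have "f (W - (\<tau> - {v})) = \<gamma> (\<tau> - {v})" using \<tau> fin by (intro f_compl) auto
          then show "csign V W v (\<tau> - {v}) * f (W - (\<tau> - {v})) = csign V W v (\<tau> - {v}) * \<gamma> (\<tau> - {v})" by simp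
        qed
        ultimately show False using nz compl[OF \<tau>(1), of f] f \<tau>(3) by auto
      qed
      then show "\<sigma> \<subseteq> W \<and> card \<sigma> = i \<and> \<not> indep E (W - \<sigma>)" using \<sigma> by (auto simp: \<tau>_def)
    qed
    with van[unfolded mvanishes_def, rule_format, of "koszul_bd (ksign V) V f"]
    obtain \<eta> where \<eta>0: "mchain (dep_monomial E) (sqfree W) (Suc i) \<eta>"
      and bd_\<eta>: "\<And>\<tau>. koszul_bd (ksign V) V \<eta> \<tau> = koszul_bd (ksign V) V f \<tau>"
      using bd_bd by blast
    note \<eta> = \<eta>0[unfolded mchain_sqfree[OF fW], rule_format]
    let ?r = "\<lambda>\<sigma>. f \<sigma> - \<eta> \<sigma>"
    define h where "h = cone (ksign V) p ?r"
    have "koszul_bd (ksign V) V ?r \<tau> = 0" for \<tau>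
      unfolding koszul_bd_diff using bd_\<eta> by simp
    then have bd_h: "koszul_bd (ksign V) V h \<tau> = ?r \<tau>" for \<tau>
      unfolding h_def by (intro bd_cone_cycle) (use p V in auto)
    have h: "\<sigma> \<subseteq> W" if "h \<sigma> \<noteq> 0" for \<sigma>
    proof -
      have "p \<in> \<sigma>" "f (\<sigma> - {p}) \<noteq> 0 \<or> \<eta> (\<sigma> - {p}) \<noteq> 0"
        using that by (auto simp: h_def cone_def split: if_splits)
      then have "\<sigma> - {p} \<subseteq> W" using f \<eta> by blast
      then show ?thesis using p by auto
    qed
    have "\<gamma> \<tau> = koszul_cobd (csign V W) (\<lambda>\<tau>. h (W - \<tau>)) \<tau>" if \<tau>: "\<tau> \<subseteq> W" "indep E \<tau>" "card \<tau> = k" for \<tau>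
    proof -
      have "W - (W - \<tau>) = \<tau>" using \<tau> by auto
      then have "\<eta> (W - \<tau>) = 0" using \<eta>[of "W - \<tau>"] \<tau> by auto
      then have "\<gamma> \<tau> = ?r (W - \<tau>)" using f_compl[OF \<tau>(1,3)] by simp
      also have "\<dots> = koszul_cobd (csign V W) (\<lambda>\<tau>. h (W - \<tau>)) \<tau>"
        using compl[OF \<tau>(1), of h] h bd_h by simp
      finally show ?thesis .
    qed
    then show "\<exists>\<eta>. \<forall>\<tau>\<subseteq>W. indep E \<tau> \<and> card \<tau> = k \<longrightarrow> \<gamma> \<tau> = koszul_cobd (csign V W) \<eta> \<tau>"
      by (intro exI[of _ "\<lambda>\<tau>. h (W - \<tau>)"]) blast
  qed
  then show ?thesis by (simp add: k_def)
qed

text \<open>A face with at least \<open>card W\<close> elements is \<open>W\<close> itself, and its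
  complement is empty, hence independent; so only the zero chain remains.\<close>

lemma mvanishes_trivial:
  fixes W :: "'v set"
  assumes "finite W" "card W \<le> i" and E: "{} \<notin> E"
  shows "mvanishes TYPE('k::field) V (dep_monomial E) (sqfree W) i"
  unfolding mvanishes_def mchain_sqfree[OF assms(1)]
proof (intro allI impI, elim conjE)
  fix \<gamma> :: "'v set \<Rightarrow> 'k"
  assume \<gamma>: "\<forall>\<sigma>. \<gamma> \<sigma> \<noteq> 0 \<longrightarrow> \<sigma> \<subseteq> W \<and> card \<sigma> = i \<and> \<not> indep E (W - \<sigma>)"
  have "\<gamma> \<sigma> = 0" for \<sigma>
  proof (rule ccontr)
    assume "\<gamma> \<sigma> \<noteq> 0"
    then have \<sigma>: "\<sigma> \<subseteq> W" "card \<sigma> = i" "\<not> indep E (W - \<sigma>)" using \<gamma> by auto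
    then have "\<sigma> = W" using assms card_seteq by blast
    then have "W - \<sigma> = {}" by auto
    then show False using \<sigma>(3) E unfolding indep_def by (metis subset_empty)
  qed
  then show "\<exists>\<eta>. (\<forall>\<sigma>. \<eta> \<sigma> \<noteq> 0 \<longrightarrow> \<sigma> \<subseteq> W \<and> card \<sigma> = Suc i \<and> \<not> indep E (W - \<sigma>)) \<and>
    (\<forall>\<tau>. koszul_bd (ksign V) V \<eta> \<tau> = \<gamma> \<tau>)"
    by (intro exI[of _ "\<lambda>_. 0"]) (simp add: koszul_bd_def)
qed

text \<open>\<open>k\<close> is the degree of the coefficients, so the total degree is
  \<open>k + i\<close>; a filling has one more index element and coefficients of degree
  \<open>k - 1\<close>.\<close>

definition kvanishes :: "'v set \<Rightarrow> (int \<Rightarrow> ('v, 'k::field) mpoly set) \<Rightarrow> nat \<Rightarrow> int \<Rightarrow> bool" where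
  "kvanishes V A i k \<longleftrightarrow> (\<forall>c\<in>chains V (A k) i. (\<forall>\<tau>. kz V c \<tau> = 0) \<longrightarrow>
    (\<exists>g\<in>chains V (A (k - 1)) (Suc i). \<forall>\<tau>. kz V g \<tau> = c \<tau>))"

abbreviation edge_pieces :: "'v set \<Rightarrow> 'v set set \<Rightarrow> int \<Rightarrow> ('v, 'k::field) mpoly set" where
  "edge_pieces V E \<equiv> monomial_pieces V (dep_monomial E)"

text \<open>The vanishing half of Hochster's formula. An exponent of at least 2 gives an apex; the
  remaining multidegrees are squarefree and fall to duality.\<close>

lemma kvanishes_edge_pieces:
  assumes V: "finite V" and E: "{} \<notin> E"
    and coh: "\<And>W. W \<subseteq> V \<Longrightarrow> int (card W) = k + int i \<Longrightarrow> i < card W \<Longrightarrow>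
      coh_vanishes E (csign V W :: _ \<Rightarrow> _ \<Rightarrow> 'k::field) W (card W - Suc i)"
  shows "kvanishes V (edge_pieces V E :: int \<Rightarrow> ('v, 'k) mpoly set) i k"
  unfolding kvanishes_def
proof (intro ballI impI)
  fix c :: "'v set \<Rightarrow> ('v, 'k) mpoly"
  assume c: "c \<in> chains V (edge_pieces V E k) i" and cyc: "\<forall>\<tau>. kz V c \<tau> = 0"
  show "\<exists>g\<in>chains V (edge_pieces V E (k - 1)) (Suc i). \<forall>\<tau>. kz V g \<tau> = c \<tau>"
  proof (rule kz_lift[OF V c])
    fix m assume m: "keys m \<subseteq> V" "int (monom_degree m) = k + int i"
    have "mvanishes TYPE('k) V (dep_monomial E) m i"
    proof (cases "\<exists>p\<in>keys m. lookup m p \<ge> 2")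
      case True
      then obtain p where p: "p \<in> keys m" "lookup m p \<ge> 2" by auto
      show ?thesis
      proof (rule mvanishes_cone[OF V _ p(1)])
        show "p \<in> V" using p m by auto
        fix \<sigma> assume \<sigma>: "\<sigma> \<subseteq> keys m" "dep_monomial E (m - sqfree \<sigma>)"
        have fin: "finite \<sigma>" "finite (insert p \<sigma>)" using finite_subset_keys[OF \<sigma>(1)] by auto
        \<comment> \<open>With exponent at least 2, dividing by x_p once keeps x_p in the
          support.\<close>
        have "keys (m - sqfree (insert p \<sigma>)) = keys (m - sqfree \<sigma>)"
          unfolding keys_diff_sqfree[OF fin(1)] keys_diff_sqfree[OF fin(2)] using p(2) by auto
        then show "dep_monomial E (m - sqfree (insert p \<sigma>))" using \<sigma>(2) by (simp add: dep_monomial_def)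
      qed
    next
      case False
      define W where "W = keys m"
      have fW: "finite W" and WV: "W \<subseteq> V" using m by (auto simp: W_def)
      have "lookup m v = (if v \<in> W then 1 else 0)" for v
      proof (cases "v \<in> W")
        case True
        then have "lookup m v \<noteq> 0" "\<not> lookup m v \<ge> 2"
          using False by (auto simp: W_def in_keys_iff)
        then show ?thesis using True by simp
      qed (simp add: W_def in_keys_iff)
      then have mW: "m = sqfree W" by (intro poly_mapping_eqI) (simp add: lookup_sqfree[OF fW])
      have cW: "int (card W) = k + int i" using m(2) mW monom_degree_sqfree[OF fW] by simp
      show ?thesis
      proof (cases "i < card W")
        case True
        show ?thesis unfolding mW
          by (rule coh_vanishes_imp_mvanishes[OF V WV True coh[OF WV cW True]])
      next
        case False
        then show ?thesis unfolding mW by (intro mvanishes_trivial fW E) auto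
      qed
    qed
    moreover have "mchain (dep_monomial E) m i (mcoef m c)" by (rule mcoef_mchain[OF c])
    moreover have "koszul_bd (ksign V) V (mcoef m c) \<tau> = 0" for \<tau>
      unfolding mcoef_kz[symmetric] using cyc by (simp add: mcoef_def)
    ultimately show "\<exists>\<eta>. mchain (dep_monomial E) m (Suc i) \<eta> \<and> (\<forall>\<tau>. koszul_bd (ksign V) V \<eta> \<tau> = mcoef m c \<tau>)"
      unfolding mvanishes_def by blast
  qed
qed

text \<open>The nonvanishing half of Hochster's formula: a scalar cycle lifts to a Koszul cycle of
  multidegree \<open>W\<close>, and the part of multidegree \<open>W\<close> of any filling fills
  the scalar cycle.\<close>

lemma not_kvanishes_edge_pieces:
  assumes V: "finite V" and W: "W \<subseteq> V" "int (card W) = k + int i" "i < card W"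
    and coh: "\<not> coh_vanishes E (csign V W :: _ \<Rightarrow> _ \<Rightarrow> 'k::field) W (card W - Suc i)"
  shows "\<not> kvanishes V (edge_pieces V E :: int \<Rightarrow> ('v, 'k) mpoly set) i k"
proof
  assume van: "kvanishes V (edge_pieces V E :: int \<Rightarrow> ('v, 'k) mpoly set) i k"
  have fW: "finite W" using W V finite_subset by auto
  have "mvanishes TYPE('k) V (dep_monomial E) (sqfree W) i"
    unfolding mvanishes_def
  proof (intro allI impI, elim conjE)
    fix \<gamma> :: "'v set \<Rightarrow> 'k"
    assume \<gamma>: "mchain (dep_monomial E) (sqfree W) i \<gamma>" "\<forall>\<tau>. koszul_bd (ksign V) V \<gamma> \<tau> = 0"
    have "keys (sqfree W) \<subseteq> V" "int (monom_degree (sqfree W)) = k + int i"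
      using W fW by (auto simp: keys_sqfree monom_degree_sqfree)
    from mchain_lift[OF V this \<gamma>(1)] \<gamma>(2) obtain c :: "'v set \<Rightarrow> ('v, 'k) mpoly" where
      c: "c \<in> chains V (edge_pieces V E k) i" "\<And>\<tau>. kz V c \<tau> = 0" "mcoef (sqfree W) c = \<gamma>" by metis
    with van obtain g where g: "g \<in> chains V (edge_pieces V E (k - 1)) (Suc i)" "\<And>\<tau>. kz V g \<tau> = c \<tau>"
      unfolding kvanishes_def by blast
    have "koszul_bd (ksign V) V (mcoef (sqfree W) g) \<tau> = \<gamma> \<tau>" for \<tau>
      unfolding mcoef_kz[symmetric] c(3)[symmetric] using g(2) by (simp add: mcoef_def)
    then show "\<exists>\<eta>. mchain (dep_monomial E) (sqfree W) (Suc i) \<eta> \<and> (\<forall>\<tau>. koszul_bd (ksign V) V \<eta> \<tau> = \<gamma> \<tau>)"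
      using mcoef_mchain[OF g(1)] by blast
  qed
  then show False using coh mvanishes_imp_coh_vanishes[OF V W(1,3)] by blast
qed

text \<open>The Koszul complex of the ring resolves the field: in a nonzero multidegree any variable
  dividing it is an apex, and multidegree 0 only meets the constant term in index 0, which the last
  hypothesis excludes.\<close>

lemma kz_lift_homogeneous:
  fixes c :: "'v set \<Rightarrow> ('v, 'k::field) mpoly"
  assumes V: "finite V" and c: "c \<in> chains V (homogeneous_part V k) i" and cyc: "\<And>\<tau>. kz V c \<tau> = 0"
    and 0: "i = 0 \<Longrightarrow> lookup (c {}) 0 = 0"
  shows "\<exists>g\<in>chains V (homogeneous_part V (k - 1)) (Suc i). \<forall>\<tau>. kz V g \<tau> = c \<tau>"
proof -
  have eq: "monomial_pieces V (\<lambda>_. True) j = (homogeneous_part V j :: ('v, 'k) mpoly set)" for j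
    by (simp add: monomial_pieces_def)
  have c': "c \<in> chains V (monomial_pieces V (\<lambda>_. True) k) i" using c eq by simp
  have "\<exists>g\<in>chains V (monomial_pieces V (\<lambda>_. True) (k - 1)) (Suc i). \<forall>\<tau>. kz V g \<tau> = c \<tau>"
  proof (rule kz_lift[OF V c'])
    fix m :: "'v \<Rightarrow>\<^sub>0 nat" assume m: "keys m \<subseteq> V" "int (monom_degree m) = k + int i"
    show "\<exists>\<eta>. mchain (\<lambda>_. True) m (Suc i) \<eta> \<and> (\<forall>\<tau>. koszul_bd (ksign V) V \<eta> \<tau> = mcoef m c \<tau>)"
    proof (cases "m = 0")
      case True
      have "mcoef m c \<sigma> = 0" for \<sigma>
      proof (cases "\<sigma> = {}")
        case \<sigma>: True
        show ?thesis
        proof (cases "i = 0")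
          case False
          then show ?thesis using \<sigma> chains_0[OF c, of \<sigma>] by (simp add: mcoef_def)
        qed (use True \<sigma> 0 in \<open>simp add: mcoef_def sqfree_def\<close>)
      qed (use True in \<open>simp add: mcoef_def\<close>)
      then show ?thesis
        by (intro exI[of _ "\<lambda>_. 0"]) (simp add: mchain_def koszul_bd_def)
    next
      case False
      then obtain p where p: "p \<in> keys m" by (metis equals0I keys_eq_empty)
      then have "mvanishes TYPE('k) V (\<lambda>_. True) m i"
        using m by (intro mvanishes_cone[OF V, of p]) auto
      moreover have "mchain (\<lambda>_. True) m i (mcoef m c)" by (rule mcoef_mchain[OF c'])
      moreover have "koszul_bd (ksign V) V (mcoef m c) \<tau> = 0" for \<tau>
        unfolding mcoef_kz[symmetric] using cyc by (simp add: mcoef_def)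
      ultimately show ?thesis unfolding mvanishes_def by blast
    qed
  qed
  then show ?thesis unfolding eq .
qed

section \<open>Koszul homology and minimal covers\<close>

lemma sum_fun_apply: "(\<Sum>x\<in>A. f x) b = (\<Sum>x\<in>A. f x b)"
  by (induction A rule: infinite_finite_induct) auto

lemma free_module_carrier_iff:
  "f \<in> carrier (free_module (poly_ring V) n) \<longleftrightarrow> (\<forall>b<n. f b \<in> carrier (poly_ring V)) \<and> (\<forall>b\<ge>n. f b = 0)"
  by (simp add: free_module_def)

lemma free_grading_iff:
  "f \<in> free_grading V n d k \<longleftrightarrow> (\<forall>b<n. f b \<in> homogeneous_part V (k - d b)) \<and> (\<forall>b\<ge>n. f b = 0)"
  by (auto simp: free_grading_def free_module_carrier_iff homogeneous_part_carrier)

definition KZ :: "'v set \<Rightarrow> ('v set \<Rightarrow> nat \<Rightarrow> ('v, 'k::field) mpoly) \<Rightarrow> 'v set \<Rightarrow> nat \<Rightarrow> ('v, 'k) mpoly" where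
  "KZ V c \<tau> b = kz V (\<lambda>\<sigma>. c \<sigma> b) \<tau>"

text \<open>\<open>A k\<close> is the component of degree \<open>k\<close>. A chain with values in \<open>A k\<close> on sets of size \<open>i\<close>
  has degree \<open>k + i\<close>, so this says that the \<open>i\<close>-th Koszul homology vanishes in degree \<open>k + i\<close>.\<close>

definition acyclic_at :: "'v set \<Rightarrow> (int \<Rightarrow> (nat \<Rightarrow> ('v, 'k::field) mpoly) set) \<Rightarrow> nat \<Rightarrow> int \<Rightarrow> bool" where
  "acyclic_at V A i k \<longleftrightarrow> (\<forall>c\<in>chains V (A k) i. (\<forall>\<tau>. KZ V c \<tau> = 0) \<longrightarrow>
    (\<exists>g\<in>chains V (A (k - 1)) (Suc i). \<forall>\<tau>. KZ V g \<tau> = c \<tau>))"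

lemma KZ_KZ: "finite V \<Longrightarrow> KZ V (KZ V c) \<tau> = 0"
  by (rule ext) (simp add: KZ_def kz_kz)

lemma KZ_diff: "KZ V (\<lambda>\<sigma>. f \<sigma> - g \<sigma>) \<tau> = KZ V f \<tau> - KZ V g \<tau>"
  by (rule ext) (simp add: KZ_def kz_def koszul_bd_diff)

lemma chains_diff:
  fixes c :: "'v set \<Rightarrow> 'm::ab_group_add"
  assumes "c \<in> chains V A i" "c' \<in> chains V A i" "\<And>x y. x \<in> A \<Longrightarrow> y \<in> A \<Longrightarrow> x - y \<in> A"
  shows "(\<lambda>\<sigma>. c \<sigma> - c' \<sigma>) \<in> chains V A i"
  using assms unfolding chains_def by auto

definition graded_submodule :: "'v set \<Rightarrow> (int \<Rightarrow> (nat \<Rightarrow> ('v, 'k::field) mpoly) set) \<Rightarrow> bool" where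
  "graded_submodule V A \<longleftrightarrow>
    (\<forall>k. 0 \<in> A k \<and> (\<forall>f\<in>A k. \<forall>g\<in>A k. f + g \<in> A k)) \<and>
    (\<forall>j k. \<forall>p\<in>homogeneous_part V j. \<forall>f\<in>A k. (\<lambda>b. p * f b) \<in> A (j + k))"

context
  fixes V :: "'v set" and A :: "int \<Rightarrow> (nat \<Rightarrow> ('v, 'k::field) mpoly) set"
  assumes A: "graded_submodule V A"
begin

lemma gs_0: "0 \<in> A k" using A by (simp add: graded_submodule_def)

lemma gs_add: "f \<in> A k \<Longrightarrow> g \<in> A k \<Longrightarrow> f + g \<in> A k" using A by (simp add: graded_submodule_def)

lemma gs_mult: "p \<in> homogeneous_part V j \<Longrightarrow> f \<in> A k \<Longrightarrow> l = j + k \<Longrightarrow> (\<lambda>b. p * f b) \<in> A l"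
  using A by (simp add: graded_submodule_def)

lemma gs_uminus: "f \<in> A k \<Longrightarrow> - f \<in> A k"
proof -
  assume f: "f \<in> A k"
  have "(\<lambda>b. (- 1) * f b) \<in> A k"
    by (rule gs_mult[of "- 1" 0]) (use f in \<open>auto intro: homogeneous_part_closed\<close>)
  moreover have "(\<lambda>b. (- 1) * f b) = - f" by auto
  ultimately show ?thesis by metis
qed

lemma gs_diff: "f \<in> A k \<Longrightarrow> g \<in> A k \<Longrightarrow> f - g \<in> A k"
  using gs_add[of f k "- g"] gs_uminus[of g k] by simp

lemma gs_sum: "(\<And>x. x \<in> B \<Longrightarrow> f x \<in> A k) \<Longrightarrow> sum f B \<in> A k"
  by (induction B rule: infinite_finite_induct) (auto intro: gs_0 gs_add)

lemma KZ_chains: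
  assumes V: "finite V" and c: "c \<in> chains V (A k) (Suc i)"
  shows "KZ V c \<in> chains V (A (k + 1)) i"
proof -
  have eq: "KZ V c \<tau> = (\<Sum>v\<in>V - \<tau>. (\<lambda>b. ksign V v \<tau> * var v * c (insert v \<tau>) b))" for \<tau>
    by (rule ext) (simp add: KZ_def kz_def koszul_bd_def sum_fun_apply)
  have "KZ V c \<tau> \<in> A (k + 1)" if "\<tau> \<subseteq> V" "card \<tau> = i" for \<tau>
    unfolding eq
  proof (rule gs_sum)
    fix v assume v: "v \<in> V - \<tau>"
    have "finite \<tau>" using that V finite_subset by blast
    then have cA: "c (insert v \<tau>) \<in> A k" using chainsD[OF c, of "insert v \<tau>"] v that by auto
    have kA: "ksign V v \<tau> * var v \<in> (homogeneous_part V 1 :: ('v, 'k) mpoly set)"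
      unfolding ksign_def using v by (intro homogeneous_part_sign homogeneous_part_closed) auto
    show "(\<lambda>b. ksign V v \<tau> * var v * c (insert v \<tau>) b) \<in> A (k + 1)"
      by (rule gs_mult[OF kA cA]) simp
  qed
  moreover have "KZ V c \<tau> = 0" if "\<not> (\<tau> \<subseteq> V \<and> card \<tau> = i)" for \<tau>
  proof -
    have "c (insert v \<tau>) = 0" if v: "v \<in> V - \<tau>" for v
    proof (rule chains_0[OF c], rule notI, elim conjE)
      assume *: "insert v \<tau> \<subseteq> V" "card (insert v \<tau>) = Suc i"
      then have "finite \<tau>" using V finite_subset by (metis finite_insert)
      then show False using * v \<open>\<not> (\<tau> \<subseteq> V \<and> card \<tau> = i)\<close> by auto
    qed
    then show ?thesis by (intro ext) (simp add: eq sum_fun_apply)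
  qed
  ultimately show ?thesis by (auto simp: chains_def)
qed

end

lemma KZ_chains_0:
  assumes V: "finite V" and c: "c \<in> chains V B 0"
  shows "KZ V c \<tau> = 0"
proof -
  have "c (insert v \<tau>) = 0" if v: "v \<in> V - \<tau>" for v
  proof (rule chains_0[OF c], rule notI, elim conjE)
    assume *: "insert v \<tau> \<subseteq> V" "card (insert v \<tau>) = 0"
    then show False using V finite_subset by fastforce
  qed
  then show ?thesis by (intro ext) (simp add: KZ_def kz_def koszul_bd_def)
qed

text \<open>The differential multiplies by variables, so boundaries lie in the irrelevant ideal
  times the module, and a basis vector is never one.\<close>

lemma lookup_KZ_0: "lookup (KZ V c \<tau> b) 0 = 0"
  by (simp add: KZ_def kz_def koszul_bd_def lookup_sum lookup_ksign_var_mult)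

lemma graded_submodule_free: "graded_submodule V (free_grading V n d :: int \<Rightarrow> (nat \<Rightarrow> ('v, 'k::field) mpoly) set)"
  unfolding graded_submodule_def
proof (intro conjI allI ballI)
  fix j k :: int and p :: "('v, 'k) mpoly" and f :: "nat \<Rightarrow> ('v, 'k) mpoly"
  assume *: "p \<in> homogeneous_part V j" "f \<in> free_grading V n d k"
  have "p * f b \<in> homogeneous_part V (j + k - d b)" if "b < n" for b
    by (rule homogeneous_part_mult[OF *(1), of _ "k - d b"]) (use * that in \<open>auto simp: free_grading_iff\<close>)
  then show "(\<lambda>b. p * f b) \<in> free_grading V n d (j + k)" using * by (simp add: free_grading_iff)
qed (auto simp: free_grading_iff intro: homogeneous_part_closed)

lemma free_lift:
  fixes c :: "'v set \<Rightarrow> nat \<Rightarrow> ('v, 'k::field) mpoly"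
  assumes V: "finite V" and c: "c \<in> chains V (free_grading V n d k) i" and cyc: "\<And>\<tau>. KZ V c \<tau> = 0"
    and 0: "\<And>b. i = 0 \<Longrightarrow> b < n \<Longrightarrow> lookup (c {} b) 0 = 0"
  shows "\<exists>g\<in>chains V (free_grading V n d (k - 1)) (Suc i). \<forall>\<tau>. KZ V g \<tau> = c \<tau>"
proof -
  have "\<forall>b\<in>{..<n}. \<exists>g. g \<in> chains V (homogeneous_part V (k - d b - 1)) (Suc i) \<and> (\<forall>\<tau>. kz V g \<tau> = c \<tau> b)"
  proof
    fix b assume b: "b \<in> {..<n}"
    have "(\<lambda>\<sigma>. c \<sigma> b) \<in> chains V (homogeneous_part V (k - d b)) i"
      using c b by (auto simp: chains_def free_grading_iff split: if_splits)
    from kz_lift_homogeneous[OF V this]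
    show "\<exists>g. g \<in> chains V (homogeneous_part V (k - d b - 1)) (Suc i) \<and> (\<forall>\<tau>. kz V g \<tau> = c \<tau> b)"
      using cyc 0 b by (auto simp: KZ_def fun_eq_iff)
  qed
  then obtain g where g: "\<And>b. b < n \<Longrightarrow> g b \<in> chains V (homogeneous_part V (k - d b - 1)) (Suc i)"
    "\<And>b \<tau>. b < n \<Longrightarrow> kz V (g b) \<tau> = c \<tau> b"
    by (metis lessThan_iff)
  define G where "G \<sigma> b = (if b < n then g b \<sigma> else 0)" for \<sigma> b
  have "G \<in> chains V (free_grading V n d (k - 1)) (Suc i)"
  proof -
    have "G \<sigma> \<in> free_grading V n d (k - 1)" if "\<sigma> \<subseteq> V" "card \<sigma> = Suc i" for \<sigma>
      using chainsD[OF g(1) that] by (auto simp: G_def free_grading_iff algebra_simps)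
    moreover have "G \<sigma> = 0" if "\<not> (\<sigma> \<subseteq> V \<and> card \<sigma> = Suc i)" for \<sigma>
      using chains_0[OF g(1) that] by (auto simp: G_def fun_eq_iff)
    ultimately show ?thesis by (auto simp: chains_def)
  qed
  moreover have "KZ V G \<tau> = c \<tau>" for \<tau>
  proof
    fix b
    show "KZ V G \<tau> b = c \<tau> b"
    proof (cases "b < n")
      case True
      then show ?thesis using g(2) by (simp add: KZ_def G_def)
    next
      case False
      then have "c \<tau> b = 0" using c by (cases "\<tau> \<subseteq> V \<and> card \<tau> = i")
          (auto simp: chains_def free_grading_iff split: if_splits)
      then show ?thesis using False by (simp add: KZ_def G_def kz_def koszul_bd_def)
    qed
  qed
  ultimately show ?thesis by blast
qed

text \<open>A row vector times a matrix: \<open>g b\<close> is the image of the basis vector with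
  index \<open>b\<close>.\<close>

definition mat :: "nat \<Rightarrow> (nat \<Rightarrow> nat \<Rightarrow> ('v, 'k::field) mpoly) \<Rightarrow> (nat \<Rightarrow> ('v, 'k) mpoly) \<Rightarrow> nat \<Rightarrow> ('v, 'k) mpoly" where
  "mat n g f = (\<lambda>c. \<Sum>b<n. f b * g b c)"

lemma mat_add: "mat n g (f + f') = mat n g f + mat n g f'"
  by (rule ext) (simp add: mat_def distrib_right sum.distrib)

lemma mat_diff: "mat n g (f - f') = mat n g f - mat n g f'"
  by (rule ext) (simp add: mat_def left_diff_distrib sum_subtractf)

lemma mat_0 [simp]: "mat n g 0 = 0"
  by (rule ext) (simp add: mat_def)

lemma mat_mult: "mat n g (\<lambda>b. p * f b) = (\<lambda>c. p * mat n g f c)"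
  by (rule ext) (simp add: mat_def sum_distrib_left mult.assoc)

lemma mat_sum: "mat n g (\<Sum>x\<in>B. f x) = (\<Sum>x\<in>B. mat n g (f x))"
  by (rule ext) (simp add: mat_def sum_fun_apply sum_distrib_right sum.swap[of _ _ B])

lemma mat_KZ: "mat n g (KZ V c \<tau>) = KZ V (\<lambda>\<sigma>. mat n g (c \<sigma>)) \<tau>"
proof
  fix b
  have "mat n g (KZ V c \<tau>) b = (\<Sum>a<n. \<Sum>v\<in>V - \<tau>. ksign V v \<tau> * var v * (c (insert v \<tau>) a * g a b))"
    by (simp add: mat_def KZ_def kz_def koszul_bd_def sum_distrib_right mult.assoc)
  also have "\<dots> = (\<Sum>v\<in>V - \<tau>. \<Sum>a<n. ksign V v \<tau> * var v * (c (insert v \<tau>) a * g a b))"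
    by (rule sum.swap)
  also have "\<dots> = KZ V (\<lambda>\<sigma>. mat n g (c \<sigma>)) \<tau> b"
    by (simp add: mat_def KZ_def kz_def koszul_bd_def sum_distrib_left)
  finally show "mat n g (KZ V c \<tau>) b = KZ V (\<lambda>\<sigma>. mat n g (c \<sigma>)) \<tau> b" .
qed

lemma mat_chains:
  assumes "c \<in> chains V A i" "\<And>f. f \<in> A \<Longrightarrow> mat n g f \<in> B"
  shows "(\<lambda>\<sigma>. mat n g (c \<sigma>)) \<in> chains V B i"
  using assms by (auto simp: chains_def split: if_splits)

lemma chains_mat_lift:
  assumes "c \<in> chains V B i" "\<And>x. x \<in> B \<Longrightarrow> \<exists>f\<in>A. mat n g f = x"
  shows "\<exists>c'\<in>chains V A i. \<forall>\<sigma>. mat n g (c' \<sigma>) = c \<sigma>"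
proof -
  obtain s where s: "\<And>x. x \<in> B \<Longrightarrow> s x \<in> A \<and> mat n g (s x) = x" using assms(2) by metis
  let ?c = "\<lambda>\<sigma>. if \<sigma> \<subseteq> V \<and> card \<sigma> = i then s (c \<sigma>) else 0"
  have "?c \<in> chains V A i" using assms(1) s by (auto simp: chains_def split: if_splits)
  moreover have "mat n g (?c \<sigma>) = c \<sigma>" for \<sigma>
    using assms(1) s by (auto simp: chains_def split: if_splits)
  ultimately show ?thesis by (intro bexI[of _ ?c]) auto
qed

text \<open>Koszul homology is functorial for matrices: the cycle is sent to \<open>A\<close>,
  filled there, and the filling is sent back.\<close>

lemma acyclic_at_retract:
  assumes "acyclic_at V A i k"
    and "\<And>l f. f \<in> A l \<Longrightarrow> mat n g f \<in> B l" "\<And>l f. f \<in> B l \<Longrightarrow> mat n' g' f \<in> A l"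
    and inv: "\<And>l f. f \<in> B l \<Longrightarrow> mat n g (mat n' g' f) = f"
  shows "acyclic_at V B i k"
  unfolding acyclic_at_def
proof (intro ballI impI)
  fix c assume c: "c \<in> chains V (B k) i" "\<forall>\<tau>. KZ V c \<tau> = 0"
  have "(\<lambda>\<sigma>. mat n' g' (c \<sigma>)) \<in> chains V (A k) i" by (rule mat_chains[OF c(1)]) (rule assms)
  moreover have "\<forall>\<tau>. KZ V (\<lambda>\<sigma>. mat n' g' (c \<sigma>)) \<tau> = 0" using c(2) by (simp flip: mat_KZ)
  ultimately obtain h where h: "h \<in> chains V (A (k - 1)) (Suc i)" "\<And>\<tau>. KZ V h \<tau> = mat n' g' (c \<tau>)"
    using assms(1) unfolding acyclic_at_def by blast
  have "KZ V (\<lambda>\<sigma>. mat n g (h \<sigma>)) \<tau> = c \<tau>" for \<tau>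
  proof -
    have "KZ V (\<lambda>\<sigma>. mat n g (h \<sigma>)) \<tau> = mat n g (mat n' g' (c \<tau>))"
      by (simp add: h(2) flip: mat_KZ)
    also have "\<dots> = c \<tau>"
      using inv c(1) by (cases "\<tau> \<subseteq> V \<and> card \<tau> = i") (auto simp: chains_def split: if_splits)
    finally show ?thesis .
  qed
  moreover have "(\<lambda>\<sigma>. mat n g (h \<sigma>)) \<in> chains V (B (k - 1)) (Suc i)"
    by (rule mat_chains[OF h(1)]) (rule assms)
  ultimately show "\<exists>g\<in>chains V (B (k - 1)) (Suc i). \<forall>\<tau>. KZ V g \<tau> = c \<tau>" by blast
qed

text \<open>The last condition says that the kernel \<open>A'\<close> lies in \<open>\<mm>\<close> times the free module.\<close>

definition minimal_cover ::
    "'v set \<Rightarrow> nat \<Rightarrow> (nat \<Rightarrow> int) \<Rightarrow> (nat \<Rightarrow> nat \<Rightarrow> ('v, 'k::field) mpoly)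
      \<Rightarrow> (int \<Rightarrow> (nat \<Rightarrow> ('v, 'k) mpoly) set) \<Rightarrow> (int \<Rightarrow> (nat \<Rightarrow> ('v, 'k) mpoly) set) \<Rightarrow> bool" where
  "minimal_cover V n d g A A' \<longleftrightarrow> graded_submodule V A \<and>
    (\<forall>k. mat n g ` free_grading V n d k = A k) \<and>
    (\<forall>k. A' k = {f \<in> free_grading V n d k. mat n g f = 0}) \<and>
    (\<forall>k. \<forall>f\<in>A' k. \<forall>b<n. lookup (f b) 0 = 0)"

context
  fixes V :: "'v set" and n d g and A A' :: "int \<Rightarrow> (nat \<Rightarrow> ('v, 'k::field) mpoly) set"
  assumes V: "finite V" and cover: "minimal_cover V n d g A A'"
begin

lemma cover_in: "f \<in> free_grading V n d k \<Longrightarrow> mat n g f \<in> A k"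
  and cover_lift: "x \<in> A k \<Longrightarrow> \<exists>f\<in>free_grading V n d k. mat n g f = x"
  and cover_ker: "f \<in> A' k \<longleftrightarrow> f \<in> free_grading V n d k \<and> mat n g f = 0"
  and cover_min: "f \<in> A' k \<Longrightarrow> b < n \<Longrightarrow> lookup (f b) 0 = 0"
proof -
  have c2: "\<And>k. mat n g ` free_grading V n d k = A k"
    and c3: "\<And>k. A' k = {f \<in> free_grading V n d k. mat n g f = 0}"
    and c4: "\<And>k f b. f \<in> A' k \<Longrightarrow> b < n \<Longrightarrow> lookup (f b) 0 = 0"
    using cover unfolding minimal_cover_def by blast+
  show "f \<in> free_grading V n d k \<Longrightarrow> mat n g f \<in> A k" using c2 by blast
  show "x \<in> A k \<Longrightarrow> \<exists>f\<in>free_grading V n d k. mat n g f = x" unfolding c2[symmetric] by blast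
  show "f \<in> A' k \<longleftrightarrow> f \<in> free_grading V n d k \<and> mat n g f = 0" unfolding c3 by blast
  show "f \<in> A' k \<Longrightarrow> b < n \<Longrightarrow> lookup (f b) 0 = 0" by (rule c4)
qed

lemma cover_A': "graded_submodule V A'"
  unfolding graded_submodule_def
proof (intro conjI allI ballI)
  show "0 \<in> A' k" for k
    unfolding cover_ker using gs_0[OF graded_submodule_free] by auto
  show "f + f' \<in> A' k" if "f \<in> A' k" "f' \<in> A' k" for k f f'
    using that gs_add[OF graded_submodule_free] unfolding cover_ker by (auto simp: mat_add)
  show "(\<lambda>b. p * f b) \<in> A' (j + k)" if "p \<in> homogeneous_part V j" "f \<in> A' k" for j k p f
    using that gs_mult[OF graded_submodule_free that(1) _ refl] unfolding cover_ker
    by (auto simp: mat_mult fun_eq_iff)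
qed

text \<open>The connecting map of \<open>0 \<rightarrow> A' \<rightarrow> \<Oplus>\<^sub>b S(- d b) \<rightarrow> A \<rightarrow> 0\<close>. The free module has no higher Koszul
  homology, and for \<open>i = 0\<close> minimality makes \<open>A'\<close> vanish in the zeroth one.\<close>

lemma acyclic_at_cover: "acyclic_at V A (Suc i) k \<longleftrightarrow> acyclic_at V A' i (k + 1)"
proof
  assume ac: "acyclic_at V A (Suc i) k"
  show "acyclic_at V A' i (k + 1)"
    unfolding acyclic_at_def
  proof (intro ballI impI)
    fix c assume c: "c \<in> chains V (A' (k + 1)) i" "\<forall>\<tau>. KZ V c \<tau> = 0"
    have "A' (k + 1) \<subseteq> free_grading V n d (k + 1)" using cover_ker by blast
    then have c_free: "c \<in> chains V (free_grading V n d (k + 1)) i" using c chains_mono by blast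
    have "lookup (c {} b) 0 = 0" if "i = 0" "b < n" for b
      using chainsD[OF c(1), of "{}"] that cover_min by auto
    from free_lift[OF V c_free _ this] c(2) obtain f where
      f: "f \<in> chains V (free_grading V n d k) (Suc i)" "\<And>\<tau>. KZ V f \<tau> = c \<tau>" by auto
    have "(\<lambda>\<sigma>. mat n g (f \<sigma>)) \<in> chains V (A k) (Suc i)"
      by (rule mat_chains[OF f(1)]) (rule cover_in)
    moreover have "KZ V (\<lambda>\<sigma>. mat n g (f \<sigma>)) \<tau> = 0" for \<tau>
    proof -
      have "mat n g (c \<tau>) = 0"
        using c(1) cover_ker by (cases "\<tau> \<subseteq> V \<and> card \<tau> = i") (auto simp: chains_def split: if_splits)
      then show ?thesis by (simp add: f(2) flip: mat_KZ)
    qed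
    ultimately obtain h where h: "h \<in> chains V (A (k - 1)) (Suc (Suc i))" "\<And>\<tau>. KZ V h \<tau> = mat n g (f \<tau>)"
      using ac unfolding acyclic_at_def by blast
    from chains_mat_lift[OF h(1), where A = "free_grading V n d (k - 1)" and n = n and g = g] cover_lift
    obtain h' where h': "h' \<in> chains V (free_grading V n d (k - 1)) (Suc (Suc i))"
      "\<And>\<sigma>. mat n g (h' \<sigma>) = h \<sigma>" by blast
    \<comment> \<open>\<open>f\<close> fills \<open>c\<close> in the free module only; subtracting a
      boundary with the same image moves the filling into the kernel \<open>A'\<close>.\<close>
    let ?r = "\<lambda>\<sigma>. f \<sigma> - KZ V h' \<sigma>"
    have "KZ V h' \<in> chains V (free_grading V n d k) (Suc i)"
      using KZ_chains[OF graded_submodule_free V h'(1)] by simp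
    then have r: "?r \<in> chains V (free_grading V n d k) (Suc i)"
      by (intro chains_diff f(1)) (auto intro: gs_diff[OF graded_submodule_free])
    have "mat n g (?r \<sigma>) = 0" for \<sigma>
      by (simp add: mat_diff mat_KZ h' h)
    then have "?r \<in> chains V (A' k) (Suc i)"
      using r unfolding chains_def cover_ker by (auto split: if_splits)
    moreover have "KZ V ?r \<tau> = c \<tau>" for \<tau>
      unfolding KZ_diff by (simp add: KZ_KZ[OF V] f(2))
    ultimately show "\<exists>g\<in>chains V (A' (k + 1 - 1)) (Suc i). \<forall>\<tau>. KZ V g \<tau> = c \<tau>"
      by (intro bexI[of _ ?r]) auto
  qed
next
  assume ac: "acyclic_at V A' i (k + 1)"
  show "acyclic_at V A (Suc i) k"
    unfolding acyclic_at_def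
  proof (intro ballI impI)
    fix c assume c: "c \<in> chains V (A k) (Suc i)" "\<forall>\<tau>. KZ V c \<tau> = 0"
    from chains_mat_lift[OF c(1), where A = "free_grading V n d k" and n = n and g = g] cover_lift
    obtain c' where c': "c' \<in> chains V (free_grading V n d k) (Suc i)" "\<And>\<sigma>. mat n g (c' \<sigma>) = c \<sigma>"
      by blast
    have "KZ V c' \<in> chains V (free_grading V n d (k + 1)) i"
      by (rule KZ_chains[OF graded_submodule_free V c'(1)])
    moreover have "mat n g (KZ V c' \<tau>) = 0" for \<tau> using c(2) by (simp add: mat_KZ c'(2))
    ultimately have "KZ V c' \<in> chains V (A' (k + 1)) i"
      unfolding chains_def cover_ker by (auto split: if_splits)
    \<comment> \<open>The boundary of the lift \<open>c'\<close> represents the connecting class;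
      once it bounds in \<open>A'\<close>, the lift can be corrected to a cycle of the acyclic free
      module.\<close>
    then obtain z where z: "z \<in> chains V (A' k) (Suc i)" "\<And>\<tau>. KZ V z \<tau> = KZ V c' \<tau>"
      using ac KZ_KZ[OF V] unfolding acyclic_at_def by force
    have "A' k \<subseteq> free_grading V n d k" using cover_ker by blast
    then have "z \<in> chains V (free_grading V n d k) (Suc i)" using z(1) chains_mono by blast
    then have "(\<lambda>\<sigma>. c' \<sigma> - z \<sigma>) \<in> chains V (free_grading V n d k) (Suc i)"
      by (intro chains_diff c'(1)) (auto intro: gs_diff[OF graded_submodule_free])
    from free_lift[OF V this] obtain f where
      f: "f \<in> chains V (free_grading V n d (k - 1)) (Suc (Suc i))" "\<And>\<tau>. KZ V f \<tau> = c' \<tau> - z \<tau>"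
      using z(2) by (auto simp: KZ_diff)
    have "(\<lambda>\<sigma>. mat n g (f \<sigma>)) \<in> chains V (A (k - 1)) (Suc (Suc i))"
      by (rule mat_chains[OF f(1)]) (rule cover_in)
    moreover have "KZ V (\<lambda>\<sigma>. mat n g (f \<sigma>)) \<tau> = c \<tau>" for \<tau>
    proof -
      have "mat n g (z \<tau>) = 0"
        using z(1) cover_ker by (cases "\<tau> \<subseteq> V \<and> card \<tau> = Suc i") (auto simp: chains_def split: if_splits)
      then show ?thesis by (simp add: f(2) mat_diff c'(2) flip: mat_KZ)
    qed
    ultimately show "\<exists>g\<in>chains V (A (k - 1)) (Suc (Suc i)). \<forall>\<tau>. KZ V g \<tau> = c \<tau>" by blast
  qed
qed

text \<open>Koszul homology in index 0 is \<open>A\<close> modulo the irrelevant ideal times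
  \<open>A\<close>. By minimality the images of the basis vectors form a basis of it over the field,
  so it lives exactly in the degrees \<open>d b\<close>.\<close>

lemma acyclic_at_0_cover: "acyclic_at V A 0 k \<longleftrightarrow> (\<forall>b<n. d b \<noteq> k)"
proof
  assume ac: "acyclic_at V A 0 k"
  show "\<forall>b<n. d b \<noteq> k"
  proof (intro allI impI notI)
    fix b0 assume b0: "b0 < n" "d b0 = k"
    define e where "e = (\<lambda>b. if b = b0 then 1 else (0 :: ('v, 'k) mpoly))"
    have e: "e \<in> free_grading V n d k"
      using b0 by (auto simp: e_def free_grading_iff homogeneous_part_closed)
    let ?c = "\<lambda>\<sigma>. if \<sigma> = {} then mat n g e else 0"
    have c: "?c \<in> chains V (A k) 0"
      using V finite_subset cover_in[OF e] by (fastforce simp: chains_def)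
    with ac KZ_chains_0[OF V c] obtain h where
      h: "h \<in> chains V (A (k - 1)) (Suc 0)" "\<And>\<tau>. KZ V h \<tau> = ?c \<tau>"
      unfolding acyclic_at_def by blast
    from chains_mat_lift[OF h(1), where A = "free_grading V n d (k - 1)" and n = n and g = g] cover_lift
    obtain h' where h': "h' \<in> chains V (free_grading V n d (k - 1)) (Suc 0)"
      "\<And>\<sigma>. mat n g (h' \<sigma>) = h \<sigma>" by blast
    have "KZ V h' \<in> chains V (free_grading V n d k) 0"
      using KZ_chains[OF graded_submodule_free V h'(1)] by simp
    then have "KZ V h' {} \<in> free_grading V n d k" using chainsD by fastforce
    \<comment> \<open>A boundary has zero constant terms, so this kernel element would have constant
      term 1 at \<open>b0\<close>, against minimality.\<close>
    then have "e - KZ V h' {} \<in> free_grading V n d k" using e gs_diff[OF graded_submodule_free] by blast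
    moreover have "mat n g (e - KZ V h' {}) = 0" using h(2)[of "{}"] by (simp add: mat_diff mat_KZ h'(2))
    ultimately have "e - KZ V h' {} \<in> A' k" using cover_ker by blast
    from cover_min[OF this b0(1)] show False
      by (simp add: lookup_minus lookup_KZ_0 e_def)
  qed
next
  assume nd: "\<forall>b<n. d b \<noteq> k"
  show "acyclic_at V A 0 k"
    unfolding acyclic_at_def
  proof (intro ballI impI)
    fix c assume c: "c \<in> chains V (A k) 0"
    from chains_mat_lift[OF c, where A = "free_grading V n d k" and n = n and g = g] cover_lift
    obtain c' where c': "c' \<in> chains V (free_grading V n d k) 0" "\<And>\<sigma>. mat n g (c' \<sigma>) = c \<sigma>"
      by blast
    have "lookup (c' {} b) 0 = 0" if "b < n" for b
    proof (rule homogeneous_part_const)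
      show "c' {} b \<in> homogeneous_part V (k - d b)"
        using chainsD[OF c'(1), of "{}"] that by (simp add: free_grading_iff)
      show "k - d b \<noteq> 0" using nd that by auto
    qed
    from free_lift[OF V c'(1) KZ_chains_0[OF V c'(1)] this]
    obtain f where f: "f \<in> chains V (free_grading V n d (k - 1)) (Suc 0)" "\<And>\<tau>. KZ V f \<tau> = c' \<tau>" by blast
    have "(\<lambda>\<sigma>. mat n g (f \<sigma>)) \<in> chains V (A (k - 1)) (Suc 0)"
      by (rule mat_chains[OF f(1)]) (rule cover_in)
    moreover have "KZ V (\<lambda>\<sigma>. mat n g (f \<sigma>)) \<tau> = c \<tau>" for \<tau>
      by (simp add: f(2) c'(2) flip: mat_KZ)
    ultimately show "\<exists>g\<in>chains V (A (k - 1)) (Suc 0). \<forall>\<tau>. KZ V g \<tau> = c \<tau>" by blast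
  qed
qed

end

section \<open>Homogeneous generators and existence of minimal covers\<close>

definition generates ::
    "'v set \<Rightarrow> (int \<times> (nat \<Rightarrow> ('v, 'k::field) mpoly)) set \<Rightarrow> (int \<Rightarrow> (nat \<Rightarrow> ('v, 'k) mpoly) set) \<Rightarrow> bool" where
  "generates V Gs A \<longleftrightarrow> finite Gs \<and> (\<forall>z\<in>Gs. snd z \<in> A (fst z)) \<and>
    (\<forall>k. \<forall>f\<in>A k. \<exists>p. (\<forall>z\<in>Gs. p z \<in> homogeneous_part V (k - fst z)) \<and>
      f = (\<lambda>b. \<Sum>z\<in>Gs. p z * snd z b))"

text \<open>A component sits in the span of the finitely many monomial vectors of its degree, hence
  is finite-dimensional; constant polynomials act as scalars.\<close>

lemma finite_spanning_set:
  fixes A :: "int \<Rightarrow> (nat \<Rightarrow> ('v, 'k::field) mpoly) set"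
  assumes V: "finite V" and A: "graded_submodule V A" and sub: "A k \<subseteq> free_grading V n d k"
  shows "\<exists>S\<subseteq>A k. finite S \<and> (\<forall>f\<in>A k. \<exists>a. f = (\<lambda>b. \<Sum>s\<in>S. single 0 (a s) * s b))"
proof -
  define scale :: "'k \<Rightarrow> (nat \<Rightarrow> ('v, 'k) mpoly) \<Rightarrow> nat \<Rightarrow> ('v, 'k) mpoly"
    where "scale c f = (\<lambda>b. single 0 c * f b)" for c f
  interpret vector_space scale
    by unfold_locales
      (auto simp: scale_def fun_eq_iff distrib_left distrib_right single_add mult_single mult.assoc[symmetric])
  define mon where "mon b m = (\<lambda>b'. if b' = b then single m 1 else (0 :: ('v, 'k) mpoly))" for b :: nat and m
  define T where "T = (\<lambda>(b, m). mon b m) ` (SIGMA b:{..<n}. {m. keys m \<subseteq> V \<and> int (monom_degree m) = k - d b})"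
  have finT: "finite T" unfolding T_def using finite_monomials[OF V] by (intro finite_imageI finite_SigmaI) auto
  have "f \<in> span T" if f: "f \<in> free_grading V n d k" for f
  proof -
    have "f = (\<Sum>b<n. \<Sum>m\<in>keys (f b). scale (lookup (f b) m) (mon b m))"
    proof
      fix b'
      have "(\<Sum>b<n. \<Sum>m\<in>keys (f b). scale (lookup (f b) m) (mon b m)) b'
        = (\<Sum>b<n. if b = b' then \<Sum>m\<in>keys (f b). single m (lookup (f b) m) else 0)"
        unfolding sum_fun_apply by (intro sum.cong) (auto simp: scale_def mon_def mult_single)
      also have "\<dots> = f b'"
        using f by (auto simp: free_grading_iff poly_mapping_sum_single[symmetric])
      finally show "f b' = (\<Sum>b<n. \<Sum>m\<in>keys (f b). scale (lookup (f b) m) (mon b m)) b'" ..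
    qed
    moreover have "mon b m \<in> T" if "b < n" "m \<in> keys (f b)" for b m
      using f that by (auto simp: T_def free_grading_iff homogeneous_part_iff in_keys_iff)
    then have "(\<Sum>b<n. \<Sum>m\<in>keys (f b). scale (lookup (f b) m) (mon b m)) \<in> span T"
      by (intro span_sum span_scale span_base) auto
    ultimately show ?thesis by metis
  qed
  then have AT: "A k \<subseteq> span T" using sub by blast
  obtain S where S: "S \<subseteq> A k" "independent S" "A k \<subseteq> span S"
    using maximal_independent_subset[of "A k"] by metis
  have finS: "finite S" using independent_span_bound[OF finT S(2)] S(1) AT by blast
  have "\<exists>a. f = (\<lambda>b. \<Sum>s\<in>S. single 0 (a s) * s b)" if f: "f \<in> A k" for f
  proof -
    have "f \<in> range (\<lambda>u. \<Sum>v\<in>S. scale (u v) v)" using S(3) f span_finite[OF finS] by blast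
    then obtain a where "f = (\<Sum>v\<in>S. scale (a v) v)" by auto
    then show ?thesis by (intro exI[of _ a]) (auto simp: fun_eq_iff sum_fun_apply scale_def)
  qed
  then show ?thesis using S(1) finS by blast
qed

text \<open>Graded Nakayama: generators are collected from the finitely many degrees with nonzero
  homology in index 0. In any other degree an element is a combination of variables times elements
  one degree lower, and the descent stops below the lowest basis degree.\<close>

lemma generates_exists:
  fixes A :: "int \<Rightarrow> (nat \<Rightarrow> ('v, 'k::field) mpoly) set"
  assumes V: "finite V" and A: "graded_submodule V A" and sub: "\<And>k. A k \<subseteq> free_grading V n d k"
    and fin: "finite {k. \<not> acyclic_at V A 0 k}"
  shows "\<exists>Gs. generates V Gs A"
proof -
  let ?D = "{k. \<not> acyclic_at V A 0 k}"
  have "\<forall>k. \<exists>S. S \<subseteq> A k \<and> finite S \<and> (\<forall>f\<in>A k. \<exists>a. f = (\<lambda>b. \<Sum>s\<in>S. single 0 (a s) * s b))"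
    using finite_spanning_set[OF V A sub] by blast
  from choice[OF this] obtain S where S: "\<And>k. S k \<subseteq> A k" "\<And>k. finite (S k)"
    "\<And>k f. f \<in> A k \<Longrightarrow> \<exists>a. f = (\<lambda>b. \<Sum>s\<in>S k. single 0 (a s) * s b)"
    by blast
  define Gs where "Gs = (SIGMA k:?D. S k)"
  have finG: "finite Gs" unfolding Gs_def using fin S(2) by (intro finite_SigmaI) auto
  obtain low where low: "\<And>b. b < n \<Longrightarrow> low \<le> d b"
  proof
    show "Min (d ` {..<n}) \<le> d b" if "b < n" for b using that by (intro Min_le) auto
  qed
  have gen: "\<exists>p. (\<forall>z\<in>Gs. p z \<in> homogeneous_part V (k - fst z)) \<and> f = (\<lambda>b. \<Sum>z\<in>Gs. p z * snd z b)"
    if "f \<in> A k" for f k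
    using that
  proof (induction "nat (k - low + 1)" arbitrary: k f rule: less_induct)
    case less
    show ?case
    proof (cases "acyclic_at V A 0 k")
      case False
      obtain a where a: "f = (\<lambda>b. \<Sum>s\<in>S k. single 0 (a s) * s b)" using S(3) less.prems by blast
      define p where "p z = (if fst z = k then single 0 (a (snd z)) else (0 :: ('v, 'k) mpoly))" for z
      have "(\<Sum>z\<in>Gs. p z * snd z b) = f b" for b
      proof -
        have "(\<Sum>z\<in>Gs. p z * snd z b) = (\<Sum>z\<in>Pair k ` S k. p z * snd z b)"
          by (rule sum.mono_neutral_right) (use finG False in \<open>auto simp: Gs_def p_def\<close>)
        also have "\<dots> = (\<Sum>s\<in>S k. single 0 (a s) * s b)"
          by (subst sum.reindex) (auto simp: inj_on_def p_def)
        finally show ?thesis using a by simp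
      qed
      then show ?thesis
        by (intro exI[of _ p]) (auto simp: p_def fun_eq_iff homogeneous_part_closed)
    next
      case True
      show ?thesis
      proof (cases "k < low")
        case True
        have "f b = 0" for b
        proof (cases "b < n")
          case b: True
          then have "f b \<in> homogeneous_part V (k - d b)" using less.prems sub[of k] by (auto simp: free_grading_iff)
          then show ?thesis by (rule homogeneous_part_neg) (use low[OF b] True in simp)
        next
          case False
          then show ?thesis using less.prems sub[of k] by (auto simp: free_grading_iff)
        qed
        then show ?thesis by (intro exI[of _ "\<lambda>_. 0"]) (auto simp: homogeneous_part_closed)
      next
        case False
        let ?c = "\<lambda>\<sigma>. if \<sigma> = {} then f else 0"
        have c: "?c \<in> chains V (A k) 0"
          using V finite_subset less.prems by (fastforce simp: chains_def)
        \<comment> \<open>Acyclicity writes \<open>f\<close> as the signed sum of the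
          \<open>var v * h {v}\<close>, with each \<open>h {v}\<close> one degree lower.\<close>
        with True KZ_chains_0[OF V c] obtain h where
          h: "h \<in> chains V (A (k - 1)) (Suc 0)" "\<And>\<tau>. KZ V h \<tau> = ?c \<tau>"
          unfolding acyclic_at_def by blast
        have hA: "h {v} \<in> A (k - 1)" if "v \<in> V" for v using chainsD[OF h(1), of "{v}"] that by auto
        have "\<forall>v\<in>V. \<exists>p. (\<forall>z\<in>Gs. p z \<in> homogeneous_part V (k - 1 - fst z)) \<and> h {v} = (\<lambda>b. \<Sum>z\<in>Gs. p z * snd z b)"
          using less.hyps[of "k - 1"] hA False by auto
        from bchoice[OF this] obtain q where q: "\<And>v z. v \<in> V \<Longrightarrow> z \<in> Gs \<Longrightarrow> q v z \<in> homogeneous_part V (k - 1 - fst z)"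
          "\<And>v. v \<in> V \<Longrightarrow> h {v} = (\<lambda>b. \<Sum>z\<in>Gs. q v z * snd z b)" by blast
        define p where "p z = (\<Sum>v\<in>V. ksign V v {} * var v * q v z)" for z
        have "p z \<in> homogeneous_part V (k - fst z)" if "z \<in> Gs" for z
          unfolding p_def
        proof (rule homogeneous_part_sum)
          fix v assume v: "v \<in> V"
          have "ksign V v {} * var v \<in> (homogeneous_part V 1 :: ('v, 'k) mpoly set)"
            unfolding ksign_def using v by (intro homogeneous_part_sign homogeneous_part_closed)
          then show "ksign V v {} * var v * q v z \<in> homogeneous_part V (k - fst z)"
            by (rule homogeneous_part_mult[OF _ q(1)[OF v that]]) simp
        qed
        moreover have "f b = (\<Sum>z\<in>Gs. p z * snd z b)" for b
        proof -
          have "f b = KZ V h {} b" by (simp add: h(2))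
          also have "\<dots> = (\<Sum>v\<in>V. \<Sum>z\<in>Gs. ksign V v {} * var v * q v z * snd z b)"
            by (simp add: KZ_def kz_def koszul_bd_def q(2) sum_distrib_left mult.assoc)
          also have "\<dots> = (\<Sum>z\<in>Gs. p z * snd z b)"
            unfolding p_def sum_distrib_right by (rule sum.swap)
          finally show ?thesis .
        qed
        ultimately show ?thesis by blast
      qed
    qed
  qed
  have "\<forall>z\<in>Gs. snd z \<in> A (fst z)" using S(1) by (auto simp: Gs_def)
  then show ?thesis unfolding generates_def using finG gen by blast
qed

text \<open>A generating set of least cardinality gives the cover: a relation with a nonzero
  constant coefficient could be solved for that generator, which could then be dropped.\<close>

lemma minimal_cover_exists:
  fixes A :: "int \<Rightarrow> (nat \<Rightarrow> ('v, 'k::field) mpoly) set"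
  assumes V: "finite V" and A: "graded_submodule V A" and sub: "\<And>k. A k \<subseteq> free_grading V n d k"
    and fin: "finite {k. \<not> acyclic_at V A 0 k}"
  shows "\<exists>n' d' g A'. minimal_cover V n' d' g A A'"
proof -
  obtain Gs where Gs: "generates V Gs A" and min: "\<And>Gs'. generates V Gs' A \<Longrightarrow> card Gs \<le> card Gs'"
    using generates_exists[OF V A sub fin] ex_has_least_nat[of "\<lambda>Gs. generates V Gs A" _ card] by metis
  have finG: "finite Gs" and GA: "\<And>z. z \<in> Gs \<Longrightarrow> snd z \<in> A (fst z)"
    and gen: "\<And>k f. f \<in> A k \<Longrightarrow> \<exists>p. (\<forall>z\<in>Gs. p z \<in> homogeneous_part V (k - fst z)) \<and>
      f = (\<lambda>b. \<Sum>z\<in>Gs. p z * snd z b)"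
    using Gs unfolding generates_def by blast+
  have no_unit: "lookup (q z0) 0 = 0"
    if q: "\<And>z. z \<in> Gs \<Longrightarrow> q z \<in> homogeneous_part V (k - fst z)"
      and rel: "\<And>b. (\<Sum>z\<in>Gs. q z * snd z b) = 0" and z0: "z0 \<in> Gs" for q k z0
  proof (rule ccontr)
    assume nz: "lookup (q z0) 0 \<noteq> 0"
    define c where "c = lookup (q z0) 0"
    have k: "k = fst z0" using homogeneous_part_const[OF q[OF z0]] nz by auto
    have qz0: "q z0 = single 0 c" using homogeneous_part_0[of "q z0" V] q[OF z0] k unfolding c_def by simp
    define C where "C = single (0 :: 'v \<Rightarrow>\<^sub>0 nat) (1 / c)"
    have "c \<noteq> 0" using nz by (simp add: c_def)
    then have Cq: "C * q z0 = 1" by (simp add: C_def qz0 mult_single)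
    have "generates V (Gs - {z0}) A"
      unfolding generates_def
    proof (intro conjI ballI allI)
      fix l f assume "f \<in> A l"
      then obtain p where p: "\<And>z. z \<in> Gs \<Longrightarrow> p z \<in> homogeneous_part V (l - fst z)"
        "\<And>b. f b = (\<Sum>z\<in>Gs. p z * snd z b)" using gen by force
      \<comment> \<open>Subtracts the multiple of the relation that cancels the coefficient of
        \<open>z0\<close>; \<open>C\<close> is the inverse of the constant
        \<open>q z0\<close>.\<close>
      define p' where "p' z = p z - p z0 * C * q z" for z
      have "p' z \<in> homogeneous_part V (l - fst z)" if z: "z \<in> Gs" for z
      proof -
        have "p z0 * C \<in> homogeneous_part V (l - fst z0)"
          by (rule homogeneous_part_mult[OF p(1)[OF z0], of _ 0]) (auto simp: C_def homogeneous_part_closed)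
        then have "p z0 * C * q z \<in> homogeneous_part V (l - fst z)"
          by (rule homogeneous_part_mult[OF _ q[OF z]]) (simp add: k)
        then show ?thesis unfolding p'_def using p(1)[OF z] by (intro homogeneous_part_closed)
      qed
      moreover have "f b = (\<Sum>z\<in>Gs - {z0}. p' z * snd z b)" for b
      proof -
        have "p' z0 = 0" using Cq by (simp add: p'_def mult.assoc)
        then have "(\<Sum>z\<in>Gs - {z0}. p' z * snd z b) = (\<Sum>z\<in>Gs. p' z * snd z b)"
          by (intro sum.mono_neutral_left) (use finG in auto)
        also have "\<dots> = (\<Sum>z\<in>Gs. p z * snd z b) - p z0 * C * (\<Sum>z\<in>Gs. q z * snd z b)"
          by (simp add: p'_def left_diff_distrib sum_subtractf sum_distrib_left mult.assoc)
        also have "\<dots> = f b" by (simp add: rel p(2))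
        finally show ?thesis ..
      qed
      ultimately show "\<exists>p. (\<forall>z\<in>Gs - {z0}. p z \<in> homogeneous_part V (l - fst z)) \<and>
          f = (\<lambda>b. \<Sum>z\<in>Gs - {z0}. p z * snd z b)"
        by (intro exI[of _ p']) auto
    qed (use finG GA in auto)
    then have "card Gs \<le> card (Gs - {z0})" by (rule min)
    then show False using z0 finG card_Diff1_less by (metis leD)
  qed
  define n' where "n' = card Gs"
  obtain h where h: "bij_betw h {..<n'} Gs"
    using ex_bij_betw_nat_finite[OF finG] unfolding n'_def atLeast0LessThan by blast
  define d' where "d' b = fst (h b)" for b
  define g where "g b = snd (h b)" for b
  have hG: "h b \<in> Gs" if "b < n'" for b using h that by (auto simp: bij_betw_def)
  define h' where "h' = the_inv_into {..<n'} h"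
  have h': "h' z < n'" "h (h' z) = z" if "z \<in> Gs" for z
    using bij_betwE[OF bij_betw_the_inv_into[OF h]] f_the_inv_into_f_bij_betw[OF h] that
    unfolding h'_def by auto
  have h'h: "h' (h b) = b" if "b < n'" for b
    unfolding h'_def using h that by (intro the_inv_into_f_f) (auto simp: bij_betw_def)
  have mat_eq: "mat n' g f b = (\<Sum>z\<in>Gs. f (h' z) * snd z b)" for f b
  proof -
    have "(\<Sum>z\<in>Gs. f (h' z) * snd z b) = (\<Sum>a<n'. f (h' (h a)) * snd (h a) b)"
      by (rule sum.reindex_bij_betw[OF h, symmetric])
    also have "\<dots> = mat n' g f b" unfolding mat_def by (rule sum.cong) (auto simp: h'h g_def)
    finally show ?thesis ..
  qed
  have "minimal_cover V n' d' g A (\<lambda>k. {f \<in> free_grading V n' d' k. mat n' g f = 0})"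
    unfolding minimal_cover_def
  proof (intro conjI allI ballI impI)
    fix k
    show "mat n' g ` free_grading V n' d' k = A k"
    proof
      show "mat n' g ` free_grading V n' d' k \<subseteq> A k"
      proof
        fix x assume "x \<in> mat n' g ` free_grading V n' d' k"
        then obtain f where f: "f \<in> free_grading V n' d' k" "x = mat n' g f" by blast
        have "x = (\<Sum>b<n'. (\<lambda>c. f b * g b c))" unfolding f(2) mat_def by (rule ext) (simp add: sum_fun_apply)
        also have "\<dots> \<in> A k"
        proof (rule gs_sum[OF A])
          fix b assume b: "b \<in> {..<n'}"
          show "(\<lambda>c. f b * g b c) \<in> A k"
            by (rule gs_mult[OF A, of _ "k - d' b" _ "d' b"])
              (use f b GA[OF hG] in \<open>auto simp: free_grading_iff g_def d'_def\<close>)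
        qed
        finally show "x \<in> A k" .
      qed
      show "A k \<subseteq> mat n' g ` free_grading V n' d' k"
      proof
        fix x assume "x \<in> A k"
        then obtain p where p: "\<And>z. z \<in> Gs \<Longrightarrow> p z \<in> homogeneous_part V (k - fst z)"
          "\<And>b. x b = (\<Sum>z\<in>Gs. p z * snd z b)" using gen by force
        define f where "f b = (if b < n' then p (h b) else 0)" for b
        have "f \<in> free_grading V n' d' k" using p(1) hG by (auto simp: f_def free_grading_iff d'_def)
        moreover have "mat n' g f = x"
          by (rule ext) (simp add: mat_eq p(2) f_def h')
        ultimately show "x \<in> mat n' g ` free_grading V n' d' k" by blast
      qed
    qed
  next
    fix k f b assume f: "f \<in> {f \<in> free_grading V n' d' k. mat n' g f = 0}" and b: "b < n'"
    have "lookup (f (h' (h b))) 0 = 0"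
    proof (rule no_unit)
      show "f (h' z) \<in> homogeneous_part V (k - fst z)" if "z \<in> Gs" for z
      proof -
        have "f (h' z) \<in> homogeneous_part V (k - d' (h' z))" using f h'(1)[OF that] by (auto simp: free_grading_iff)
        then show ?thesis by (simp add: d'_def h'(2)[OF that])
      qed
      show "(\<Sum>z\<in>Gs. f (h' z) * snd z b) = 0" for b using f mat_eq[of f b] by simp
    qed (rule hG[OF b])
    then show "lookup (f b) 0 = 0" using h'h[OF b] by simp
  qed (use A in auto)
  then show ?thesis by blast
qed

section \<open>Graded free resolutions\<close>

lemma free_module_closed:
  fixes f g :: "nat \<Rightarrow> ('v, 'k::field) mpoly"
  shows "0 \<in> carrier (free_module (poly_ring V :: ('v, 'k) mpoly ring) n)"
    "f \<in> carrier (free_module (poly_ring V) n) \<Longrightarrow> g \<in> carrier (free_module (poly_ring V) n) \<Longrightarrow>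
      f + g \<in> carrier (free_module (poly_ring V) n)"
    "p \<in> carrier (poly_ring V) \<Longrightarrow> f \<in> carrier (free_module (poly_ring V) n) \<Longrightarrow>
      (\<lambda>b. p * f b) \<in> carrier (free_module (poly_ring V) n)"
  by (auto simp: free_module_carrier_iff intro: poly_ring_closed)

lemma free_module_sum:
  fixes f :: "'a \<Rightarrow> nat \<Rightarrow> ('v, 'k::field) mpoly"
  shows "(\<And>x. x \<in> B \<Longrightarrow> f x \<in> carrier (free_module (poly_ring V) n)) \<Longrightarrow>
    sum f B \<in> carrier (free_module (poly_ring V) n)"
  by (induction B rule: infinite_finite_induct) (auto intro: free_module_closed)

lemma free_grading_carrier: "f \<in> free_grading V n d k \<Longrightarrow> f \<in> carrier (free_module (poly_ring V) n)"
  by (simp add: free_grading_def)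

definition vcomp :: "(nat \<Rightarrow> int) \<Rightarrow> int \<Rightarrow> (nat \<Rightarrow> ('v, 'k::field) mpoly) \<Rightarrow> nat \<Rightarrow> ('v, 'k) mpoly" where
  "vcomp d k f = (\<lambda>b. hcomp (k - d b) (f b))"

lemma vcomp_in: "f \<in> carrier (free_module (poly_ring V) n) \<Longrightarrow> vcomp d k f \<in> free_grading V n d k"
  by (auto simp: vcomp_def free_grading_iff free_module_carrier_iff intro: hcomp_in)

lemma vcomp_homogeneous:
  assumes "f \<in> free_grading V n d l"
  shows "vcomp d k f = (if l = k then f else 0)"
proof
  fix b
  show "vcomp d k f b = (if l = k then f else 0) b"
  proof (cases "b < n")
    case True
    then have "f b \<in> homogeneous_part V (l - d b)" using assms by (auto simp: free_grading_iff)
    from hcomp_homogeneous[OF this, of "k - d b"] show ?thesis by (simp add: vcomp_def)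
  next
    case False
    then show ?thesis using assms by (auto simp: free_grading_iff vcomp_def)
  qed
qed

lemma vcomp_sum: "vcomp d k (\<Sum>x\<in>B. f x) = (\<Sum>x\<in>B. vcomp d k (f x))"
  by (rule ext) (simp add: vcomp_def sum_fun_apply hcomp_sum)

text \<open>The finite set of degrees is made to contain a prescribed \<open>l\<close>, so that the
  component of degree \<open>l\<close> can be read off the sum even when it is zero.\<close>

lemma vcomp_decomposition:
  fixes f :: "nat \<Rightarrow> ('v, 'k::field) mpoly"
  assumes f: "f \<in> carrier (free_module (poly_ring V) n)"
  obtains J where "finite J" "l \<in> J" "f = (\<Sum>k\<in>J. vcomp d k f)"
proof
  define J where "J = insert l (\<Union>b<n. (\<lambda>j. j + d b) ` hdegs (f b))"
  show fin: "finite J" by (simp add: J_def finite_hdegs)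
  show "l \<in> J" by (simp add: J_def)
  show "f = (\<Sum>k\<in>J. vcomp d k f)"
  proof
    fix b
    show "f b = (\<Sum>k\<in>J. vcomp d k f) b"
    proof (cases "b < n")
      case True
      have "(\<Sum>k\<in>J. vcomp d k f) b = (\<Sum>k\<in>J. hcomp (k - d b) (f b))"
        by (simp add: sum_fun_apply vcomp_def)
      also have "\<dots> = (\<Sum>j\<in>(\<lambda>k. k - d b) ` J. hcomp j (f b))"
        by (subst sum.reindex) (auto simp: inj_on_def)
      also have "\<dots> = f b"
      proof (rule sum_hcomp)
        show "hdegs (f b) \<subseteq> (\<lambda>k. k - d b) ` J"
        proof
          fix j assume "j \<in> hdegs (f b)"
          then have "j + d b \<in> J" using True by (auto simp: J_def)
          then show "j \<in> (\<lambda>k. k - d b) ` J" by force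
        qed
      qed (use fin in simp)
      finally show ?thesis ..
    next
      case False
      then show ?thesis using f by (simp add: free_module_carrier_iff sum_fun_apply vcomp_def)
    qed
  qed
qed

lemma vcomp_mat:
  assumes gr: "\<And>l f. f \<in> free_grading V n d' l \<Longrightarrow> mat n g f \<in> free_grading V m d l"
    and f: "f \<in> carrier (free_module (poly_ring V) n)"
  shows "vcomp d k (mat n g f) = mat n g (vcomp d' k f)"
proof -
  obtain J where J: "finite J" "k \<in> J" "f = (\<Sum>l\<in>J. vcomp d' l f)" using vcomp_decomposition[OF f] .
  have "vcomp d k (mat n g f) = (\<Sum>l\<in>J. vcomp d k (mat n g (vcomp d' l f)))"
    by (subst J(3)) (simp only: mat_sum vcomp_sum)
  also have "\<dots> = (\<Sum>l\<in>J. if l = k then mat n g (vcomp d' l f) else 0)"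
    by (intro sum.cong refl vcomp_homogeneous[OF gr[OF vcomp_in[OF f]]])
  also have "\<dots> = mat n g (vcomp d' k f)" using J by simp
  finally show ?thesis .
qed

lemma mat_carrier:
  assumes gr: "\<And>l f. f \<in> free_grading V n d' l \<Longrightarrow> mat n g f \<in> free_grading V m d l"
    and f: "f \<in> carrier (free_module (poly_ring V) n)"
  shows "mat n g f \<in> carrier (free_module (poly_ring V) m)"
proof -
  obtain J where J: "f = (\<Sum>l\<in>J. vcomp d' l f)" using vcomp_decomposition[OF f] .
  have "mat n g f = (\<Sum>l\<in>J. mat n g (vcomp d' l f))" by (subst J) (simp only: mat_sum)
  also have "\<dots> \<in> carrier (free_module (poly_ring V) m)"
    by (intro free_module_sum free_grading_carrier[OF gr[OF vcomp_in[OF f]]])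
  finally show ?thesis .
qed

text \<open>The direct sum of the components, as a set of vectors. Exactness of a resolution is
  stated for such ungraded sets, whereas covers are graded.\<close>

definition total_module ::
    "'v set \<Rightarrow> nat \<Rightarrow> (nat \<Rightarrow> int) \<Rightarrow> (int \<Rightarrow> (nat \<Rightarrow> ('v, 'k::field) mpoly) set) \<Rightarrow> (nat \<Rightarrow> ('v, 'k) mpoly) set" where
  "total_module V n d A = {f \<in> carrier (free_module (poly_ring V) n). \<forall>k. vcomp d k f \<in> A k}"

context
  fixes V :: "'v set" and n' d' g n d and A A' :: "int \<Rightarrow> (nat \<Rightarrow> ('v, 'k::field) mpoly) set"
  assumes V: "finite V" and cover: "minimal_cover V n' d' g A A'" and sub: "\<And>k. A k \<subseteq> free_grading V n d k"
begin

lemma cover_graded: "f \<in> free_grading V n' d' k \<Longrightarrow> mat n' g f \<in> free_grading V n d k"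
  using cover_in[OF V cover] sub by blast

lemma cover_image: "mat n' g ` carrier (free_module (poly_ring V) n') = total_module V n d A"
proof
  show "mat n' g ` carrier (free_module (poly_ring V) n') \<subseteq> total_module V n d A"
    unfolding total_module_def
    using mat_carrier[of V n' d' g n d, OF cover_graded] vcomp_mat[of V n' d' g n d, OF cover_graded]
      cover_in[OF V cover] vcomp_in
    by fastforce
  show "total_module V n d A \<subseteq> mat n' g ` carrier (free_module (poly_ring V) n')"
  proof
    fix f assume f: "f \<in> total_module V n d A"
    then have fc: "f \<in> carrier (free_module (poly_ring V) n)" by (simp add: total_module_def)
    obtain J where J: "f = (\<Sum>k\<in>J. vcomp d k f)" by (rule vcomp_decomposition[OF fc])
    have "\<forall>k. \<exists>x. x \<in> free_grading V n' d' k \<and> mat n' g x = vcomp d k f"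
      using f cover_lift[OF V cover] unfolding total_module_def by blast
    from choice[OF this] obtain x where
      x: "\<And>k. x k \<in> free_grading V n' d' k" "\<And>k. mat n' g (x k) = vcomp d k f" by blast
    have "f = mat n' g (\<Sum>k\<in>J. x k)" by (subst J) (simp only: mat_sum x(2))
    moreover have "(\<Sum>k\<in>J. x k) \<in> carrier (free_module (poly_ring V) n')"
      by (intro free_module_sum free_grading_carrier[OF x(1)])
    ultimately show "f \<in> mat n' g ` carrier (free_module (poly_ring V) n')" by blast
  qed
qed

lemma cover_kernel:
  "{f \<in> carrier (free_module (poly_ring V) n'). mat n' g f = 0} = total_module V n' d' A'"
proof (intro equalityI subsetI)
  fix f assume "f \<in> {f \<in> carrier (free_module (poly_ring V) n'). mat n' g f = 0}"
  then have f: "f \<in> carrier (free_module (poly_ring V) n')" "mat n' g f = 0" by auto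
  have "mat n' g (vcomp d' k f) = 0" for k
    using vcomp_mat[of V n' d' g n d, OF cover_graded f(1), of k] f(2)
    by (simp add: vcomp_def fun_eq_iff)
  then have "vcomp d' k f \<in> A' k" for k
    unfolding cover_ker[OF V cover] using vcomp_in[OF f(1)] by blast
  then show "f \<in> total_module V n' d' A'" using f(1) by (simp add: total_module_def)
next
  fix f assume f: "f \<in> total_module V n' d' A'"
  then have fc: "f \<in> carrier (free_module (poly_ring V) n')" by (simp add: total_module_def)
  obtain J where J: "f = (\<Sum>k\<in>J. vcomp d' k f)" by (rule vcomp_decomposition[OF fc])
  have "mat n' g f = (\<Sum>k\<in>J. mat n' g (vcomp d' k f))" by (subst J) (simp only: mat_sum)
  also have "\<dots> = 0" using f by (simp add: total_module_def cover_ker[OF V cover])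
  finally show "f \<in> {f \<in> carrier (free_module (poly_ring V) n'). mat n' g f = 0}"
    using f by (simp add: total_module_def)
qed

end

text \<open>Finite generation of all syzygies is controlled by Koszul homology, so that the Hilbert basis
  theorem is not needed.\<close>

definition resolvable ::
    "'v set \<Rightarrow> nat \<Rightarrow> (nat \<Rightarrow> int) \<Rightarrow> (int \<Rightarrow> (nat \<Rightarrow> ('v, 'k::field) mpoly) set) \<Rightarrow> bool" where
  "resolvable V n d A \<longleftrightarrow> graded_submodule V A \<and> (\<forall>k. A k \<subseteq> free_grading V n d k) \<and>
    (\<forall>i. finite {k. \<not> acyclic_at V A i k}) \<and>
    (\<forall>k. \<forall>f\<in>A k. \<forall>b<n. lookup (f b) 0 = 0)"

text \<open>Finiteness in index \<open>i\<close> for the kernel comes from index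
  \<open>i + 1\<close> for \<open>A\<close>; for this reason \<open>resolvable\<close> demands all
  indices at once.\<close>

lemma resolvable_step:
  assumes V: "finite V" and A: "resolvable V n d A"
  shows "\<exists>n' d' g A'. minimal_cover V n' d' g A A' \<and> resolvable V n' d' A'"
proof -
  obtain n' d' g A' where c: "minimal_cover V n' d' g A A'"
    using minimal_cover_exists[OF V] A unfolding resolvable_def by metis
  have "finite {k. \<not> acyclic_at V A' i k}" for i
  proof -
    have "{k. \<not> acyclic_at V A' i k} \<subseteq> (\<lambda>k. k + 1) ` {k. \<not> acyclic_at V A (Suc i) k}"
    proof
      fix k assume "k \<in> {k. \<not> acyclic_at V A' i k}"
      then have "\<not> acyclic_at V A (Suc i) (k - 1)" using acyclic_at_cover[OF V c, of i "k - 1"] by simp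
      then show "k \<in> (\<lambda>k. k + 1) ` {k. \<not> acyclic_at V A (Suc i) k}" by (intro image_eqI[of _ _ "k - 1"]) auto
    qed
    then show ?thesis using A finite_subset unfolding resolvable_def by blast
  qed
  then have "resolvable V n' d' A'"
    unfolding resolvable_def using cover_A'[OF V c] cover_ker[OF V c] cover_min[OF V c] by blast
  then show ?thesis using c by blast
qed

lemma resolution_sequence:
  fixes A :: "int \<Rightarrow> (nat \<Rightarrow> ('v, 'k::field) mpoly) set"
  assumes V: "finite V" and A: "resolvable V n d A"
  obtains N D GG AA where "N 0 = n" "D 0 = d" "AA 0 = A" "\<And>i. resolvable V (N i) (D i) (AA i)"
    "\<And>i. minimal_cover V (N (Suc i)) (D (Suc i)) (GG i) (AA i) (AA (Suc i))"
proof -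
  \<comment> \<open>Each state stores the matrix of the cover that produced it; the initial one is a
    dummy, hence the shifted index when the matrices are read off at the end.\<close>
  define P where "P i x = (case x of (m, e, g :: nat \<Rightarrow> nat \<Rightarrow> ('v, 'k) mpoly, B) \<Rightarrow>
    resolvable V m e B \<and> (i = 0 \<longrightarrow> m = n \<and> e = d \<and> B = A))" for i :: nat and x :: "_ \<times> _ \<times> _ \<times> (int \<Rightarrow> (nat \<Rightarrow> ('v, 'k) mpoly) set)"
  define Q where "Q x y = (case x of (m, e, g :: nat \<Rightarrow> nat \<Rightarrow> ('v, 'k) mpoly, B) \<Rightarrow> case y of (m', e', g', B') \<Rightarrow>
    minimal_cover V m' e' g' B B')" for x :: "nat \<times> (nat \<Rightarrow> int) \<times> _ \<times> (int \<Rightarrow> (nat \<Rightarrow> ('v, 'k) mpoly) set)" and y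
  have "\<exists>f. \<forall>i. P i (f i) \<and> Q (f i) (f (Suc i))"
  proof (rule dependent_nat_choice)
    show "\<exists>x. P 0 x" using A by (auto simp: P_def)
    fix x i assume "P i x"
    then show "\<exists>y. P (Suc i) y \<and> Q x y"
      using resolvable_step[OF V] by (cases x) (fastforce simp: P_def Q_def)
  qed
  then obtain f where f: "\<And>i. P i (f i)" "\<And>i. Q (f i) (f (Suc i))" by blast
  show ?thesis
  proof (rule that[of "\<lambda>i. fst (f i)" "\<lambda>i. fst (snd (f i))" "\<lambda>i. snd (snd (snd (f i)))" "\<lambda>i. fst (snd (snd (f (Suc i))))"])
    show "fst (f 0) = n" "fst (snd (f 0)) = d" "snd (snd (snd (f 0))) = A"
      using f(1)[of 0] by (auto simp: P_def split: prod.splits)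
    show "resolvable V (fst (f i)) (fst (snd (f i))) (snd (snd (snd (f i))))" for i
      using f(1)[of i] by (auto simp: P_def split: prod.splits)
    show "minimal_cover V (fst (f (Suc i))) (fst (snd (f (Suc i)))) (fst (snd (snd (f (Suc i)))))
      (snd (snd (snd (f i)))) (snd (snd (snd (f (Suc i)))))" for i
      using f(2)[of i] by (auto simp: Q_def split: prod.splits)
  qed
qed

locale poly_ideal =
  fixes V :: "'v set" and I :: "('v, 'k::field) mpoly set"
  assumes ideal: "ideal I (poly_ring V)"
begin

abbreviation "R \<equiv> poly_ring V :: ('v, 'k) mpoly ring"
abbreviation "M \<equiv> quotient_module R I"

sublocale R: cring R by (rule cring_poly_ring)
sublocale I: ideal I R by (rule ideal)

lemma minus_eq: "q \<in> carrier R \<Longrightarrow> p \<ominus>\<^bsub>R\<^esub> q = p - q"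
proof -
  assume q: "q \<in> carrier R"
  have "\<ominus>\<^bsub>R\<^esub> q = - q" using q by (intro R.minus_equality) (auto intro: poly_ring_closed)
  then show ?thesis by (simp add: a_minus_def)
qed

lemma coset_eq_iff: "p \<in> carrier R \<Longrightarrow> q \<in> carrier R \<Longrightarrow> I +>\<^bsub>R\<^esub> p = I +>\<^bsub>R\<^esub> q \<longleftrightarrow> p - q \<in> I"
  using R.quotient_eq_iff_same_a_r_cos[OF ideal, of p q] minus_eq by simp

lemma coset_0: "I +>\<^bsub>R\<^esub> 0 = I"
  using I.a_rcos_const[OF additive_subgroup.zero_closed[OF I.additive_subgroup_axioms]] by simp

lemma coset_zero_iff: "p \<in> carrier R \<Longrightarrow> I +>\<^bsub>R\<^esub> p = I \<longleftrightarrow> p \<in> I"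
  using coset_eq_iff[of p 0] by (simp add: coset_0 poly_ring_closed)

lemma qm_carrier: "carrier M = {I +>\<^bsub>R\<^esub> p | p. p \<in> carrier R}"
  by (auto simp: quotient_module_def FactRing_def A_RCOSETS_def')

lemma qm_zero: "zero M = I"
  by (simp add: quotient_module_def FactRing_def)

lemma qm_add: "p \<in> carrier R \<Longrightarrow> q \<in> carrier R \<Longrightarrow>
    (I +>\<^bsub>R\<^esub> p) \<oplus>\<^bsub>M\<^esub> (I +>\<^bsub>R\<^esub> q) = I +>\<^bsub>R\<^esub> (p + q)"
  using I.a_rcos_sum[of p q] by (simp add: quotient_module_def FactRing_def)

lemma qm_smult: "p \<in> carrier R \<Longrightarrow> q \<in> carrier R \<Longrightarrow>
    p \<odot>\<^bsub>M\<^esub> (I +>\<^bsub>R\<^esub> q) = I +>\<^bsub>R\<^esub> (p * q)"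
  using I.rcoset_mult_add[of p q] by (simp add: quotient_module_def FactRing_def)

end

section \<open>Homomorphisms on free modules as matrices\<close>

definition unit_vec :: "nat \<Rightarrow> nat \<Rightarrow> ('v, 'k::field) mpoly" where
  "unit_vec b = (\<lambda>c. if c = b then 1 else 0)"

lemma unit_vec_in: "b < n \<Longrightarrow> unit_vec b \<in> free_grading V n d (d b)"
  by (auto simp: unit_vec_def free_grading_iff homogeneous_part_closed)

text \<open>Proved by induction over truncations of \<open>f\<close>, one coordinate at a time.
  Arbitrary resolutions thereby become matrices to which the results on covers apply.\<close>

lemma module_hom_mat:
  fixes \<phi> :: "(nat \<Rightarrow> ('v, 'k::field) mpoly) \<Rightarrow> nat \<Rightarrow> ('v, 'k) mpoly"
  assumes \<phi>: "\<phi> \<in> Defs.module_hom (poly_ring V) (free_module (poly_ring V) n) (free_module (poly_ring V) m)"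
    and f: "f \<in> carrier (free_module (poly_ring V) n)"
  shows "\<phi> f = mat n (\<lambda>b. \<phi> (unit_vec b)) f"
proof -
  have add: "\<phi> (\<lambda>b. x b + y b) = (\<lambda>b. \<phi> x b + \<phi> y b)"
    if "x \<in> carrier (free_module (poly_ring V) n)" "y \<in> carrier (free_module (poly_ring V) n)" for x y
    using \<phi> that unfolding Defs.module_hom_def by (auto simp: free_module_def)
  have smult: "\<phi> (\<lambda>b. p * x b) = (\<lambda>b. p * \<phi> x b)"
    if "p \<in> carrier (poly_ring V)" "x \<in> carrier (free_module (poly_ring V) n)" for p x
    using \<phi> that unfolding Defs.module_hom_def by (auto simp: free_module_def)
  have unit: "unit_vec b \<in> carrier (free_module (poly_ring V :: ('v, 'k) mpoly ring) n)" if "b < n" for b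
    using unit_vec_in[OF that, of V "\<lambda>_. 0"] free_grading_carrier by blast
  have tr: "(\<lambda>b. if b < k then f b else 0) \<in> carrier (free_module (poly_ring V) n)" for k
    using f by (auto simp: free_module_carrier_iff poly_ring_closed)
  have "\<phi> (\<lambda>b. if b < k then f b else 0) = (\<lambda>c. \<Sum>b<k. f b * \<phi> (unit_vec b) c)" if "k \<le> n" for k
    using that
  proof (induction k)
    case 0
    have "\<phi> (\<lambda>b. 0) c + 0 = \<phi> (\<lambda>b. 0) c + \<phi> (\<lambda>b. 0) c" for c
      using fun_cong[OF add[OF tr[of 0] tr[of 0]], of c] by simp
    then show ?case by (auto simp: fun_eq_iff)
  next
    case (Suc k)
    have "(\<lambda>b. if b < Suc k then f b else 0) = (\<lambda>b. (if b < k then f b else 0) + f k * unit_vec k b)"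
      by (auto simp: fun_eq_iff unit_vec_def less_Suc_eq)
    moreover have "f k \<in> carrier (poly_ring V)" using f Suc.prems by (auto simp: free_module_carrier_iff)
    ultimately show ?case
      using Suc add[OF tr[of k], of "\<lambda>b. f k * unit_vec k b"] smult[of "f k" "unit_vec k"] unit[of k]
        free_module_closed(3)[of "f k" V "unit_vec k" n]
      by auto
  qed
  from this[of n] have "\<phi> (\<lambda>b. if b < n then f b else 0) = mat n (\<lambda>b. \<phi> (unit_vec b)) f"
    by (simp add: mat_def)
  moreover have "(\<lambda>b. if b < n then f b else 0) = f" using f by (auto simp: fun_eq_iff free_module_carrier_iff)
  ultimately show ?thesis by simp
qed

lemma mat_module_hom:
  assumes "\<And>f. f \<in> carrier (free_module (poly_ring V) n) \<Longrightarrow> mat n g f \<in> carrier (free_module (poly_ring V) m)"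
  shows "mat n g \<in> Defs.module_hom (poly_ring V) (free_module (poly_ring V) n) (free_module (poly_ring V) m)"
  using assms unfolding Defs.module_hom_def
  by (auto simp: free_module_def mat_mult mat_add[unfolded plus_fun_def])

lemma (in poly_ideal) aug_mat:
  assumes \<phi>: "\<phi> \<in> Defs.module_hom R (free_module R n) M"
    and p: "\<And>b. b < n \<Longrightarrow> p b \<in> carrier R" "\<And>b. b < n \<Longrightarrow> \<phi> (unit_vec b) = I +>\<^bsub>R\<^esub> p b"
    and f: "f \<in> carrier (free_module R n)"
  shows "\<phi> f = I +>\<^bsub>R\<^esub> (\<Sum>b<n. f b * p b)"
proof -
  have add: "\<phi> (\<lambda>b. x b + y b) = \<phi> x \<oplus>\<^bsub>M\<^esub> \<phi> y"
    if "x \<in> carrier (free_module R n)" "y \<in> carrier (free_module R n)" for x y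
    using \<phi> that unfolding Defs.module_hom_def by (auto simp: free_module_def)
  have smult: "\<phi> (\<lambda>b. q * x b) = q \<odot>\<^bsub>M\<^esub> \<phi> x"
    if "q \<in> carrier R" "x \<in> carrier (free_module R n)" for q x
    using \<phi> that unfolding Defs.module_hom_def by (auto simp: free_module_def)
  have unit: "unit_vec b \<in> carrier (free_module R n)" if "b < n" for b
    using unit_vec_in[OF that, of V "\<lambda>_. 0"] free_grading_carrier by blast
  have tr: "(\<lambda>b. if b < k then f b else 0) \<in> carrier (free_module R n)" for k
    using f by (auto simp: free_module_carrier_iff poly_ring_closed)
  have fc: "f b \<in> carrier R" if "b < n" for b using f that by (auto simp: free_module_carrier_iff)
  have sc: "(\<Sum>b<k. f b * p b) \<in> carrier R" if "k \<le> n" for k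
    using that by (intro poly_ring_sum poly_ring_closed(6) fc p) auto
  have "\<phi> (\<lambda>b. if b < k then f b else 0) = I +>\<^bsub>R\<^esub> (\<Sum>b<k. f b * p b)" if "k \<le> n" for k
    using that
  proof (induction k)
    case 0
    have "\<phi> (\<lambda>b. 0) \<in> carrier M" using \<phi> tr[of 0] unfolding Defs.module_hom_def by auto
    then obtain q where q: "q \<in> carrier R" "\<phi> (\<lambda>b. 0) = I +>\<^bsub>R\<^esub> q" unfolding qm_carrier by blast
    have "0 \<odot>\<^bsub>M\<^esub> \<phi> (\<lambda>b. 0) = \<phi> (\<lambda>b. 0)"
      using smult[OF poly_ring_closed(1) tr[of 0]] by simp
    then show ?case using q by (simp add: qm_smult poly_ring_closed)
  next
    case (Suc k)
    have eq: "(\<lambda>b. if b < Suc k then f b else 0) = (\<lambda>b. (if b < k then f b else 0) + f k * unit_vec k b)"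
      by (auto simp: fun_eq_iff unit_vec_def less_Suc_eq)
    have k: "k < n" using Suc.prems by simp
    have "\<phi> (\<lambda>b. if b < Suc k then f b else 0) = \<phi> (\<lambda>b. if b < k then f b else 0) \<oplus>\<^bsub>M\<^esub> \<phi> (\<lambda>b. f k * unit_vec k b)"
      unfolding eq by (rule add[OF tr free_module_closed(3)[OF fc[OF k] unit[OF k]]])
    also have "\<phi> (\<lambda>b. f k * unit_vec k b) = I +>\<^bsub>R\<^esub> (f k * p k)"
      using smult[OF fc[OF k] unit[OF k]] by (simp add: p k qm_smult fc)
    also have "\<phi> (\<lambda>b. if b < k then f b else 0) = I +>\<^bsub>R\<^esub> (\<Sum>b<k. f b * p b)" using Suc by simp
    finally show ?case
      using qm_add[OF sc[of k] poly_ring_closed(6)[OF fc[OF k] p(1)[OF k]]] k by simp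
  qed
  from this[of n] have "\<phi> (\<lambda>b. if b < n then f b else 0) = I +>\<^bsub>R\<^esub> (\<Sum>b<n. f b * p b)" by simp
  moreover have "(\<lambda>b. if b < n then f b else 0) = f" using f by (auto simp: fun_eq_iff free_module_carrier_iff)
  ultimately show ?thesis by simp
qed

text \<open>\<open>{} \<notin> E\<close> keeps the ideal proper: otherwise the monomial 1 would
  belong to it.\<close>

locale edge_ideal_quotient = poly_ideal V I
  for V :: "'v set" and I :: "('v, 'k::field) mpoly set" +
  fixes E :: "'v set set"
  assumes finite_V: "finite V" and E_nonempty: "{} \<notin> E"
    and I_eq: "I = {p \<in> carrier (poly_ring V). \<forall>m. lookup p m \<noteq> 0 \<longrightarrow> dep_monomial E m}"
begin

lemma edge_pieces_iff: "p \<in> edge_pieces V E k \<longleftrightarrow> p \<in> homogeneous_part V k \<and> p \<in> I"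
  unfolding I_eq monomial_pieces_def using homogeneous_part_carrier by blast

lemma I_const: "p \<in> I \<Longrightarrow> lookup p 0 = 0"
  using E_nonempty unfolding I_eq dep_monomial_def indep_def by auto

lemma I_closed:
  "0 \<in> I" "p \<in> I \<Longrightarrow> q \<in> I \<Longrightarrow> p + q \<in> I"
  "p \<in> I \<Longrightarrow> q \<in> carrier R \<Longrightarrow> q * p \<in> I"
  using additive_subgroup.zero_closed[OF I.additive_subgroup_axioms]
    additive_subgroup.a_closed[OF I.additive_subgroup_axioms, of p q] I.I_l_closed[of p q] by auto

lemma I_hcomp: "p \<in> I \<Longrightarrow> hcomp k p \<in> I"
  unfolding I_eq by (auto simp: lookup_hcomp carrier_poly_ring_iff)

text \<open>The ideal as a graded submodule of the free module of rank one.\<close>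

definition IV :: "int \<Rightarrow> (nat \<Rightarrow> ('v, 'k) mpoly) set" where
  "IV k = {f. f 0 \<in> edge_pieces V E k \<and> (\<forall>b\<ge>1. f b = 0)}"

lemma IV_chain_0: "c \<in> chains V (IV k) i \<Longrightarrow> b \<ge> 1 \<Longrightarrow> c \<tau> b = 0"
  by (cases "\<tau> \<subseteq> V \<and> card \<tau> = i") (auto simp: chains_def IV_def split: if_splits)

lemma acyclic_at_IV: "acyclic_at V IV i k \<longleftrightarrow> kvanishes V (edge_pieces V E :: int \<Rightarrow> ('v, 'k) mpoly set) i k"
proof
  assume ac: "acyclic_at V IV i k"
  show "kvanishes V (edge_pieces V E :: int \<Rightarrow> ('v, 'k) mpoly set) i k"
    unfolding kvanishes_def
  proof (intro ballI impI)
    fix c :: "'v set \<Rightarrow> ('v, 'k) mpoly"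
    assume c: "c \<in> chains V (edge_pieces V E k) i" "\<forall>\<tau>. kz V c \<tau> = 0"
    let ?C = "\<lambda>\<sigma> b. if b = (0::nat) then c \<sigma> else 0"
    have "?C \<in> chains V (IV k) i" using c(1) by (auto simp: chains_def IV_def fun_eq_iff split: if_splits)
    moreover have "KZ V ?C \<tau> = 0" for \<tau>
    proof
      fix b show "KZ V ?C \<tau> b = 0 b" using c(2) by (cases "b = 0") (auto simp: KZ_def kz_def koszul_bd_def)
    qed
    ultimately obtain g where g: "g \<in> chains V (IV (k - 1)) (Suc i)" "\<And>\<tau>. KZ V g \<tau> = ?C \<tau>"
      using ac unfolding acyclic_at_def by blast
    have "(\<lambda>\<sigma>. g \<sigma> 0) \<in> chains V (edge_pieces V E (k - 1)) (Suc i)"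
      using g(1) by (auto simp: chains_def IV_def split: if_splits)
    moreover have "kz V (\<lambda>\<sigma>. g \<sigma> 0) \<tau> = c \<tau>" for \<tau>
      using fun_cong[OF g(2)[of \<tau>], of 0] by (simp add: KZ_def)
    ultimately show "\<exists>g\<in>chains V (edge_pieces V E (k - 1)) (Suc i). \<forall>\<tau>. kz V g \<tau> = c \<tau>" by blast
  qed
next
  assume van: "kvanishes V (edge_pieces V E :: int \<Rightarrow> ('v, 'k) mpoly set) i k"
  show "acyclic_at V IV i k"
    unfolding acyclic_at_def
  proof (intro ballI impI)
    fix c assume c: "c \<in> chains V (IV k) i" "\<forall>\<tau>. KZ V c \<tau> = 0"
    have "(\<lambda>\<sigma>. c \<sigma> 0) \<in> chains V (edge_pieces V E k) i"
      using c(1) by (auto simp: chains_def IV_def split: if_splits)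
    moreover have "kz V (\<lambda>\<sigma>. c \<sigma> 0) \<tau> = 0" for \<tau>
      using c(2) by (auto simp: KZ_def fun_eq_iff)
    ultimately obtain g where g: "g \<in> chains V (edge_pieces V E (k - 1)) (Suc i)" "\<And>\<tau>. kz V g \<tau> = c \<tau> 0"
      using van unfolding kvanishes_def by blast
    let ?G = "\<lambda>\<sigma> b. if b = (0::nat) then g \<sigma> else 0"
    have "?G \<in> chains V (IV (k - 1)) (Suc i)" using g(1) by (auto simp: chains_def IV_def fun_eq_iff split: if_splits)
    moreover have "KZ V ?G \<tau> = c \<tau>" for \<tau>
    proof
      fix b show "KZ V ?G \<tau> b = c \<tau> b"
        using g(2) IV_chain_0[OF c(1), of b \<tau>] by (cases "b = 0") (auto simp: KZ_def kz_def koszul_bd_def)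
    qed
    ultimately show "\<exists>g\<in>chains V (IV (k - 1)) (Suc i). \<forall>\<tau>. KZ V g \<tau> = c \<tau>" by blast
  qed
qed

lemma IV_sub: "IV k \<subseteq> free_grading V 1 (\<lambda>_. 0) k"
  by (auto simp: IV_def free_grading_iff edge_pieces_iff)

text \<open>Hochster's formula confines nonzero homology in index \<open>i\<close> to the finitely
  many coefficient degrees \<open>card W - i\<close> with \<open>W\<close> a subset of
  \<open>V\<close>.\<close>

lemma resolvable_IV: "resolvable V 1 (\<lambda>_. 0) IV"
  unfolding resolvable_def
proof (intro conjI allI ballI impI)
  show "graded_submodule V IV"
    unfolding graded_submodule_def
  proof (intro conjI allI ballI)
    show "0 \<in> IV k" for k by (simp add: IV_def edge_pieces_iff homogeneous_part_closed I_closed)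
    show "f + g \<in> IV k" if "f \<in> IV k" "g \<in> IV k" for k f g
      using that by (simp add: IV_def edge_pieces_iff homogeneous_part_closed I_closed)
    show "(\<lambda>b. p * f b) \<in> IV (j + k)" if "p \<in> homogeneous_part V j" "f \<in> IV k" for j k p f
      using that I_closed(3)[of "f 0" p] homogeneous_part_carrier[OF that(1)]
      by (auto simp: IV_def edge_pieces_iff intro: homogeneous_part_mult)
  qed
  show "IV k \<subseteq> free_grading V 1 (\<lambda>_. 0) k" for k by (rule IV_sub)
  show "finite {k. \<not> acyclic_at V IV i k}" for i
  proof (rule finite_subset)
    show "{k. \<not> acyclic_at V IV i k} \<subseteq> (\<lambda>c. int c - int i) ` {..card V}"
    proof
      fix k assume "k \<in> {k. \<not> acyclic_at V IV i k}"
      then have "\<not> kvanishes V (edge_pieces V E :: int \<Rightarrow> ('v, 'k) mpoly set) i k" by (simp add: acyclic_at_IV)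
      then obtain W where "W \<subseteq> V" "int (card W) = k + int i"
        using kvanishes_edge_pieces[OF finite_V E_nonempty] by blast
      then show "k \<in> (\<lambda>c. int c - int i) ` {..card V}"
        using card_mono[OF finite_V] by (intro image_eqI[of _ _ "card W"]) auto
    qed
  qed simp
  show "lookup (f b) 0 = 0" if "f \<in> IV k" "b < 1" for k f b
    using that I_const by (simp add: IV_def edge_pieces_iff)
qed

lemma total_IV: "total_module V 1 (\<lambda>_. 0) IV = {f \<in> carrier (free_module R 1). f 0 \<in> I}"
proof (intro equalityI subsetI)
  fix f assume "f \<in> total_module V 1 (\<lambda>_. 0) IV"
  then have f: "f \<in> carrier (free_module R 1)" "\<And>k. hcomp k (f 0) \<in> I"
    by (auto simp: total_module_def IV_def vcomp_def edge_pieces_iff)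
  have "(\<Sum>j\<in>B. hcomp j (f 0)) \<in> I" for B
    by (induction B rule: infinite_finite_induct) (auto intro: I_closed f)
  from this[of "hdegs (f 0)"] have "f 0 \<in> I" by (simp add: sum_hcomp finite_hdegs)
  then show "f \<in> {f \<in> carrier (free_module R 1). f 0 \<in> I}" using f by auto
next
  fix f assume "f \<in> {f \<in> carrier (free_module R 1). f 0 \<in> I}"
  then show "f \<in> total_module V 1 (\<lambda>_. 0) IV"
    by (auto simp: total_module_def IV_def vcomp_def edge_pieces_iff free_module_carrier_iff
      intro: hcomp_in I_hcomp)
qed

text \<open>The free module of rank one covers the quotient with kernel \<open>IV\<close>, so this
  augmentation is followed by the successive covers starting from the ideal.\<close>

lemma minimal_resolution_exists:
  "\<exists>F. minimal_graded_free_resolution V M (quotient_grading V I) F"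
proof -
  obtain N D GG AA where init: "N 0 = 1" "D 0 = (\<lambda>_. 0)" "AA 0 = IV"
    and res: "\<And>i. resolvable V (N i) (D i) (AA i)"
    and cov: "\<And>i. minimal_cover V (N (Suc i)) (D (Suc i)) (GG i) (AA i) (AA (Suc i))"
    using resolution_sequence[OF finite_V resolvable_IV] by metis
  have sub: "AA i k \<subseteq> free_grading V (N i) (D i) k" for i k using res[of i] unfolding resolvable_def by blast
  define F where "F = \<lparr>res_rank = N, res_shift = D, res_aug = (\<lambda>f. I +>\<^bsub>R\<^esub> f 0),
    res_diff = (\<lambda>i. mat (N (Suc i)) (GG i))\<rparr>"
  have F: "res_rank F = N" "res_shift F = D" "res_aug F = (\<lambda>f. I +>\<^bsub>R\<^esub> f 0)"
    "res_diff F i = mat (N (Suc i)) (GG i)" for i by (simp_all add: F_def)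
  have image: "mat (N (Suc i)) (GG i) ` carrier (free_module R (N (Suc i))) = total_module V (N i) (D i) (AA i)" for i
    by (rule cover_image[OF finite_V cov sub])
  have kernel: "{f \<in> carrier (free_module R (N (Suc i))). mat (N (Suc i)) (GG i) f = 0}
    = total_module V (N (Suc i)) (D (Suc i)) (AA (Suc i))" for i
    by (rule cover_kernel[OF finite_V cov sub])
  have zero: "zero (free_module R n) = 0" for n by (auto simp: free_module_def)
  have mat_in: "mat (N (Suc i)) (GG i) f \<in> carrier (free_module R (N i))"
    if "f \<in> carrier (free_module R (N (Suc i)))" for f i
    using image[of i] that unfolding total_module_def by blast
  have f0: "f 0 \<in> carrier R" if "f \<in> carrier (free_module R 1)" for f
    using that by (simp add: free_module_carrier_iff)
  have ext1: "(\<lambda>b. if b = 0 then p else 0) \<in> carrier (free_module R 1)" if "p \<in> carrier R" for p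
    using that by (simp add: free_module_carrier_iff)
  have "graded_free_resolution V M (quotient_grading V I) F"
    unfolding graded_free_resolution_def res_module_def res_grading_def F zero
  proof (intro conjI allI)
    show "(\<lambda>f. I +>\<^bsub>R\<^esub> f 0) \<in> Defs.module_hom R (free_module R (N 0)) M"
      unfolding Defs.module_hom_def init
      using f0 by (auto simp: qm_carrier free_module_def qm_add qm_smult)
    show "mat (N (Suc i)) (GG i) \<in> Defs.module_hom R (free_module R (N (Suc i))) (free_module R (N i))" for i
      by (rule mat_module_hom) (rule mat_in)
    show "(\<lambda>f. I +>\<^bsub>R\<^esub> f 0) ` free_grading V (N 0) (D 0) j \<subseteq> quotient_grading V I j" for j
      unfolding init by (auto simp: quotient_grading_def free_grading_iff)
    show "mat (N (Suc i)) (GG i) ` free_grading V (N (Suc i)) (D (Suc i)) j \<subseteq> free_grading V (N i) (D i) j" for i j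
      using cover_in[OF finite_V cov] sub by blast
    show "(\<lambda>f. I +>\<^bsub>R\<^esub> f 0) ` carrier (free_module R (N 0)) = carrier M"
      unfolding init qm_carrier
    proof (intro equalityI subsetI)
      fix X assume "X \<in> {I +>\<^bsub>R\<^esub> p |p. p \<in> carrier R}"
      then obtain p where "p \<in> carrier R" "X = I +>\<^bsub>R\<^esub> p" by blast
      then show "X \<in> (\<lambda>f. I +>\<^bsub>R\<^esub> f 0) ` carrier (free_module R 1)"
        using ext1 by (intro image_eqI[of _ _ "\<lambda>b. if b = 0 then p else 0"]) auto
    qed (use f0 in auto)
    show "{f \<in> carrier (free_module R (N 0)). I +>\<^bsub>R\<^esub> f 0 = \<zero>\<^bsub>M\<^esub>} =
      mat (N (Suc 0)) (GG 0) ` carrier (free_module R (N 1))"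
      using image[of 0] f0 coset_zero_iff unfolding init total_IV qm_zero by auto
    show "{f \<in> carrier (free_module R (N (Suc i))). mat (N (Suc i)) (GG i) f = 0} =
      mat (N (Suc (Suc i))) (GG (Suc i)) ` carrier (free_module R (N (Suc (Suc i))))" for i
      unfolding kernel image ..
  qed
  moreover have "mat (N (Suc i)) (GG i) f b \<in> irrelevant_ideal V"
    if f: "f \<in> carrier (free_module R (N (Suc i)))" and b: "b < N i" for i f b
  proof -
    have t: "mat (N (Suc i)) (GG i) f \<in> total_module V (N i) (D i) (AA i)" using image f by blast
    \<comment> \<open>A constant in coordinate \<open>b\<close> has degree \<open>D i b\<close>, so
      this component alone decides the constant term.\<close>
    then have "vcomp (D i) (D i b) (mat (N (Suc i)) (GG i) f) \<in> AA i (D i b)" by (simp add: total_module_def)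
    then have "lookup (vcomp (D i) (D i b) (mat (N (Suc i)) (GG i) f) b) 0 = 0"
      using res[of i] b unfolding resolvable_def by blast
    then have "lookup (mat (N (Suc i)) (GG i) f b) 0 = 0" by (simp add: vcomp_def lookup_hcomp)
    moreover have "mat (N (Suc i)) (GG i) f b \<in> carrier R"
      using mat_in[OF f] b by (simp add: free_module_carrier_iff)
    ultimately show ?thesis by (simp add: irrelevant_ideal_eq)
  qed
  ultimately have "minimal_graded_free_resolution V M (quotient_grading V I) F"
    unfolding minimal_graded_free_resolution_def res_module_def F by blast
  then show ?thesis by blast
qed

end

text \<open>\<open>F\<close> is an arbitrary minimal resolution, so whatever is proved here holds
  for the one chosen by \<open>SOME\<close>.\<close>

locale minimal_resolution = edge_ideal_quotient V I E
  for V :: "'v set" and I :: "('v, 'k::field) mpoly set" and E +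
  fixes F :: "('v, 'k, ('v, 'k) mpoly set) free_complex"
  assumes F: "minimal_graded_free_resolution V M (quotient_grading V I) F"
begin

abbreviation "n \<equiv> res_rank F"
abbreviation "d \<equiv> res_shift F"
abbreviation "FM i \<equiv> free_module R (n i)"
abbreviation "Fgr i \<equiv> free_grading V (n i) (d i)"

lemma
  shows aug_hom: "res_aug F \<in> Defs.module_hom R (FM 0) M"
    and diff_hom: "res_diff F i \<in> Defs.module_hom R (FM (Suc i)) (FM i)"
    and aug_graded: "f \<in> Fgr 0 j \<Longrightarrow> res_aug F f \<in> quotient_grading V I j"
    and diff_graded: "f \<in> Fgr (Suc i) j \<Longrightarrow> res_diff F i f \<in> Fgr i j"
    and aug_surj: "res_aug F ` carrier (FM 0) = carrier M"
    and aug_exact: "{f \<in> carrier (FM 0). res_aug F f = I} = res_diff F 0 ` carrier (FM 1)"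
    and diff_exact: "{f \<in> carrier (FM (Suc i)). res_diff F i f = 0} = res_diff F (Suc i) ` carrier (FM (Suc (Suc i)))"
    and diff_min: "f \<in> carrier (FM (Suc i)) \<Longrightarrow> b < n i \<Longrightarrow> lookup (res_diff F i f b) 0 = 0"
proof -
  have zero: "zero (FM i) = 0" for i by (auto simp: free_module_def)
  note r = F[unfolded minimal_graded_free_resolution_def graded_free_resolution_def res_module_def
      res_grading_def zero qm_zero irrelevant_ideal_eq]
  note r1 = r[THEN conjunct1] and r2 = r[THEN conjunct2]
  note c1 = r1[THEN conjunct2] note c2 = c1[THEN conjunct2] note c3 = c2[THEN conjunct2]
  note c4 = c3[THEN conjunct2] note c5 = c4[THEN conjunct2] note c6 = c5[THEN conjunct2]
  show "res_aug F \<in> Defs.module_hom R (FM 0) M" by (rule r1[THEN conjunct1])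
  show "res_diff F i \<in> Defs.module_hom R (FM (Suc i)) (FM i)" by (rule c1[THEN conjunct1, THEN spec])
  show "f \<in> Fgr 0 j \<Longrightarrow> res_aug F f \<in> quotient_grading V I j"
    using c2[THEN conjunct1, THEN spec, of j] by blast
  show "f \<in> Fgr (Suc i) j \<Longrightarrow> res_diff F i f \<in> Fgr i j"
    using c3[THEN conjunct1, THEN spec, of i, THEN spec, of j] by blast
  show "res_aug F ` carrier (FM 0) = carrier M" by (rule c4[THEN conjunct1])
  show "{f \<in> carrier (FM 0). res_aug F f = I} = res_diff F 0 ` carrier (FM 1)" by (rule c5[THEN conjunct1])
  show "{f \<in> carrier (FM (Suc i)). res_diff F i f = 0} = res_diff F (Suc i) ` carrier (FM (Suc (Suc i)))"
    by (rule c6[THEN spec])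
  show "lookup (res_diff F i f b) 0 = 0" if "f \<in> carrier (FM (Suc i))" "b < n i"
    using r2[THEN spec, of i] that by blast
qed

definition "diff_gens i = (\<lambda>b. res_diff F i (unit_vec b))"

lemma diff_mat: "f \<in> carrier (FM (Suc i)) \<Longrightarrow> res_diff F i f = mat (n (Suc i)) (diff_gens i) f"
  unfolding diff_gens_def by (rule module_hom_mat[OF diff_hom])

text \<open>Homogeneous polynomial representatives of the images of the basis vectors; the
  augmentation itself only yields cosets.\<close>

definition aug_gens where "aug_gens = (SOME aug_gens. \<forall>b<n 0. aug_gens b \<in> homogeneous_part V (d 0 b) \<and> res_aug F (unit_vec b) = I +>\<^bsub>R\<^esub> aug_gens b)"

lemma aug_gens: "b < n 0 \<Longrightarrow> aug_gens b \<in> homogeneous_part V (d 0 b)" "b < n 0 \<Longrightarrow> res_aug F (unit_vec b) = I +>\<^bsub>R\<^esub> aug_gens b"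
proof -
  have "\<exists>aug_gens. \<forall>b<n 0. aug_gens b \<in> homogeneous_part V (d 0 b) \<and> res_aug F (unit_vec b) = I +>\<^bsub>R\<^esub> aug_gens b"
    using aug_graded[OF unit_vec_in[of _ "n 0" V "d 0"]] unfolding quotient_grading_def
    by (intro choice) blast
  from someI_ex[OF this] show "b < n 0 \<Longrightarrow> aug_gens b \<in> homogeneous_part V (d 0 b)"
    "b < n 0 \<Longrightarrow> res_aug F (unit_vec b) = I +>\<^bsub>R\<^esub> aug_gens b" unfolding aug_gens_def by blast+
qed

definition "aug_lift f = (\<Sum>b<n 0. f b * aug_gens b)"

lemma aug_eq: "f \<in> carrier (FM 0) \<Longrightarrow> res_aug F f = I +>\<^bsub>R\<^esub> aug_lift f"
  unfolding aug_lift_def by (rule aug_mat[OF aug_hom homogeneous_part_carrier[OF aug_gens(1)] aug_gens(2)])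

lemma aug_lift_hom: "f \<in> Fgr 0 k \<Longrightarrow> aug_lift f \<in> homogeneous_part V k"
  unfolding aug_lift_def
proof (rule homogeneous_part_sum)
  fix b assume f: "f \<in> Fgr 0 k" and b: "b \<in> {..<n 0}"
  then have "f b \<in> homogeneous_part V (k - d 0 b)" by (simp add: free_grading_iff)
  then show "f b * aug_gens b \<in> homogeneous_part V k" by (rule homogeneous_part_mult[OF _ aug_gens(1)]) (use b in auto)
qed

lemma aug_lift_carrier: "f \<in> carrier (FM 0) \<Longrightarrow> aug_lift f \<in> carrier R"
  unfolding aug_lift_def
  by (intro poly_ring_sum poly_ring_closed(6) homogeneous_part_carrier[OF aug_gens(1)])
    (auto simp: free_module_carrier_iff)

lemma aug_lift_diff: "aug_lift (f - f') = aug_lift f - aug_lift f'"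
  by (simp add: aug_lift_def left_diff_distrib sum_subtractf)

lemma aug_lift_mult: "aug_lift (\<lambda>b. q * f b) = q * aug_lift f"
  by (simp add: aug_lift_def sum_distrib_left mult.assoc)

text \<open>The graded kernel of the map leaving the \<open>i\<close>-th module; for
  \<open>i = 0\<close> that map is the augmentation, expressed through
  \<open>aug_lift\<close>.\<close>

definition "syz i k = (if i = 0 then {f \<in> Fgr 0 k. aug_lift f \<in> I}
    else {f \<in> Fgr i k. mat (n i) (diff_gens (i - 1)) f = 0})"

text \<open>By exactness a syzygy is in the image of the next differential, and minimality puts that
  image into the irrelevant ideal.\<close>

lemma syz_const: "f \<in> syz i k \<Longrightarrow> b < n i \<Longrightarrow> lookup (f b) 0 = 0"
proof -
  assume f: "f \<in> syz i k" and b: "b < n i"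
  have fc: "f \<in> carrier (FM i)" using f free_grading_carrier by (auto simp: syz_def split: if_splits)
  have "\<exists>x\<in>carrier (FM (Suc i)). f = res_diff F i x"
  proof (cases i)
    case 0
    then have "res_aug F f = I" using f fc aug_eq coset_zero_iff aug_lift_carrier by (auto simp: syz_def)
    then show ?thesis using aug_exact fc 0 by auto
  next
    case (Suc j)
    then have "res_diff F j f = 0" using f fc diff_mat[of f j] by (auto simp: syz_def)
    then show ?thesis using diff_exact[of j] fc Suc by auto
  qed
  then show ?thesis using diff_min b by blast
qed

lemma mat_syz: "mat (n (Suc i)) (diff_gens i) ` Fgr (Suc i) k = syz i k"
proof (intro equalityI subsetI)
  fix x assume "x \<in> mat (n (Suc i)) (diff_gens i) ` Fgr (Suc i) k"
  then obtain f where f: "f \<in> Fgr (Suc i) k" "x = mat (n (Suc i)) (diff_gens i) f" by blast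
  then have "x = res_diff F i f" using diff_mat[OF free_grading_carrier[OF f(1)]] by simp
  note f = f(1) this
  have x: "x \<in> Fgr i k" using diff_graded[OF f(1)] f(2) by simp
  then have x: "x \<in> Fgr i k" "x \<in> carrier (FM i)" by (auto intro: free_grading_carrier)
  have fc: "f \<in> carrier (FM (Suc i))" using f(1) by (rule free_grading_carrier)
  show "x \<in> syz i k"
  proof (cases i)
    case 0
    then have "res_aug F x = I" using aug_exact fc f(2) by auto
    then show ?thesis using x 0 aug_eq[of x] coset_zero_iff[OF aug_lift_carrier, of x] by (simp add: syz_def)
  next
    case (Suc j)
    then have "res_diff F j x = 0" using diff_exact[of j] fc f(2) by auto
    then show ?thesis using x Suc diff_mat[of x j] by (simp add: syz_def)
  qed
next
  fix x assume x: "x \<in> syz i k"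
  then have xF: "x \<in> Fgr i k" by (auto simp: syz_def split: if_splits)
  then have xc: "x \<in> carrier (FM i)" by (rule free_grading_carrier)
  have "\<exists>f\<in>carrier (FM (Suc i)). x = res_diff F i f"
  proof (cases i)
    case 0
    then have "res_aug F x = I" using x xc aug_eq coset_zero_iff aug_lift_carrier by (auto simp: syz_def)
    then show ?thesis using aug_exact xc 0 by auto
  next
    case (Suc j)
    then have "res_diff F j x = 0" using x xc diff_mat[of x j] by (auto simp: syz_def)
    then show ?thesis using diff_exact[of j] xc Suc by auto
  qed
  then obtain f where f: "f \<in> carrier (FM (Suc i))" "x = mat (n (Suc i)) (diff_gens i) f" using diff_mat by auto
  have gr: "mat (n (Suc i)) (diff_gens i) f \<in> Fgr i l" if "f \<in> Fgr (Suc i) l" for l f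
    using diff_graded[OF that] diff_mat[OF free_grading_carrier[OF that]] by simp
  \<comment> \<open>The given preimage may be inhomogeneous; its component of degree
    \<open>k\<close> still maps to \<open>x\<close>.\<close>
  have "x = vcomp (d i) k x" using vcomp_homogeneous[OF xF, of k] by simp
  also have "\<dots> = mat (n (Suc i)) (diff_gens i) (vcomp (d (Suc i)) k f)"
    unfolding f(2) by (rule vcomp_mat[OF gr f(1)])
  finally show "x \<in> mat (n (Suc i)) (diff_gens i) ` Fgr (Suc i) k" using vcomp_in[OF f(1)] by blast
qed

lemma syz_submodule: "graded_submodule V (syz 0)"
  unfolding graded_submodule_def
proof (intro conjI allI ballI)
  show "0 \<in> syz 0 k" for k
    using gs_0[OF graded_submodule_free, of V "n 0" "d 0" k] I_closed(1) by (simp add: syz_def aug_lift_def)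
  show "x + y \<in> syz 0 k" if "x \<in> syz 0 k" "y \<in> syz 0 k" for k x y
  proof -
    have "aug_lift (x + y) = aug_lift x + aug_lift y" by (simp add: aug_lift_def distrib_right sum.distrib)
    then show ?thesis using that gs_add[OF graded_submodule_free, of x V "n 0" "d 0" k y] I_closed(2)
      by (simp add: syz_def)
  qed
  show "(\<lambda>b. q * f b) \<in> syz 0 (j + k)" if "q \<in> homogeneous_part V j" "f \<in> syz 0 k" for j k q f
    using that gs_mult[OF graded_submodule_free that(1), of f "n 0" "d 0" k] I_closed(3) homogeneous_part_carrier[OF that(1)]
    by (simp add: syz_def aug_lift_mult)
qed

lemma cover: "minimal_cover V (n (Suc i)) (d (Suc i)) (diff_gens i) (syz i) (syz (Suc i))"
proof -
  have step: "minimal_cover V (n (Suc i)) (d (Suc i)) (diff_gens i) (syz i) (syz (Suc i))"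
    if "graded_submodule V (syz i)" for i
    unfolding minimal_cover_def
  proof (intro conjI allI ballI impI)
    show "mat (n (Suc i)) (diff_gens i) ` Fgr (Suc i) k = syz i k" for k by (rule mat_syz)
    show "syz (Suc i) k = {f \<in> Fgr (Suc i) k. mat (n (Suc i)) (diff_gens i) f = 0}" for k by (simp add: syz_def)
    show "lookup (f b) 0 = 0" if "f \<in> syz (Suc i) k" "b < n (Suc i)" for k f b
      by (rule syz_const[OF that])
  qed (rule that)
  \<comment> \<open>A cover presupposes that its target is a graded submodule and yields the same
    for its kernel, so the property climbs from \<open>syz 0\<close>.\<close>
  have "graded_submodule V (syz i)"
    by (induction i) (auto intro: syz_submodule cover_A'[OF finite_V step])
  then show ?thesis by (rule step)
qed

text \<open>Iterates the connecting isomorphism: each cover trades one syzygy step for one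
  homological index, the coefficient degree dropping by one.\<close>

lemma acyclic_syz: "acyclic_at V (syz i) 0 k \<longleftrightarrow> acyclic_at V (syz 0) i (k - int i)"
proof -
  have "acyclic_at V (syz i) j k \<longleftrightarrow> acyclic_at V (syz 0) (i + j) (k - int i)" for j k
  proof (induction i arbitrary: j k)
    case (Suc i)
    have "acyclic_at V (syz (Suc i)) j k \<longleftrightarrow> acyclic_at V (syz i) (Suc j) (k - 1)"
      using acyclic_at_cover[OF finite_V cover, of i j "k - 1"] by simp
    then show ?case using Suc[of "Suc j" "k - 1"] by (simp add: algebra_simps)
  qed simp
  from this[of 0 k] show ?thesis by simp
qed

text \<open>\<open>u\<close> is the degree-zero part of a preimage of 1. Minimality puts the differences
  \<open>unit_vec b - aug_gens b * u\<close> into \<open>\<mm>\<close> times the free module, and then degree reasons make them 0.\<close>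

lemma rank_one:
  obtains u where "u \<in> Fgr 0 0" "aug_lift u = 1" "\<And>b. b < n 0 \<Longrightarrow> d 0 b = 0"
    "\<And>f. f \<in> carrier (FM 0) \<Longrightarrow> f = (\<lambda>c. aug_lift f * u c)"
proof -
  have "I +>\<^bsub>R\<^esub> 1 \<in> carrier M" unfolding qm_carrier using poly_ring_closed(2) by blast
  then obtain u' where u': "u' \<in> carrier (FM 0)" "res_aug F u' = I +>\<^bsub>R\<^esub> 1"
    unfolding aug_surj[symmetric] by (metis (no_types, lifting) imageE)
  define u where "u = vcomp (d 0) 0 u'"
  have u: "u \<in> Fgr 0 0" unfolding u_def by (rule vcomp_in[OF u'(1)])
  have "aug_lift u' - 1 \<in> I"
    using u'(2) aug_eq[OF u'(1)] coset_eq_iff[OF aug_lift_carrier[OF u'(1)] poly_ring_closed(2)] by simp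
  then have "hcomp 0 (aug_lift u' - 1) \<in> I" by (rule I_hcomp)
  moreover have "hcomp 0 (aug_lift u' - 1) = aug_lift u - 1"
  proof -
    \<comment> \<open>Extracting degree 0 from a product with a homogeneous factor of degree
      \<open>l\<close> extracts degree \<open>-l\<close> from the other factor.\<close>
    have h: "hcomp 0 (f * q) = hcomp (0 - l) f * q"
      if "f \<in> carrier R" "q \<in> homogeneous_part V l" for f q l
    proof -
      have "hcomp 0 (f * q) = hcomp 0 ((\<Sum>j\<in>insert (0 - l) (hdegs f). hcomp j f) * q)"
        by (subst sum_hcomp) (auto simp: finite_hdegs)
      also have "\<dots> = (\<Sum>j\<in>insert (0 - l) (hdegs f). hcomp 0 (hcomp j f * q))"
        by (simp only: sum_distrib_right hcomp_sum)
      also have "\<dots> = (\<Sum>j\<in>insert (0 - l) (hdegs f). if j = 0 - l then hcomp (0 - l) f * q else 0)"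
      proof (intro sum.cong refl)
        fix j
        have "hcomp j f * q \<in> homogeneous_part V (j + l)"
          by (rule homogeneous_part_mult[OF hcomp_in[OF that(1)] that(2) refl])
        from hcomp_homogeneous[OF this, of 0]
        show "hcomp 0 (hcomp j f * q) = (if j = 0 - l then hcomp (0 - l) f * q else 0)" by auto
      qed
      also have "\<dots> = hcomp (0 - l) f * q" by (simp add: finite_hdegs)
      finally show ?thesis .
    qed
    have "hcomp 0 (aug_lift u') = aug_lift u"
      unfolding aug_lift_def hcomp_sum u_def vcomp_def
      by (intro sum.cong refl h) (use u'(1) aug_gens(1) in \<open>auto simp: free_module_carrier_iff\<close>)
    moreover have "hcomp 0 (aug_lift u' - 1) + hcomp 0 1 = hcomp 0 (aug_lift u')" by (simp flip: hcomp_add)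
    moreover have "hcomp 0 1 = (1 :: ('v, 'k) mpoly)"
      using hcomp_homogeneous[OF homogeneous_part_closed(7)[of V], of 0] by simp
    ultimately show ?thesis by (metis add_diff_cancel_right')
  qed
  ultimately have uI: "aug_lift u - 1 \<in> I" by simp
  have lift_u: "aug_lift u = 1"
  proof -
    have "aug_lift u - 1 \<in> homogeneous_part V 0" using aug_lift_hom[OF u] by (intro homogeneous_part_closed)
    from homogeneous_part_0[OF this] I_const[OF uI] show ?thesis by simp
  qed
  have unit: "d 0 b = 0 \<and> unit_vec b = (\<lambda>c. aug_gens b * u c)" if b: "b < n 0" for b
  proof -
    let ?r = "unit_vec b - (\<lambda>c. aug_gens b * u c)"
    have rF: "?r \<in> Fgr 0 (d 0 b)"
      by (intro gs_diff[OF graded_submodule_free] unit_vec_in[OF b] gs_mult[OF graded_submodule_free aug_gens(1)[OF b] u]) simp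
    have "aug_lift (unit_vec b) = (\<Sum>a<n 0. if a = b then aug_gens b else 0)"
      unfolding aug_lift_def by (rule sum.cong) (auto simp: unit_vec_def)
    then have "aug_lift (unit_vec b) = aug_gens b" using b by simp
    then have "aug_lift ?r = 0" unfolding aug_lift_diff aug_lift_mult by (simp add: lift_u)
    then have rA: "?r \<in> syz 0 (d 0 b)" using rF I_closed(1) by (simp add: syz_def)
    \<comment> \<open>Coordinate \<open>b\<close> of the difference has constant term 1 minus a
      multiple of that of \<open>aug_gens b\<close>, so the latter is nonzero and the homogeneous
      \<open>aug_gens b\<close> has degree 0.\<close>
    from syz_const[OF rA b] have "lookup (aug_gens b) 0 \<noteq> 0"
      by (auto simp: unit_vec_def lookup_minus lookup_mult_0)
    then have "d 0 b = 0" using homogeneous_part_const[OF aug_gens(1)[OF b]] by blast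
    then have d0: "\<And>b. b < n 0 \<Longrightarrow> d 0 b = 0 \<or> lookup (aug_gens b) 0 = 0"
      using homogeneous_part_const[OF aug_gens(1)] by blast
    show ?thesis
    proof
      show "d 0 b = 0" by fact
      have "?r c = 0" for c
      proof (cases "c < n 0")
        case True
        let ?s = "unit_vec c - (\<lambda>a. aug_gens c * u a)"
        have "?s \<in> Fgr 0 (d 0 c)"
          by (intro gs_diff[OF graded_submodule_free] unit_vec_in[OF True] gs_mult[OF graded_submodule_free aug_gens(1)[OF True] u]) simp
        moreover have "aug_lift (unit_vec c) = aug_gens c"
        proof -
          have "aug_lift (unit_vec c) = (\<Sum>a<n 0. if a = c then aug_gens c else 0)"
            unfolding aug_lift_def by (rule sum.cong) (auto simp: unit_vec_def)
          then show ?thesis using True by simp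
        qed
        then have "aug_lift ?s = 0" unfolding aug_lift_diff aug_lift_mult by (simp add: lift_u)
        ultimately have "?s \<in> syz 0 (d 0 c)" using I_closed(1) by (simp add: syz_def)
        from syz_const[OF this True] have "lookup (aug_gens c) 0 \<noteq> 0"
          by (auto simp: unit_vec_def lookup_minus lookup_mult_0)
        then have "d 0 c = 0" using d0[OF True] by blast
        moreover have "?r c \<in> homogeneous_part V (d 0 b - d 0 c)"
          using rF True unfolding free_grading_iff by blast
        ultimately have "?r c \<in> homogeneous_part V 0" using \<open>d 0 b = 0\<close> by simp
        from homogeneous_part_0[OF this] syz_const[OF rA True] show ?thesis by simp
      next
        case False
        then show ?thesis using rF by (simp add: free_grading_iff)
      qed
      then show "unit_vec b = (\<lambda>c. aug_gens b * u c)" by (simp add: fun_eq_iff)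
    qed
  qed
  have "f = (\<lambda>c. aug_lift f * u c)" if f: "f \<in> carrier (FM 0)" for f
  proof
    fix c
    have "aug_lift f * u c = (\<Sum>b<n 0. f b * (aug_gens b * u c))" by (simp add: aug_lift_def sum_distrib_right mult.assoc)
    also have "\<dots> = (\<Sum>b<n 0. f b * unit_vec b c)"
      by (intro sum.cong refl) (use unit in \<open>simp add: fun_eq_iff\<close>)
    also have "\<dots> = (\<Sum>b<n 0. if b = c then f c else 0)"
      by (rule sum.cong) (auto simp: unit_vec_def)
    also have "\<dots> = f c" using f by (auto simp: free_module_carrier_iff)
    finally show "f c = aug_lift f * u c" ..
  qed
  then show ?thesis using that u lift_u unit by blast
qed

text \<open>The zeroth module is free on \<open>u\<close>, so \<open>aug_lift\<close> and
  multiplication by \<open>u\<close> are inverse isomorphisms between \<open>syz 0\<close> and the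
  ideal.\<close>

lemma acyclic_syz_IV: "acyclic_at V (syz 0) i k \<longleftrightarrow> acyclic_at V IV i k"
proof -
  obtain u where u: "u \<in> Fgr 0 0" "aug_lift u = 1" "\<And>f. f \<in> carrier (FM 0) \<Longrightarrow> f = (\<lambda>c. aug_lift f * u c)"
    using rank_one by metis
  define P where "P b c = (if c = (0::nat) then aug_gens b else 0)" for b c
  have P: "mat (n 0) P f = (\<lambda>c. if c = 0 then aug_lift f else 0)" for f
    by (rule ext) (simp add: mat_def P_def aug_lift_def)
  have U: "mat (Suc 0) (\<lambda>_. u) f = (\<lambda>c. f 0 * u c)" for f
    by (rule ext) (simp add: mat_def)
  have P_in: "mat (n 0) P f \<in> IV l" if "f \<in> syz 0 l" for f l
    using that aug_lift_hom by (simp add: P IV_def syz_def edge_pieces_iff)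
  have U_in: "mat 1 (\<lambda>_. u) f \<in> syz 0 l" if "f \<in> IV l" for f l
    using that gs_mult[OF graded_submodule_free _ u(1), of "f 0" l l] u(2)
    by (simp add: U IV_def syz_def edge_pieces_iff aug_lift_mult)
  have PU: "mat (n 0) P (mat 1 (\<lambda>_. u) f) = f" if "f \<in> IV l" for f l
    using that by (auto simp: P U aug_lift_mult u(2) IV_def fun_eq_iff)
  have UP: "mat 1 (\<lambda>_. u) (mat (n 0) P f) = f" if "f \<in> syz 0 l" for f l
  proof -
    have "f \<in> carrier (FM 0)" using that free_grading_carrier by (auto simp: syz_def)
    then show ?thesis using u(3)[of f] by (simp add: P U)
  qed
  show ?thesis
  proof
    assume "acyclic_at V (syz 0) i k"
    then show "acyclic_at V IV i k"
      by (rule acyclic_at_retract[where n = "n 0" and g = P and n' = 1 and g' = "\<lambda>_. u"])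
        (erule P_in U_in PU)+
  next
    assume "acyclic_at V IV i k"
    then show "acyclic_at V (syz 0) i k"
      by (rule acyclic_at_retract[where n' = "n 0" and g' = P and n = 1 and g = "\<lambda>_. u"])
        (erule P_in U_in UP)+
  qed
qed

lemma shift_0: "b < res_rank F 0 \<Longrightarrow> res_shift F 0 b = 0" "0 < res_rank F 0"
proof -
  obtain u where u: "aug_lift u = 1" "\<And>b. b < n 0 \<Longrightarrow> d 0 b = 0" using rank_one by metis
  show "b < res_rank F 0 \<Longrightarrow> res_shift F 0 b = 0" using u by blast
  show "0 < res_rank F 0" using u(1) by (cases "n 0 = 0") (auto simp: aug_lift_def)
qed

text \<open>Basis vectors of degree \<open>j\<close> in step \<open>i + 1\<close> are minimal
  generators of \<open>syz i\<close>, that is homology in index 0; moving down to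
  \<open>syz 0\<close> and on to the ideal gives index \<open>i\<close> and coefficient degree
  \<open>j - i\<close>.\<close>

lemma shift_Suc:
  "(\<exists>b<res_rank F (Suc i). res_shift F (Suc i) b = j) \<longleftrightarrow>
    \<not> kvanishes V (edge_pieces V E :: int \<Rightarrow> ('v, 'k) mpoly set) i (j - int i)"
  using acyclic_at_0_cover[OF finite_V cover, of i j] acyclic_syz[of i j] acyclic_syz_IV acyclic_at_IV by auto

end

section \<open>Regularity of the edge ideal between the two matching invariants\<close>

theorem corollary3p8:
  fixes G :: "'v graph"
  assumes "finite_simple_graph G"
  shows "int (ind_match_K2_C5 G)
           \<le> reg_quotient (verts G) (edge_ideal G :: ('v, 'k::field) mpoly set)
       \<and> reg_quotient (verts G) (edge_ideal G :: ('v, 'k::field) mpoly set)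
           \<le> int (min_match_K2_C5 G)"
proof -
  let ?V = "verts G" and ?E = "edges G"
  define I where "I = (edge_ideal G :: ('v, 'k) mpoly set)"
  have V: "finite ?V" using assms by (simp add: finite_simple_graph_def)
  interpret edge_ideal_quotient ?V I ?E
  proof (intro edge_ideal_quotient.intro poly_ideal.intro edge_ideal_quotient_axioms.intro)
    interpret R: cring "poly_ring ?V :: ('v, 'k) mpoly ring" by (rule cring_poly_ring)
    have "{var u * var v | u v. {u, v} \<in> ?E} \<subseteq> carrier (poly_ring ?V :: ('v, 'k) mpoly ring)"
    proof clarify
      fix u v assume e: "{u, v} \<in> ?E"
      have "u \<in> ?V" "v \<in> ?V" using finite_simple_graph_edgeE[OF assms e] by (auto simp: doubleton_eq_iff)
      then show "var u * var v \<in> carrier (poly_ring ?V :: ('v, 'k) mpoly ring)" by (intro poly_ring_closed)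
    qed
    then show "ideal I (poly_ring ?V)" unfolding I_def edge_ideal_def by (rule R.genideal_ideal)
    show "{} \<notin> ?E" using finite_simple_graph_edgeE[OF assms, of "{}"] by auto
    show "I = {p \<in> carrier (poly_ring ?V). \<forall>m. lookup p m \<noteq> 0 \<longrightarrow> dep_monomial ?E m}"
      unfolding I_def dep_monomial_def by (rule edge_ideal_eq[OF assms])
  qed (rule V)
  define F where "F = (SOME F. minimal_graded_free_resolution ?V M (quotient_grading ?V I) F)"
  interpret minimal_resolution ?V I ?E F
    by unfold_locales (unfold F_def, rule someI_ex[OF minimal_resolution_exists])
  have betti: "graded_betti ?V M (quotient_grading ?V I) i j \<noteq> 0 \<longleftrightarrow> (\<exists>b<res_rank F i. res_shift F i b = j)" for i j
    unfolding graded_betti_def F_def[symmetric] Let_def by auto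
  define S where "S = {j - int i | i j. graded_betti ?V M (quotient_grading ?V I) i j \<noteq> 0}"
  have reg: "reg_quotient ?V I = Max S"
    unfolding reg_quotient_def regularity_def S_def ..
  have upper: "0 \<le> s \<and> s \<le> int (min_match_K2_C5 G)" if "s \<in> S" for s
  proof -
    obtain i j b where ij: "s = j - int i" "b < res_rank F i" "res_shift F i b = j"
      using \<open>s \<in> S\<close> unfolding S_def betti by blast
    show ?thesis
    proof (cases i)
      case 0
      then show ?thesis using ij shift_0(1)[of b] by simp
    next
      case (Suc i')
      then have "\<not> kvanishes ?V (edge_pieces ?V ?E :: int \<Rightarrow> ('v, 'k) mpoly set) i' (j - int i')"
        using ij shift_Suc[of i' j] by blast
      then obtain W where W: "W \<subseteq> ?V" "int (card W) = j" "i' < card W"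
        "\<not> coh_vanishes ?E (csign ?V W :: _ \<Rightarrow> _ \<Rightarrow> 'k) W (card W - Suc i')"
        using kvanishes_edge_pieces[OF V E_nonempty, of "j - int i'" i'] by auto
      interpret field_sign_system ?V "csign ?V W :: _ \<Rightarrow> _ \<Rightarrow> 'k" by (rule sign_system_csign[OF V])
      \<comment> \<open>Since \<open>j = card W\<close> and \<open>i = Suc i'\<close>, the value
        \<open>s = j - i\<close> is precisely this cohomological level.\<close>
      have "card W - Suc i' \<le> min_match_K2_C5 G"
        using coh_vanishes_min_match[OF assms refl] W(1,4) unfolding vanishes_above_def by (meson not_le)
      then show ?thesis using ij W Suc by linarith
    qed
  qed
  then have fin: "finite S" by (intro finite_subset[of S "{0..int (min_match_K2_C5 G)}"]) auto
  \<comment> \<open>The generator of the quotient in degree 0; it makes \<open>S\<close> nonempty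
    and settles the edgeless case of the lower bound.\<close>
  have "0 \<in> S"
    unfolding S_def betti using shift_0 by force
  have "int (ind_match_K2_C5 G) \<in> S"
  proof (cases "?E = {}")
    case True
    then show ?thesis using \<open>0 \<in> S\<close> by (simp add: ind_match_K2_C5_def)
  next
    case False
    define n where "n = ind_match_K2_C5 G"
    obtain X E' where X: "k2c5 X E' n" "X \<subseteq> ?V" "X \<noteq> {}"
      "\<And>\<tau>. \<tau> \<subseteq> X \<Longrightarrow> indep ?E \<tau> \<longleftrightarrow> indep E' \<tau>"
      unfolding n_def by (rule ind_match_attained[OF assms False]) blast
    have less: "n < card X" by (rule k2c5_less_card[OF X(1,3)])
    \<comment> \<open>Chosen so that faces of size \<open>n\<close> in \<open>X\<close> are dual to
      homological index \<open>i\<close>; the Betti number in step \<open>i + 1\<close> and degree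
      \<open>card X\<close> then contributes \<open>card X - (i + 1) = n\<close>.\<close>
    define i where "i = card X - Suc n"
    have i: "i < card X" "card X - Suc i = n" using less by (auto simp: i_def)
    interpret field_sign_system ?V "csign ?V X :: _ \<Rightarrow> _ \<Rightarrow> 'k" by (rule sign_system_csign[OF V])
    have "\<not> coh_vanishes ?E (csign ?V X :: _ \<Rightarrow> _ \<Rightarrow> 'k) X (card X - Suc i)"
      unfolding i(2) by (rule k2c5_not_coh_vanishes[OF X(1,2,4)])
    then have "\<not> kvanishes ?V (edge_pieces ?V ?E :: int \<Rightarrow> ('v, 'k) mpoly set) i (int (card X) - int i)"
      by (intro not_kvanishes_edge_pieces[OF V X(2) _ i(1)]) auto
    then have "\<exists>b<res_rank F (Suc i). res_shift F (Suc i) b = int (card X)" by (simp add: shift_Suc)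
    then have "int (card X) - int (Suc i) \<in> S" unfolding S_def betti by blast
    moreover have "int (card X) - int (Suc i) = int n" using i less by (simp add: i_def)
    ultimately show ?thesis by (simp add: n_def)
  qed
  then have "int (ind_match_K2_C5 G) \<le> Max S" by (rule Max_ge[OF fin])
  moreover have "Max S \<le> int (min_match_K2_C5 G)"
    using upper fin \<open>0 \<in> S\<close> by (subst Max_le_iff) auto
  ultimately show ?thesis unfolding I_def[symmetric] reg by blast
qed

end
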